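(* Assume the system $\textsf{P}+\Pi^0_1\text{-}\textsf{TRANS}$ is consistent. Then $\textsf{P}+\Pi^0_1\text{-}\textsf{TRANS}$ does not prove $\textsf{STP}$.
   Context: Types: $0$ is the type of natural numbers, $1=0\to0$, $2=1\to0$, and $\tau^*$ is the type of finite sequences of objects of type $\tau$. $\textsf{E-PA}^{\omega*}$ is classical Peano arithmetic in all finite types with the axiom of extensionality, definitionally extended with the types $\tau^*$. The language of $\textsf{P}$ adds a predicate $\text{st}$ ("is standard") for every type. $(\forall^{\text{st}}x)A$ abbreviates $(\forall x)(\text{st}(x)\to A)$ and $(\exists^{\text{st}}x)A$ abbreviates $(\exists x)(\text{st}(x)\wedge A)$; a formula is internal if it does not involve $\text{st}$. The system $\textsf{P}$ consists of $\textsf{E-PA}^{\omega*}$ (axioms for internal formulas) plus: (1) $\text{st}(x)\wedge x=y\to\text{st}(y)$; $\text{st}(t)$ for every closed term $t$ of $\textsf{E-PA}^{\omega*}$; $\text{st}(f)\wedge\text{st}(x)\to\text{st}(f(x))$; (2) external induction: $\Phi(0)\wedge(\forall^{\text{st}}n^0)(\Phi(n)\to\Phi(n+1))\to(\forall^{\text{st}}n^0)\Phi(n)$ for every (possibly external) $\Phi$; (3) Idealisation $\textsf{I}$: $(\forall^{\text{st}}x^{\sigma^*})(\exists y^\tau)(\forall z^\sigma\in x)\varphi(z,y)\to(\exists y^\tau)(\forall^{\text{st}}x^\sigma)\varphi(x,y)$ for internal $\varphi$; (4) $\textsf{HAC}_{\textsf{int}}$: $(\forall^{\text{st}}x^\rho)(\exists^{\text{st}}y^\tau)\varphi(x,y)\to(\exists^{\text{st}}F^{\rho\to\tau^*})(\forall^{\text{st}}x^\rho)(\exists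 y^\tau\in F(x))\varphi(x,y)$ for internal $\varphi$. $\Pi^0_1\text{-}\textsf{TRANS}$: $(\forall^{\text{st}}f^1)\big[(\forall^{\text{st}}n^0)(f(n)\neq0)\to(\forall m^0)(f(m)\neq0)\big]$. $\textsf{STP}$: $(\forall\alpha^1\leq_11)(\exists^{\text{st}}\beta^1\leq_11)(\alpha\approx_1\beta)$, where $\alpha\leq_11$ means $\alpha(n)\le1$ for all $n$, and $\alpha\approx_1\beta$ means $(\forall^{\text{st}}n^0)(\alpha(n)=\beta(n))$. *)

theory Defs
  imports Main
begin

text \<open>
  A deep embedding of the nonstandard system \<open>P\<close>: the many-sorted language over all finite
  types with finite sequence types, classical first-order derivability, and the axioms.
  Variables are named and carry their type. Terms are combinatory, so binding occurs in
  formulas only. Theories are sets of (possibly open) formulas.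
\<close>

section \<open>Types and terms\<close>

datatype ty = Num | Fn ty ty (infixr "\<leadsto>" 65) | Sq ty

type_synonym var = "nat \<times> ty"

datatype cnst =
    Zero | Succ
  | CombK ty ty | CombS ty ty ty
  | Rec ty            \<comment> \<open>recursion on numbers\<close>
  | SNil ty | SCons ty
  | SRec ty ty        \<comment> \<open>recursion on finite sequences\<close>

datatype tm = Var var | Cn cnst | App tm tm (infixl "\<cdot>" 80)

primrec cty :: "cnst \<Rightarrow> ty" where
  "cty Zero = Num"
| "cty Succ = Num \<leadsto> Num"
| "cty (CombK \<sigma> \<tau>) = \<sigma> \<leadsto> \<tau> \<leadsto> \<sigma>"
| "cty (CombS \<rho> \<sigma> \<tau>) = (\<rho> \<leadsto> \<sigma> \<leadsto> \<tau>) \<leadsto> (\<rho> \<leadsto> \<sigma>) \<leadsto> \<rho> \<leadsto> \<tau>"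
| "cty (Rec \<rho>) = Num \<leadsto> \<rho> \<leadsto> (\<rho> \<leadsto> Num \<leadsto> \<rho>) \<leadsto> \<rho>"
| "cty (SNil \<sigma>) = Sq \<sigma>"
| "cty (SCons \<sigma>) = \<sigma> \<leadsto> Sq \<sigma> \<leadsto> Sq \<sigma>"
| "cty (SRec \<sigma> \<rho>) = Sq \<sigma> \<leadsto> \<rho> \<leadsto> (\<rho> \<leadsto> \<sigma> \<leadsto> \<rho>) \<leadsto> \<rho>"

text \<open>\<open>ty_of\<close> is meaningful on well-typed terms (\<open>wt\<close>) only; elsewhere its value is junk.\<close>

primrec ty_of :: "tm \<Rightarrow> ty" where
  "ty_of (Var x) = snd x"
| "ty_of (Cn c) = cty c"
| "ty_of (s \<cdot> t) = (case ty_of s of \<sigma> \<leadsto> \<tau> \<Rightarrow> \<tau> | _ \<Rightarrow> Num)"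

primrec wt :: "tm \<Rightarrow> bool" where
  "wt (Var x) \<longleftrightarrow> True"
| "wt (Cn c) \<longleftrightarrow> True"
| "wt (s \<cdot> t) \<longleftrightarrow> wt s \<and> wt t \<and> (\<exists>\<tau>. ty_of s = ty_of t \<leadsto> \<tau>)"

primrec fvt :: "tm \<Rightarrow> var set" where
  "fvt (Var x) = {x}"
| "fvt (Cn c) = {}"
| "fvt (s \<cdot> t) = fvt s \<union> fvt t"

primrec subst_tm :: "var \<Rightarrow> tm \<Rightarrow> tm \<Rightarrow> tm" where
  "subst_tm x u (Var y) = (if y = x then u else Var y)"
| "subst_tm x u (Cn c) = Cn c"
| "subst_tm x u (s \<cdot> t) = subst_tm x u s \<cdot> subst_tm x u t"

text \<open>An index such that no variable of that or a larger index occurs in the term.\<close>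

primrec fresh :: "tm \<Rightarrow> nat" where
  "fresh (Var x) = Suc (fst x)"
| "fresh (Cn c) = 0"
| "fresh (s \<cdot> t) = max (fresh s) (fresh t)"

abbreviation zero :: tm where "zero \<equiv> Cn Zero"
abbreviation suc :: "tm \<Rightarrow> tm" where "suc t \<equiv> Cn Succ \<cdot> t"

subsection \<open>Defined terms\<close>

text \<open>Lambda abstraction by the usual bracket abstraction.\<close>

primrec lam :: "var \<Rightarrow> tm \<Rightarrow> tm" where
  "lam x (Var y) =
     (if y = x then Cn (CombS (snd x) (snd x \<leadsto> snd x) (snd x)) \<cdot> Cn (CombK (snd x) (snd x \<leadsto> snd x))
                      \<cdot> Cn (CombK (snd x) (snd x))
      else Cn (CombK (snd y) (snd x)) \<cdot> Var y)"
| "lam x (Cn c) = Cn (CombK (cty c) (snd x)) \<cdot> Cn c"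
| "lam x (s \<cdot> t) = Cn (CombS (snd x) (ty_of t) (ty_of (s \<cdot> t))) \<cdot> lam x s \<cdot> lam x t"
lemma ty_of_lam [simp]: "ty_of (lam x t) = snd x \<leadsto> ty_of t"
  by (induction t) auto

lemma wt_lam [simp]: "wt t \<Longrightarrow> wt (lam x t)"
  by (induction t) auto

lemma fvt_lam [simp]: "fvt (lam x t) = fvt t - {x}"
  by (induction t) auto

definition plus_tm :: "tm \<Rightarrow> tm \<Rightarrow> tm" where
  "plus_tm s t = Cn (Rec Num) \<cdot> t \<cdot> s \<cdot> lam (0, Num) (lam (1, Num) (suc (Var (0, Num))))"

primrec dflt :: "ty \<Rightarrow> tm" where
  "dflt Num = zero"
| "dflt (\<sigma> \<leadsto> \<tau>) = Cn (CombK \<tau> \<sigma>) \<cdot> dflt \<tau>"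
| "dflt (Sq \<sigma>) = Cn (SNil \<sigma>)"

definition len :: "ty \<Rightarrow> tm \<Rightarrow> tm" where
  "len \<sigma> s = Cn (SRec \<sigma> Num) \<cdot> s \<cdot> zero \<cdot> lam (0, Num) (lam (1, \<sigma>) (suc (Var (0, Num))))"

text \<open>
  The \<open>i\<close>-th entry of \<open>s\<close>, counting from 0, with a default value if \<open>i\<close> is out of range:
  the sequence recursor builds a function of \<open>i\<close>, whose value on \<open>SCons x s\<close> is \<open>x\<close> at 0 and
  the recursively obtained function \<open>r\<close> at \<open>k\<close> if \<open>i = k + 1\<close>.
\<close>

definition entry :: "ty \<Rightarrow> tm \<Rightarrow> tm \<Rightarrow> tm" where
  "entry \<sigma> s i =
     (let r = (0, Num \<leadsto> \<sigma>); x = (1, \<sigma>); j = (2, Num); q = (3, \<sigma>); k = (4, Num)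
      in Cn (SRec \<sigma> (Num \<leadsto> \<sigma>)) \<cdot> s \<cdot> dflt (Num \<leadsto> \<sigma>)
           \<cdot> lam r (lam x (lam j (Cn (Rec \<sigma>) \<cdot> Var j \<cdot> Var x \<cdot> lam q (lam k (Var r \<cdot> Var k)))))
           \<cdot> i)"


section \<open>Formulas\<close>

datatype fm = Fls | Eq tm tm (infix "\<doteq>" 60) | St tm | Imp fm fm (infixr "\<^bold>\<longrightarrow>" 45) | Forall var fm

abbreviation Neg :: "fm \<Rightarrow> fm" where "Neg A \<equiv> A \<^bold>\<longrightarrow> Fls"
abbreviation Conj :: "fm \<Rightarrow> fm \<Rightarrow> fm" (infixr "\<^bold>\<and>" 55) where "A \<^bold>\<and> B \<equiv> Neg (A \<^bold>\<longrightarrow> Neg B)"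
abbreviation Disj :: "fm \<Rightarrow> fm \<Rightarrow> fm" (infixr "\<^bold>\<or>" 50) where "A \<^bold>\<or> B \<equiv> Neg A \<^bold>\<longrightarrow> B"
abbreviation Exists :: "var \<Rightarrow> fm \<Rightarrow> fm" where "Exists x A \<equiv> Neg (Forall x (Neg A))"
abbreviation ForallSt :: "var \<Rightarrow> fm \<Rightarrow> fm" where "ForallSt x A \<equiv> Forall x (St (Var x) \<^bold>\<longrightarrow> A)"
abbreviation ExistsSt :: "var \<Rightarrow> fm \<Rightarrow> fm" where "ExistsSt x A \<equiv> Exists x (St (Var x) \<^bold>\<and> A)"

primrec wf_fm :: "fm \<Rightarrow> bool" where
  "wf_fm Fls \<longleftrightarrow> True"
| "wf_fm (s \<doteq> t) \<longleftrightarrow> wt s \<and> wt t \<and> ty_of s = ty_of t"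
| "wf_fm (St t) \<longleftrightarrow> wt t"
| "wf_fm (A \<^bold>\<longrightarrow> B) \<longleftrightarrow> wf_fm A \<and> wf_fm B"
| "wf_fm (Forall x A) \<longleftrightarrow> wf_fm A"

primrec internal :: "fm \<Rightarrow> bool" where
  "internal Fls \<longleftrightarrow> True"
| "internal (s \<doteq> t) \<longleftrightarrow> True"
| "internal (St t) \<longleftrightarrow> False"
| "internal (A \<^bold>\<longrightarrow> B) \<longleftrightarrow> internal A \<and> internal B"
| "internal (Forall x A) \<longleftrightarrow> internal A"

primrec fv :: "fm \<Rightarrow> var set" where
  "fv Fls = {}"
| "fv (s \<doteq> t) = fvt s \<union> fvt t"
| "fv (St t) = fvt t"
| "fv (A \<^bold>\<longrightarrow> B) = fv A \<union> fv B"
| "fv (Forall x A) = fv A - {x}"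

text \<open>Substitution for free occurrences; it does not rename, cf. \<open>free_for\<close>.\<close>

primrec subst :: "var \<Rightarrow> tm \<Rightarrow> fm \<Rightarrow> fm" where
  "subst x u Fls = Fls"
| "subst x u (s \<doteq> t) = (subst_tm x u s \<doteq> subst_tm x u t)"
| "subst x u (St t) = St (subst_tm x u t)"
| "subst x u (A \<^bold>\<longrightarrow> B) = (subst x u A \<^bold>\<longrightarrow> subst x u B)"
| "subst x u (Forall y A) = (if y = x then Forall y A else Forall y (subst x u A))"

primrec free_for :: "tm \<Rightarrow> var \<Rightarrow> fm \<Rightarrow> bool" where
  "free_for u x Fls \<longleftrightarrow> True"
| "free_for u x (s \<doteq> t) \<longleftrightarrow> True"
| "free_for u x (St t) \<longleftrightarrow> True"
| "free_for u x (A \<^bold>\<longrightarrow> B) \<longleftrightarrow> free_for u x A \<and> free_for u x B"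
| "free_for u x (Forall y A) \<longleftrightarrow> x \<notin> fv (Forall y A) \<or> (y \<notin> fvt u \<and> free_for u x A)"

definition less_fm :: "tm \<Rightarrow> tm \<Rightarrow> fm" where
  "less_fm s t = (let k = (max (fresh s) (fresh t), Num) in Exists k (plus_tm s (suc (Var k)) \<doteq> t))"

definition le_fm :: "tm \<Rightarrow> tm \<Rightarrow> fm" where
  "le_fm s t = (let k = (max (fresh s) (fresh t), Num) in Exists k (plus_tm s (Var k) \<doteq> t))"

definition mem :: "tm \<Rightarrow> tm \<Rightarrow> fm" where
  "mem z s = (let i = (max (fresh z) (fresh s), Num); \<sigma> = ty_of z
              in Exists i (less_fm (Var i) (len \<sigma> s) \<^bold>\<and> z \<doteq> entry \<sigma> s (Var i)))"


section \<open>Classical derivability\<close>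

text \<open>Axioms of \<open>T\<close> may be open and are then read as universally closed.\<close>

inductive derivable :: "fm set \<Rightarrow> fm \<Rightarrow> bool" (infix "\<turnstile>" 40) for T where
  Axiom: "T \<turnstile> A" if "A \<in> T" "wf_fm A"
| ImpK: "T \<turnstile> A \<^bold>\<longrightarrow> B \<^bold>\<longrightarrow> A" if "wf_fm A" "wf_fm B"
| ImpS: "T \<turnstile> (A \<^bold>\<longrightarrow> B \<^bold>\<longrightarrow> C) \<^bold>\<longrightarrow> (A \<^bold>\<longrightarrow> B) \<^bold>\<longrightarrow> A \<^bold>\<longrightarrow> C"
    if "wf_fm A" "wf_fm B" "wf_fm C"
| DNeg: "T \<turnstile> Neg (Neg A) \<^bold>\<longrightarrow> A" if "wf_fm A"
| Inst: "T \<turnstile> Forall x A \<^bold>\<longrightarrow> subst x t A"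
    if "wf_fm A" "wt t" "ty_of t = snd x" "free_for t x A"
| AllImp: "T \<turnstile> Forall x (A \<^bold>\<longrightarrow> B) \<^bold>\<longrightarrow> A \<^bold>\<longrightarrow> Forall x B"
    if "wf_fm A" "wf_fm B" "x \<notin> fv A"
| MP: "T \<turnstile> B" if "T \<turnstile> A \<^bold>\<longrightarrow> B" "T \<turnstile> A"
| Gen: "T \<turnstile> Forall x A" if "T \<turnstile> A"

definition consistent :: "fm set \<Rightarrow> bool" where
  "consistent T \<longleftrightarrow> \<not> (T \<turnstile> Fls)"


section \<open>Peano arithmetic in all finite types, extensional, with sequence types\<close>

text \<open>
  Equality is primitive at every type. Ill-typed instances of the schemes below are harmless,
  as \<open>Axiom\<close> admits well-formed formulas only.
\<close>

inductive_set EPA :: "fm set" where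
  refl: "t \<doteq> t \<in> EPA"
| repl: "(s \<doteq> t \<^bold>\<longrightarrow> subst x s A \<^bold>\<longrightarrow> subst x t A) \<in> EPA"
    if "internal A" "free_for s x A" "free_for t x A" "ty_of s = snd x" "ty_of t = snd x"
| ext: "(Forall x (f \<cdot> Var x \<doteq> g \<cdot> Var x) \<^bold>\<longrightarrow> f \<doteq> g) \<in> EPA"
    if "x \<notin> fvt f" "x \<notin> fvt g"
| Suc_not_zero: "Neg (suc t \<doteq> zero) \<in> EPA"
| Suc_inj: "(suc s \<doteq> suc t \<^bold>\<longrightarrow> s \<doteq> t) \<in> EPA"
| num_induct: "(subst n zero A \<^bold>\<and> Forall n (A \<^bold>\<longrightarrow> subst n (suc (Var n)) A) \<^bold>\<longrightarrow> Forall n A) \<in> EPA"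
    if "internal A" "snd n = Num"
| K_eq: "Cn (CombK \<sigma> \<tau>) \<cdot> s \<cdot> t \<doteq> s \<in> EPA"
| S_eq: "Cn (CombS \<rho> \<sigma> \<tau>) \<cdot> r \<cdot> s \<cdot> t \<doteq> r \<cdot> t \<cdot> (s \<cdot> t) \<in> EPA"
| Rec_zero: "Cn (Rec \<rho>) \<cdot> zero \<cdot> y \<cdot> z \<doteq> y \<in> EPA"
| Rec_Suc: "Cn (Rec \<rho>) \<cdot> suc t \<cdot> y \<cdot> z \<doteq> z \<cdot> (Cn (Rec \<rho>) \<cdot> t \<cdot> y \<cdot> z) \<cdot> t \<in> EPA"
| SRec_Nil: "Cn (SRec \<sigma> \<rho>) \<cdot> Cn (SNil \<sigma>) \<cdot> y \<cdot> z \<doteq> y \<in> EPA"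
| SRec_Cons: "Cn (SRec \<sigma> \<rho>) \<cdot> (Cn (SCons \<sigma>) \<cdot> t \<cdot> s) \<cdot> y \<cdot> z
      \<doteq> z \<cdot> (Cn (SRec \<sigma> \<rho>) \<cdot> s \<cdot> y \<cdot> z) \<cdot> t \<in> EPA"
| Sq_cases: "(s \<doteq> Cn (SNil \<sigma>) \<^bold>\<or> Exists x (Exists a (s \<doteq> Cn (SCons \<sigma>) \<cdot> Var x \<cdot> Var a))) \<in> EPA"
    if "snd x = \<sigma>" "snd a = Sq \<sigma>" "x \<notin> fvt s" "a \<notin> fvt s"


section \<open>The system P\<close>

inductive_set SysP :: "fm set" where
  EPA: "A \<in> SysP" if "A \<in> EPA"
| St_eq: "(St s \<^bold>\<and> s \<doteq> t \<^bold>\<longrightarrow> St t) \<in> SysP"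
| St_closed: "St t \<in> SysP" if "fvt t = {}"
| St_App: "(St f \<^bold>\<and> St t \<^bold>\<longrightarrow> St (f \<cdot> t)) \<in> SysP"
| ext_induct:
    "(subst n zero A \<^bold>\<and> ForallSt n (A \<^bold>\<longrightarrow> subst n (suc (Var n)) A) \<^bold>\<longrightarrow> ForallSt n A) \<in> SysP"
    if "snd n = Num"
| Idealisation:
    "(ForallSt x (Exists y (Forall z (mem (Var z) (Var x) \<^bold>\<longrightarrow> A))) \<^bold>\<longrightarrow> Exists y (ForallSt z A)) \<in> SysP"
    if "internal A" "snd x = Sq (snd z)" "x \<notin> fv A" "x \<noteq> y" "y \<noteq> z"
| HAC_int:
    "(ForallSt x (ExistsSt y A) \<^bold>\<longrightarrow> ExistsSt F (ForallSt x (Exists y (mem (Var y) (Var F \<cdot> Var x) \<^bold>\<and> A)))) \<in> SysP"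
    if "internal A" "snd F = snd x \<leadsto> Sq (snd y)" "F \<notin> fv A" "x \<noteq> y"


section \<open>Transfer and the nonstandard counterpart of weak Koenig's lemma\<close>

definition TRANS :: fm where
  "TRANS = (let f = (0, Num \<leadsto> Num); n = (0, Num); m = (1, Num) in
     ForallSt f (ForallSt n (Neg (Var f \<cdot> Var n \<doteq> zero)) \<^bold>\<longrightarrow> Forall m (Neg (Var f \<cdot> Var m \<doteq> zero))))"

definition binary :: "var \<Rightarrow> fm" where
  "binary \<alpha> = (let n = (0, Num) in Forall n (le_fm (Var \<alpha> \<cdot> Var n) (suc zero)))"

definition approx :: "var \<Rightarrow> var \<Rightarrow> fm" where
  "approx \<alpha> \<beta> = (let n = (0, Num) in ForallSt n (Var \<alpha> \<cdot> Var n \<doteq> Var \<beta> \<cdot> Var n))"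

definition STP :: fm where
  "STP = (let \<alpha> = (0, Num \<leadsto> Num); \<beta> = (1, Num \<leadsto> Num) in
     Forall \<alpha> (binary \<alpha> \<^bold>\<longrightarrow> ExistsSt \<beta> (binary \<beta> \<^bold>\<and> approx \<alpha> \<beta>)))"

lemma ty_of_dflt [simp]: "ty_of (dflt \<tau>) = \<tau>" and wt_dflt [simp]: "wt (dflt \<tau>)"
  by (induction \<tau>) auto

lemma wf_mem: "wt z \<Longrightarrow> wt s \<Longrightarrow> ty_of s = Sq (ty_of z) \<Longrightarrow> wf_fm (mem z s)"
  by (simp add: mem_def less_fm_def plus_tm_def len_def entry_def Let_def)

lemma wf_TRANS: "wf_fm TRANS" and wf_STP: "wf_fm STP"
  by (simp_all add: TRANS_def STP_def binary_def approx_def le_fm_def plus_tm_def Let_def)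

lemma closed_TRANS: "fv TRANS = {}" and closed_STP: "fv STP = {}"
  by (auto simp: TRANS_def STP_def binary_def approx_def le_fm_def plus_tm_def Let_def)

end

theory Submission
  imports Defs "HOL-Library.Countable"
begin

text \<open>
  The proof is a Shoenfield-style functional interpretation of the system, read semantically: every
  formula is a game of challenges and responses, whose strategies are elements of a model of
  Peano arithmetic in all finite types, and all axioms including transfer have winning strategies.
  The model consists of the hereditarily extensional functionals over an applicative structure on
  a countable set. Two functionals of type 2 are added to that structure: Feferman's \<open>\<mu>\<close>, which
  realizes transfer, and a functional \<open>g\<close> that is injective on the functions of type 1 of the model.
  A realizer of the standard part principle, challenged with the positions \<open>g \<beta>\<close>, would yield
  finitely many functions \<open>\<beta>\<close> such that every binary \<open>\<alpha>\<close> agrees with one of them at \<open>g \<beta>\<close>. As \<open>g\<close>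
  is injective, putting \<open>\<alpha> (g \<beta>) \<noteq> \<beta> (g \<beta>)\<close> for these \<open>\<beta>\<close> gives a contradiction.
\<close>

section \<open>An applicative structure with an injective functional of type 2\<close>

text \<open>In the full set-theoretic type structure no functional of type 2 is injective on the
  uncountably many functions of type 1. Countably many codes leave room for one, but a function has
  many codes, so an extensional functional must first select one of them. Which functions have codes
  depends in turn on that functional, since programs may call it. The circle is broken by evaluating
  relative to an arbitrary partial selection of codes, in which evaluation is monotone, and by
  taking a maximal selection. The finiteness exploited at the end comes from uniformity: a realizer
  of the standard part principle never sees \<open>\<alpha>\<close>, so the candidates
  \<open>\<beta>\<close> that it offers are fixed before \<open>\<alpha>\<close> is chosen. The
  model itself has no nonstandard numbers; to be standard only means that a finite list containing
  the value has to be supplied.\<close>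

datatype val =
    VN nat | VP val val | VL "val list"
  | K0 | K1 val | S0 | S1 val | S2 val val
  | Suc0 | R0 | R1 val | R2 val val
  | Cons0 | Cons1 val | L0 | L1 val | L2 val val
  | P0 | P1 val | Fst0 | Snd0 | Mu0 | Orc0

instance val :: countable by countable_datatype

text \<open>A pair \<open>(h, c)\<close> in \<open>\<Gamma>\<close> selects \<open>c\<close> among the codes of \<open>h\<close>; \<open>Orc0\<close> maps every code of \<open>h\<close>
  to the number of \<open>c\<close>. \<open>Mu0\<close> returns an arbitrary number on functions without zeros.\<close>

inductive ev :: "((nat \<Rightarrow> nat) \<times> val) set \<Rightarrow> val \<Rightarrow> val \<Rightarrow> val \<Rightarrow> bool" for \<Gamma> where
  ev_K0: "ev \<Gamma> K0 x (K1 x)"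
| ev_K1: "ev \<Gamma> (K1 x) y x"
| ev_S0: "ev \<Gamma> S0 x (S1 x)"
| ev_S1: "ev \<Gamma> (S1 x) y (S2 x y)"
| ev_S2: "ev \<Gamma> (S2 x y) z w" if "ev \<Gamma> x z u" "ev \<Gamma> y z v" "ev \<Gamma> u v w"
| ev_Suc: "ev \<Gamma> Suc0 (VN n) (VN (Suc n))"
| ev_R0: "ev \<Gamma> R0 x (R1 x)"
| ev_R1: "ev \<Gamma> (R1 x) y (R2 x y)"
| ev_R2_0: "ev \<Gamma> (R2 (VN 0) y) z y"
| ev_R2_Suc: "ev \<Gamma> (R2 (VN (Suc n)) y) z b"
    if "ev \<Gamma> (R2 (VN n) y) z r" "ev \<Gamma> z r a" "ev \<Gamma> a (VN n) b"
| ev_Cons0: "ev \<Gamma> Cons0 x (Cons1 x)"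
| ev_Cons1: "ev \<Gamma> (Cons1 x) (VL xs) (VL (x # xs))"
| ev_L0: "ev \<Gamma> L0 x (L1 x)"
| ev_L1: "ev \<Gamma> (L1 x) y (L2 x y)"
| ev_L2_Nil: "ev \<Gamma> (L2 (VL []) y) z y"
| ev_L2_Cons: "ev \<Gamma> (L2 (VL (x # xs)) y) z b"
    if "ev \<Gamma> (L2 (VL xs) y) z r" "ev \<Gamma> z r a" "ev \<Gamma> a x b"
| ev_P0: "ev \<Gamma> P0 x (P1 x)"
| ev_P1: "ev \<Gamma> (P1 x) y (VP x y)"
| ev_Fst: "ev \<Gamma> Fst0 (VP x y) x"
| ev_Snd: "ev \<Gamma> Snd0 (VP x y) y"
| ev_Mu: "ev \<Gamma> Mu0 f (VN (LEAST n. h n = 0))" if "\<And>k. ev \<Gamma> f (VN k) (VN (h k))"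
| ev_Orc: "ev \<Gamma> Orc0 f (VN (to_nat c))" if "\<And>k. ev \<Gamma> f (VN k) (VN (h k))" "(h, c) \<in> \<Gamma>"

inductive_cases ev_elims:
  "ev \<Gamma> K0 x r" "ev \<Gamma> (K1 a) x r" "ev \<Gamma> S0 x r" "ev \<Gamma> (S1 a) x r" "ev \<Gamma> (S2 a b) x r"
  "ev \<Gamma> Suc0 x r" "ev \<Gamma> R0 x r" "ev \<Gamma> (R1 a) x r" "ev \<Gamma> (R2 (VN 0) b) x r"
  "ev \<Gamma> (R2 (VN (Suc n)) b) x r"
  "ev \<Gamma> Cons0 x r" "ev \<Gamma> (Cons1 a) x r" "ev \<Gamma> L0 x r" "ev \<Gamma> (L1 a) x r"
  "ev \<Gamma> (L2 (VL []) b) x r" "ev \<Gamma> (L2 (VL (y # ys)) b) x r"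
  "ev \<Gamma> P0 x r" "ev \<Gamma> (P1 a) x r" "ev \<Gamma> Fst0 x r" "ev \<Gamma> Snd0 x r"
inductive_cases ev_MuE: "ev \<Gamma> Mu0 x r"
inductive_cases ev_OrcE: "ev \<Gamma> Orc0 x r"

text \<open>The graph occurs only positively, in \<open>ev_Orc\<close>, and the infinitary premises
  of \<open>ev_Mu\<close> and \<open>ev_Orc\<close> ask for values at all numerals, never for the
  failure of an evaluation. So derivations survive when the graph grows.\<close>

lemma ev_mono: "ev \<Gamma> f x r \<Longrightarrow> \<Gamma> \<subseteq> \<Delta> \<Longrightarrow> ev \<Delta> f x r"
proof (induction rule: ev.induct)
  case (ev_Mu f h)
  then show ?case by (simp add: ev.ev_Mu)
next
  case (ev_Orc f h c)
  then show ?case by (meson ev.ev_Orc subsetD)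
qed (blast intro: ev.intros)+

text \<open>The rules are syntax-directed, and only the oracle could return several values. In the
  two infinitary cases the induction hypotheses at all numerals show that both derivations tabulate
  the same function, to which the graph assigns at most one code.\<close>

lemma ev_det:
  assumes "single_valued \<Gamma>"
  shows "ev \<Gamma> f x r \<Longrightarrow> ev \<Gamma> f x r' \<Longrightarrow> r' = r"
proof (induction arbitrary: r' rule: ev.induct)
  case (ev_Mu f h)
  from ev_Mu.prems obtain h' where h': "r' = VN (LEAST n. h' n = 0)" "\<And>k. ev \<Gamma> f (VN k) (VN (h' k))"
    by (auto elim: ev_MuE)
  then have "h' k = h k" for k using ev_Mu.IH by blast
  then show ?case using h' by simp
next
  case (ev_Orc f h c)
  from ev_Orc.prems obtain h' c' where h': "r' = VN (to_nat c')" "(h', c') \<in> \<Gamma>" 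
    "\<And>k. ev \<Gamma> f (VN k) (VN (h' k))"
    by (auto elim: ev_OrcE)
  then have "h' k = h k" for k using ev_Orc.IH by blast
  then have "h' = h" by auto
  then show ?case using h' ev_Orc.hyps assms by (auto dest: single_valuedD)
next
  case (ev_S2 x z u y v w)
  from ev_S2.prems show ?case by (rule ev_elims(5)) (use ev_S2.IH in blast)
next
  case (ev_R2_Suc n y z r a b)
  from ev_R2_Suc.prems show ?case by (rule ev_elims(10)) (use ev_R2_Suc.IH in blast)
next
  case (ev_L2_Cons xs y z r a x b)
  from ev_L2_Cons.prems show ?case by (rule ev_elims(16)) (use ev_L2_Cons.IH in blast)
qed (erule ev_elims; simp)+

definition represents :: "((nat \<Rightarrow> nat) \<times> val) set \<Rightarrow> val \<Rightarrow> (nat \<Rightarrow> nat) \<Rightarrow> bool" where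
  "represents \<Gamma> c h \<longleftrightarrow> (\<forall>k. ev \<Gamma> c (VN k) (VN (h k)))"

text \<open>Adding a pair to a graph only enlarges the evaluation relation, so a maximal graph of
  correct representatives has every representable function in its domain.\<close>

lemma ex_full_graph:
  "\<exists>\<Gamma>. single_valued \<Gamma> \<and> (\<forall>(h, c) \<in> \<Gamma>. represents \<Gamma> c h) \<and> (\<forall>c h. represents \<Gamma> c h \<longrightarrow> h \<in> Domain \<Gamma>)"
proof -
  let ?P = "{\<Gamma>. single_valued \<Gamma> \<and> (\<forall>(h, c) \<in> \<Gamma>. represents \<Gamma> c h)}"
  have mono: "represents \<Gamma> c h \<Longrightarrow> \<Gamma> \<subseteq> \<Delta> \<Longrightarrow> represents \<Delta> c h" for \<Gamma> \<Delta> c h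
    by (auto simp: represents_def intro: ev_mono)
  have "\<exists>M\<in>?P. \<forall>X\<in>?P. M \<subseteq> X \<longrightarrow> X = M"
  proof (rule subset_Zorn', rule CollectI, intro conjI ballI)
    fix \<C> assume ch: "subset.chain ?P \<C>"
    then have sub: "\<C> \<subseteq> ?P" and tot: "\<And>X Y. X \<in> \<C> \<Longrightarrow> Y \<in> \<C> \<Longrightarrow> X \<subseteq> Y \<or> Y \<subseteq> X"
      by (auto simp: subset_chain_def)
    show "single_valued (\<Union>\<C>)"
    proof (rule single_valuedI)
      fix x y z assume "(x, y) \<in> \<Union>\<C>" "(x, z) \<in> \<Union>\<C>"
      then obtain X Y where "X \<in> \<C>" "(x, y) \<in> X" "Y \<in> \<C>" "(x, z) \<in> Y" by blast
      with tot[of X Y] sub show "y = z" by (auto dest: single_valuedD)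
    qed
    fix p assume "p \<in> \<Union>\<C>"
    then obtain X where X: "X \<in> \<C>" "p \<in> X" by blast
    moreover obtain h c where "p = (h, c)" by fastforce
    ultimately have "represents X c h" using X(2) subsetD[OF sub X(1)] by fast
    moreover have "X \<subseteq> \<Union>\<C>" using X(1) by (rule Union_upper)
    ultimately have "represents (\<Union>\<C>) c h" by (rule mono)
    with \<open>p = (h, c)\<close> show "case p of (h, c) \<Rightarrow> represents (\<Union>\<C>) c h" by simp
  qed
  then obtain M where M: "M \<in> ?P" and max: "\<forall>X\<in>?P. M \<subseteq> X \<longrightarrow> X = M" by (rule bexE)
  have "h \<in> Domain M" if "represents M c h" for c h
  proof (rule ccontr)
    assume "h \<notin> Domain M"
    then have "insert (h, c) M \<in> ?P" using M that
      by (auto simp: single_valued_def intro: mono[of M])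
    with max have "insert (h, c) M = M" by (meson subset_insertI)
    with \<open>h \<notin> Domain M\<close> show False by blast
  qed
  with M show ?thesis by blast
qed

definition canon :: "((nat \<Rightarrow> nat) \<times> val) set" where
  "canon = (SOME \<Gamma>. single_valued \<Gamma> \<and> (\<forall>(h, c) \<in> \<Gamma>. represents \<Gamma> c h)
     \<and> (\<forall>c h. represents \<Gamma> c h \<longrightarrow> h \<in> Domain \<Gamma>))"

text \<open>The second property lets a selected code recover its function, which makes the oracle
  injective; the third makes the oracle total on functions of type 1.\<close>

lemma canon: "single_valued canon" "\<And>h c. (h, c) \<in> canon \<Longrightarrow> represents canon c h"
  "\<And>c h. represents canon c h \<Longrightarrow> \<exists>c'. (h, c') \<in> canon"
  using someI_ex[OF ex_full_graph] unfolding canon_def[symmetric] by (auto simp: Domain_iff)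

abbreviation app :: "val \<Rightarrow> val \<Rightarrow> val \<Rightarrow> bool" where "app \<equiv> ev canon"

lemmas app_det = ev_det[OF canon(1)]

section \<open>Hereditarily extensional functionals\<close>

text \<open>Products are added to the types of the language so that challenges and responses have
  types in the model.\<close>

datatype uty = UNat | UFun uty uty (infixr "\<Rrightarrow>" 65) | USeq uty | UProd uty uty (infixr "\<otimes>" 70)

text \<open>The construction of the hereditarily effective operations, over this applicative
  structure. The function clause demands definedness on related arguments, so
  \<open>per \<tau> a a\<close> says that \<open>a\<close> is total and extensional.\<close>

primrec per :: "uty \<Rightarrow> val \<Rightarrow> val \<Rightarrow> bool" where
  "per UNat a b \<longleftrightarrow> (\<exists>n. a = VN n \<and> b = VN n)"
| "per (\<sigma> \<Rrightarrow> \<tau>) a b \<longleftrightarrow> (\<forall>x y. per \<sigma> x y \<longrightarrow> (\<exists>u v. app a x u \<and> app b y v \<and> per \<tau> u v))"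
| "per (USeq \<sigma>) a b \<longleftrightarrow> (\<exists>xs ys. a = VL xs \<and> b = VL ys \<and> list_all2 (per \<sigma>) xs ys)"
| "per (\<sigma> \<otimes> \<tau>) a b \<longleftrightarrow> (\<exists>x y x' y'. a = VP x y \<and> b = VP x' y' \<and> per \<sigma> x x' \<and> per \<tau> y y')"

lemma per_FunE:
  assumes "per (\<sigma> \<Rrightarrow> \<tau>) a b" "per \<sigma> x y"
  obtains u v where "app a x u" "app b y v" "per \<tau> u v"
  using assms unfolding per.simps by meson

lemma per_sym: "per \<tau> a b \<Longrightarrow> per \<tau> b a"
proof (induction \<tau> arbitrary: a b)
  case (UFun \<sigma> \<tau>)
  then show ?case by (simp) meson
next
  case (USeq \<sigma>)
  then show ?case by (force simp: list_all2_conv_all_nth)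
qed auto

text \<open>At function types compare \<open>a\<close> with \<open>b\<close> at the same
  \<open>x\<close>, then \<open>b\<close> at \<open>x\<close> with \<open>c\<close> at
  \<open>y\<close>; the two values of \<open>b\<close> at \<open>x\<close> coincide by determinacy
  of application.\<close>

lemma per_trans: "per \<tau> a b \<Longrightarrow> per \<tau> b c \<Longrightarrow> per \<tau> a c"
proof (induction \<tau> arbitrary: a b c)
  case (UFun \<sigma> \<tau>)
  show ?case unfolding per.simps
  proof (intro allI impI)
    fix x y assume xy: "per \<sigma> x y"
    then have "per \<sigma> x x" using UFun.IH(1) per_sym by blast
    with UFun.prems(1) obtain u v where uv: "app a x u" "app b x v" "per \<tau> u v" by (rule per_FunE)
    from UFun.prems(2) xy obtain v' w where vw: "app b x v'" "app c y w" "per \<tau> v' w" by (rule per_FunE)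
    from uv(3) vw(3) have "per \<tau> u w"
      unfolding app_det[OF uv(2) vw(1)] by (rule UFun.IH(2))
    with uv(1) vw(2) show "\<exists>u v. app a x u \<and> app c y v \<and> per \<tau> u v" by blast
  qed
next
  case (USeq \<sigma>)
  then obtain xs ys zs where "a = VL xs" "b = VL ys" "c = VL zs"
    and *: "list_all2 (per \<sigma>) xs ys" "list_all2 (per \<sigma>) ys zs" by auto
  moreover from * have "list_all2 (per \<sigma>) xs zs"
    using USeq.IH[of "xs ! i" "ys ! i" "zs ! i" for i] by (simp add: list_all2_conv_all_nth)
  ultimately show ?case by simp
next
  case (UProd \<sigma> \<tau>)
  then show ?case by (simp) blast
qed auto

lemma per_refl: "per \<tau> a b \<Longrightarrow> per \<tau> a a" "per \<tau> a b \<Longrightarrow> per \<tau> b b"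
  using per_sym per_trans by blast+

text \<open>Functionals are equivalence classes, so that equality of functionals is equality of HOL;
  pairs and sequences of functionals are kept as pairs and lists.\<close>

datatype elt =
    num (natof: nat) | Fun uty uty "val set" | pr (pfst: elt) (psnd: elt) | lst (elems: "elt list")

primrec cls :: "uty \<Rightarrow> val \<Rightarrow> elt" where
  "cls UNat a = num (case a of VN n \<Rightarrow> n | _ \<Rightarrow> 0)"
| "cls (\<sigma> \<Rrightarrow> \<tau>) a = Fun \<sigma> \<tau> {b. per (\<sigma> \<Rrightarrow> \<tau>) a b}"
| "cls (USeq \<sigma>) a = lst (case a of VL vs \<Rightarrow> map (cls \<sigma>) vs | _ \<Rightarrow> [])"
| "cls (\<sigma> \<otimes> \<tau>) a = (case a of VP x y \<Rightarrow> pr (cls \<sigma> x) (cls \<tau> y) | _ \<Rightarrow> num 0)"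

declare cls.simps [simp del]

definition Car :: "uty \<Rightarrow> elt set" where "Car \<tau> = {cls \<tau> a |a. per \<tau> a a}"

lemma CarE: assumes "x \<in> Car \<tau>" obtains a where "x = cls \<tau> a" "per \<tau> a a"
  using assms by (auto simp: Car_def)

lemma cls_in: "per \<tau> a b \<Longrightarrow> cls \<tau> a \<in> Car \<tau>"
  by (auto simp: Car_def dest: per_refl)

lemma num_cls: "num n = cls UNat (VN n)"
  by (simp add: cls.simps)

lemma pr_cls: "pr (cls \<sigma> a) (cls \<tau> b) = cls (\<sigma> \<otimes> \<tau>) (VP a b)"
  by (simp add: cls.simps)

lemma lst_cls: "lst (map (cls \<sigma>) vs) = cls (USeq \<sigma>) (VL vs)"
  by (simp add: cls.simps)

lemma cls_eqI: "per \<tau> a b \<Longrightarrow> cls \<tau> a = cls \<tau> b"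
proof (induction \<tau> arbitrary: a b)
  case (UFun \<sigma> \<tau>)
  then have "per (\<sigma> \<Rrightarrow> \<tau>) a c \<longleftrightarrow> per (\<sigma> \<Rrightarrow> \<tau>) b c" for c
    using per_sym per_trans by blast
  then show ?case by (simp add: cls.simps(2) del: per.simps)
next
  case (USeq \<sigma>)
  then obtain xs ys where "a = VL xs" "b = VL ys" "list_all2 (per \<sigma>) xs ys" by auto
  moreover from this USeq.IH have "map (cls \<sigma>) xs = map (cls \<sigma>) ys"
    by (auto simp: list_all2_conv_all_nth intro: nth_equalityI)
  ultimately show ?case by (simp add: cls.simps)
next
  case (UProd \<sigma> \<tau>)
  then show ?case by (auto simp: cls.simps)
qed auto

lemma cls_eqD: "cls \<tau> a = cls \<tau> b \<Longrightarrow> per \<tau> a a \<Longrightarrow> per \<tau> b b \<Longrightarrow> per \<tau> a b"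
proof (induction \<tau> arbitrary: a b)
  case (UFun \<sigma> \<tau>)
  then show ?case by (auto simp: cls.simps(2) simp del: per.simps)
next
  case (USeq \<sigma>)
  then obtain xs ys where ab: "a = VL xs" "b = VL ys" "list_all2 (per \<sigma>) xs xs" "list_all2 (per \<sigma>) ys ys"
    by auto
  with USeq.prems have "map (cls \<sigma>) xs = map (cls \<sigma>) ys" by (simp add: cls.simps)
  with ab(3,4) have "list_all2 (per \<sigma>) xs ys"
    using USeq.IH[of "xs ! i" "ys ! i" for i] by (simp add: list_all2_conv_all_nth list_eq_iff_nth_eq)
  with ab show ?case by simp
next
  case (UProd \<sigma> \<tau>)
  then show ?case by (auto simp: cls.simps)
qed (auto simp: cls.simps)

lemma num_in [simp, intro]: "num n \<in> Car UNat"
  unfolding num_cls by (rule cls_in) auto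

lemma Car_UNat: "Car UNat = range num"
  by (auto simp: Car_def num_cls)

lemma pr_in_iff [simp]: "pr x y \<in> Car (\<sigma> \<otimes> \<tau>) \<longleftrightarrow> x \<in> Car \<sigma> \<and> y \<in> Car \<tau>"
  by (force simp: Car_def cls.simps)

lemma Car_UProd_E: assumes "p \<in> Car (\<sigma> \<otimes> \<tau>)" obtains x y where "p = pr x y" "x \<in> Car \<sigma>" "y \<in> Car \<tau>"
proof -
  from assms obtain a b where "p = cls (\<sigma> \<otimes> \<tau>) (VP a b)" "per \<sigma> a a" "per \<tau> b b"
    by (auto simp: Car_def)
  then show ?thesis using that by (metis pr_cls cls_in)
qed

lemma pfst_in [intro]: "p \<in> Car (\<sigma> \<otimes> \<tau>) \<Longrightarrow> pfst p \<in> Car \<sigma>"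
  and psnd_in [intro]: "p \<in> Car (\<sigma> \<otimes> \<tau>) \<Longrightarrow> psnd p \<in> Car \<tau>"
  by (erule Car_UProd_E; simp)+

lemma Car_list_E: assumes "set xs \<subseteq> Car \<sigma>" obtains vs where "xs = map (cls \<sigma>) vs" "list_all2 (per \<sigma>) vs vs"
proof -
  have "\<exists>vs. xs = map (cls \<sigma>) vs \<and> list_all2 (per \<sigma>) vs vs" using assms
  proof (induction xs)
    case (Cons x xs)
    then obtain v vs where "x = cls \<sigma> v" "per \<sigma> v v" "xs = map (cls \<sigma>) vs \<and> list_all2 (per \<sigma>) vs vs"
      by (auto elim: CarE)
    then show ?case by (intro exI[of _ "v # vs"]) simp
  qed simp
  then show ?thesis using that by blast
qed

lemma Car_USeq_E: assumes "l \<in> Car (USeq \<sigma>)" obtains xs where "l = lst xs" "set xs \<subseteq> Car \<sigma>"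
proof -
  from assms obtain vs where *: "l = cls (USeq \<sigma>) (VL vs)" "list_all2 (per \<sigma>) vs vs"
    by (auto simp: Car_def)
  then have "set (map (cls \<sigma>) vs) \<subseteq> Car \<sigma>"
    by (auto simp: list_all2_conv_all_nth in_set_conv_nth intro!: cls_in)
  then show ?thesis using that * lst_cls by metis
qed

lemma lst_in_iff [simp]: "lst xs \<in> Car (USeq \<sigma>) \<longleftrightarrow> set xs \<subseteq> Car \<sigma>"
proof
  assume "set xs \<subseteq> Car \<sigma>"
  then obtain vs where "xs = map (cls \<sigma>) vs" "list_all2 (per \<sigma>) vs vs" by (rule Car_list_E)
  then show "lst xs \<in> Car (USeq \<sigma>)" by (auto simp: lst_cls intro: cls_in[where b = "VL vs"])
qed (auto elim: Car_USeq_E)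

lemma elems_in: "l \<in> Car (USeq \<sigma>) \<Longrightarrow> set (elems l) \<subseteq> Car \<sigma>"
  by (erule Car_USeq_E) simp

text \<open>The types stored in \<open>Fun\<close> tell \<open>ap\<close> which relation to use, so
  application needs no type arguments. By \<open>ap_cls\<close> the choice of representatives is
  immaterial on the carriers.\<close>

definition ap :: "elt \<Rightarrow> elt \<Rightarrow> elt" where
  "ap f x = (case f of Fun \<sigma> \<tau> F \<Rightarrow>
     cls \<tau> (SOME r. \<exists>a\<in>F. \<exists>b. cls \<sigma> b = x \<and> per \<sigma> b b \<and> app a b r) | _ \<Rightarrow> f)"

lemma ap_cls:
  assumes "per (\<sigma> \<Rrightarrow> \<tau>) a a" "per \<sigma> x x" "app a x r"
  shows "ap (cls (\<sigma> \<Rrightarrow> \<tau>) a) (cls \<sigma> x) = cls \<tau> r"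
proof -
  let ?Q = "\<lambda>r. \<exists>a\<in>{b. per (\<sigma> \<Rrightarrow> \<tau>) a b}. \<exists>b. cls \<sigma> b = cls \<sigma> x \<and> per \<sigma> b b \<and> app a b r"
  have "?Q r" using assms by blast
  then have "?Q (SOME r. ?Q r)" by (rule someI)
  then obtain a' b' where *: "per (\<sigma> \<Rrightarrow> \<tau>) a a'" "cls \<sigma> b' = cls \<sigma> x" "per \<sigma> b' b'"
    "app a' b' (SOME r. ?Q r)" by blast
  from *(2)[symmetric] assms(2) *(3) have "per \<sigma> x b'" by (rule cls_eqD)
  with *(1) obtain u v where uv: "app a x u" "app a' b' v" "per \<tau> u v" by (rule per_FunE)
  have "per \<tau> r (SOME r. ?Q r)"
    using uv(3) unfolding app_det[OF uv(1) assms(3)] app_det[OF *(4) uv(2)] .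
  then have "cls \<tau> (SOME r. ?Q r) = cls \<tau> r" by (rule cls_eqI[OF per_sym])
  moreover have "ap (cls (\<sigma> \<Rrightarrow> \<tau>) a) (cls \<sigma> x) = cls \<tau> (SOME r. ?Q r)"
    by (simp only: ap_def cls.simps(2) elt.case)
  ultimately show ?thesis by simp
qed

lemma ap_in [intro]: "f \<in> Car (\<sigma> \<Rrightarrow> \<tau>) \<Longrightarrow> x \<in> Car \<sigma> \<Longrightarrow> ap f x \<in> Car \<tau>"
proof -
  assume "f \<in> Car (\<sigma> \<Rrightarrow> \<tau>)" "x \<in> Car \<sigma>"
  then obtain a b where *: "f = cls (\<sigma> \<Rrightarrow> \<tau>) a" "per (\<sigma> \<Rrightarrow> \<tau>) a a" "x = cls \<sigma> b" "per \<sigma> b b"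
    by (meson CarE)
  from *(2,4) obtain r r' where "app a b r" "per \<tau> r r'" by (rule per_FunE)
  then show ?thesis using * ap_cls cls_in by metis
qed

text \<open>Agreement on all classes says that the two codes send each \<open>x\<close> to related
  values; extensionality of the second code moves from \<open>x\<close> to a related
  \<open>y\<close>. So the codes are related and have one class.\<close>

lemma fun_ext:
  assumes "f \<in> Car (\<sigma> \<Rrightarrow> \<tau>)" "g \<in> Car (\<sigma> \<Rrightarrow> \<tau>)" "\<And>x. x \<in> Car \<sigma> \<Longrightarrow> ap f x = ap g x"
  shows "f = g"
proof -
  from assms obtain a b where ab: "f = cls (\<sigma> \<Rrightarrow> \<tau>) a" "per (\<sigma> \<Rrightarrow> \<tau>) a a" "g = cls (\<sigma> \<Rrightarrow> \<tau>) b" "per (\<sigma> \<Rrightarrow> \<tau>) b b"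
    by (meson CarE)
  have "per (\<sigma> \<Rrightarrow> \<tau>) a b"
    unfolding per.simps
  proof (intro allI impI)
    fix x y assume xy: "per \<sigma> x y"
    then have xx: "per \<sigma> x x" by (rule per_refl)
    from ab(2) xx obtain u u' where u: "app a x u" "per \<tau> u u'" by (rule per_FunE)
    from ab(4) xy obtain v w where vw: "app b x v" "app b y w" "per \<tau> v w" by (rule per_FunE)
    have "cls \<tau> u = cls \<tau> v"
      using assms(3)[OF cls_in[OF xx]] ap_cls[OF ab(2) xx u(1)] ap_cls[OF ab(4) xx vw(1)] ab by simp
    then have "per \<tau> u v" using u(2) vw(3) by (blast intro: cls_eqD per_refl)
    then show "\<exists>u v. app a x u \<and> app b y v \<and> per \<tau> u v" using u vw per_trans by blast
  qed
  then show ?thesis using ab cls_eqI by blast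
qed

lemma ap_clsE:
  assumes "per (\<sigma> \<Rrightarrow> \<tau>) a a" "per \<sigma> x x"
  obtains r where "app a x r" "ap (cls (\<sigma> \<Rrightarrow> \<tau>) a) (cls \<sigma> x) = cls \<tau> r" "per \<tau> r r"
proof -
  from assms obtain r r' where "app a x r" "per \<tau> r r'" by (rule per_FunE)
  then show ?thesis using that ap_cls[OF assms] per_refl(1) by blast
qed

lemma per_FunI:
  assumes "\<And>x y. per \<sigma> x y \<Longrightarrow> app a x (F x) \<and> app b y (G y) \<and> per \<tau> (F x) (G y)"
  shows "per (\<sigma> \<Rrightarrow> \<tau>) a b"
  using assms unfolding per.simps by blast

section \<open>Combinators, recursors and pairing in the model\<close>

definition kE :: "uty \<Rightarrow> uty \<Rightarrow> elt" where "kE \<sigma> \<tau> = cls (\<sigma> \<Rrightarrow> \<tau> \<Rrightarrow> \<sigma>) K0"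

lemma per_K1: "per \<sigma> x y \<Longrightarrow> per (\<tau> \<Rrightarrow> \<sigma>) (K1 x) (K1 y)"
  by (rule per_FunI[where F = "\<lambda>_. x" and G = "\<lambda>_. y"]) (simp add: ev_K1)

lemma per_K0: "per (\<sigma> \<Rrightarrow> \<tau> \<Rrightarrow> \<sigma>) K0 K0"
  by (rule per_FunI[where F = K1 and G = K1]) (simp add: ev_K0 per_K1 del: per.simps)

lemma kE_in [simp, intro]: "kE \<sigma> \<tau> \<in> Car (\<sigma> \<Rrightarrow> \<tau> \<Rrightarrow> \<sigma>)"
  unfolding kE_def by (rule cls_in[OF per_K0])

lemma kE [simp]: "x \<in> Car \<sigma> \<Longrightarrow> y \<in> Car \<tau> \<Longrightarrow> ap (ap (kE \<sigma> \<tau>) x) y = x"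
  unfolding kE_def
  by (elim CarE) (simp add: ap_cls[OF per_K0 _ ev_K0] ap_cls[OF per_K1 _ ev_K1] del: per.simps)

definition sE :: "uty \<Rightarrow> uty \<Rightarrow> uty \<Rightarrow> elt" where
  "sE \<rho> \<sigma> \<tau> = cls ((\<rho> \<Rrightarrow> \<sigma> \<Rrightarrow> \<tau>) \<Rrightarrow> (\<rho> \<Rrightarrow> \<sigma>) \<Rrightarrow> \<rho> \<Rrightarrow> \<tau>) S0"

lemma per_S2:
  assumes "per (\<rho> \<Rrightarrow> \<sigma> \<Rrightarrow> \<tau>) f f'" "per (\<rho> \<Rrightarrow> \<sigma>) g g'"
  shows "per (\<rho> \<Rrightarrow> \<tau>) (S2 f g) (S2 f' g')"
  unfolding per.simps
proof (intro allI impI)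
  fix x y assume xy: "per \<rho> x y"
  from assms(1) xy obtain u v where uv: "app f x u" "app f' y v" "per (\<sigma> \<Rrightarrow> \<tau>) u v" by (rule per_FunE)
  from assms(2) xy obtain u' v' where uv': "app g x u'" "app g' y v'" "per \<sigma> u' v'" by (rule per_FunE)
  from uv(3) uv'(3) obtain r r' where "app u u' r" "app v v' r'" "per \<tau> r r'" by (rule per_FunE)
  then show "\<exists>u v. app (S2 f g) x u \<and> app (S2 f' g') y v \<and> per \<tau> u v"
    using uv uv' ev_S2 by blast
qed

lemma per_S1: "per (\<rho> \<Rrightarrow> \<sigma> \<Rrightarrow> \<tau>) f f' \<Longrightarrow> per ((\<rho> \<Rrightarrow> \<sigma>) \<Rrightarrow> \<rho> \<Rrightarrow> \<tau>) (S1 f) (S1 f')"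
  by (rule per_FunI[where F = "S2 f" and G = "S2 f'"]) (simp add: ev_S1 per_S2 del: per.simps)

lemma per_S0: "per ((\<rho> \<Rrightarrow> \<sigma> \<Rrightarrow> \<tau>) \<Rrightarrow> (\<rho> \<Rrightarrow> \<sigma>) \<Rrightarrow> \<rho> \<Rrightarrow> \<tau>) S0 S0"
  by (rule per_FunI[where F = S1 and G = S1]) (simp add: ev_S0 per_S1 del: per.simps)

lemma sE_in [simp, intro]: "sE \<rho> \<sigma> \<tau> \<in> Car ((\<rho> \<Rrightarrow> \<sigma> \<Rrightarrow> \<tau>) \<Rrightarrow> (\<rho> \<Rrightarrow> \<sigma>) \<Rrightarrow> \<rho> \<Rrightarrow> \<tau>)"
  unfolding sE_def by (rule cls_in[OF per_S0])

lemma sE [simp]: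
  assumes "f \<in> Car (\<rho> \<Rrightarrow> \<sigma> \<Rrightarrow> \<tau>)" "g \<in> Car (\<rho> \<Rrightarrow> \<sigma>)" "x \<in> Car \<rho>"
  shows "ap (ap (ap (sE \<rho> \<sigma> \<tau>) f) g) x = ap (ap f x) (ap g x)"
proof -
  from assms obtain a b c where abc: "f = cls (\<rho> \<Rrightarrow> \<sigma> \<Rrightarrow> \<tau>) a" "per (\<rho> \<Rrightarrow> \<sigma> \<Rrightarrow> \<tau>) a a"
    "g = cls (\<rho> \<Rrightarrow> \<sigma>) b" "per (\<rho> \<Rrightarrow> \<sigma>) b b" "x = cls \<rho> c" "per \<rho> c c" by (elim CarE)
  obtain u where u: "app a c u" "ap f x = cls (\<sigma> \<Rrightarrow> \<tau>) u" "per (\<sigma> \<Rrightarrow> \<tau>) u u"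
    using ap_clsE[OF abc(2,6)] abc by metis
  obtain v where v: "app b c v" "ap g x = cls \<sigma> v" "per \<sigma> v v"
    using ap_clsE[OF abc(4,6)] abc by metis
  obtain r where r: "app u v r" "ap (ap f x) (ap g x) = cls \<tau> r"
    using ap_clsE[OF u(3) v(3)] u v by metis
  show ?thesis unfolding r(2) unfolding abc sE_def
    by (simp only: ap_cls[OF per_S0 abc(2) ev_S0] ap_cls[OF per_S1[OF abc(2)] abc(4) ev_S1]
        ap_cls[OF per_S2[OF abc(2,4)] abc(6) ev_S2[OF u(1) v(1) r(1)]])
qed

definition sucE :: elt where "sucE = cls (UNat \<Rrightarrow> UNat) Suc0"

lemma per_Suc0: "per (UNat \<Rrightarrow> UNat) Suc0 Suc0"
  by (auto intro: ev_Suc)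

lemma sucE_in [simp, intro]: "sucE \<in> Car (UNat \<Rrightarrow> UNat)"
  unfolding sucE_def by (rule cls_in[OF per_Suc0])

lemma sucE [simp]: "ap sucE (num n) = num (Suc n)"
  unfolding sucE_def num_cls by (rule ap_cls[OF per_Suc0 _ ev_Suc]) auto

definition recE :: "uty \<Rightarrow> elt" where
  "recE \<rho> = cls (UNat \<Rrightarrow> \<rho> \<Rrightarrow> (\<rho> \<Rrightarrow> UNat \<Rrightarrow> \<rho>) \<Rrightarrow> \<rho>) R0"

text \<open>Evaluation is a relation, so definedness of the recursion has to be shown together with
  its extensionality, by induction on the numeral.\<close>

lemma per_R2_aux:
  assumes "per \<rho> y y'" "per (\<rho> \<Rrightarrow> UNat \<Rrightarrow> \<rho>) z z'"
  shows "\<exists>u v. app (R2 (VN n) y) z u \<and> app (R2 (VN n) y') z' v \<and> per \<rho> u v"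
proof (induction n)
  case 0
  then show ?case using assms(1) ev_R2_0 by blast
next
  case (Suc n)
  then obtain u v where uv: "app (R2 (VN n) y) z u" "app (R2 (VN n) y') z' v" "per \<rho> u v" by blast
  from assms(2) uv(3) obtain a b where ab: "app z u a" "app z' v b" "per (UNat \<Rrightarrow> \<rho>) a b" by (rule per_FunE)
  have "per UNat (VN n) (VN n)" by simp
  with ab(3) obtain r r' where "app a (VN n) r" "app b (VN n) r'" "per \<rho> r r'" by (rule per_FunE)
  then show ?case using uv ab ev_R2_Suc by blast
qed

lemma per_R2:
  assumes "per \<rho> y y'"
  shows "per ((\<rho> \<Rrightarrow> UNat \<Rrightarrow> \<rho>) \<Rrightarrow> \<rho>) (R2 (VN n) y) (R2 (VN n) y')"
  unfolding per.simps(2)[of "\<rho> \<Rrightarrow> UNat \<Rrightarrow> \<rho>"] using per_R2_aux[OF assms] by blast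

lemma per_R1: "per UNat m n \<Longrightarrow> per (\<rho> \<Rrightarrow> (\<rho> \<Rrightarrow> UNat \<Rrightarrow> \<rho>) \<Rrightarrow> \<rho>) (R1 m) (R1 n)"
  by (rule per_FunI[where F = "R2 m" and G = "R2 n"])
    (auto simp: ev_R1 per_R2 simp del: per.simps(2))

lemma per_R0: "per (UNat \<Rrightarrow> \<rho> \<Rrightarrow> (\<rho> \<Rrightarrow> UNat \<Rrightarrow> \<rho>) \<Rrightarrow> \<rho>) R0 R0"
  by (rule per_FunI[where F = R1 and G = R1]) (simp add: ev_R0 per_R1 del: per.simps)

lemma recE_in [simp, intro]: "recE \<rho> \<in> Car (UNat \<Rrightarrow> \<rho> \<Rrightarrow> (\<rho> \<Rrightarrow> UNat \<Rrightarrow> \<rho>) \<Rrightarrow> \<rho>)"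
  unfolding recE_def by (rule cls_in[OF per_R0])

lemma recE_rep:
  assumes "per \<rho> y y" "per (\<rho> \<Rrightarrow> UNat \<Rrightarrow> \<rho>) z z" "app (R2 (VN n) y) z r"
  shows "ap (ap (ap (recE \<rho>) (num n)) (cls \<rho> y)) (cls (\<rho> \<Rrightarrow> UNat \<Rrightarrow> \<rho>) z) = cls \<rho> r"
proof -
  have n: "per UNat (VN n) (VN n)" by simp
  show ?thesis unfolding recE_def num_cls
    by (simp only: ap_cls[OF per_R0 n ev_R0] ap_cls[OF per_R1[OF n] assms(1) ev_R1]
        ap_cls[OF per_R2[OF assms(1)] assms(2) assms(3)])
qed

lemma recE_0 [simp]:
  assumes "y \<in> Car \<rho>" "z \<in> Car (\<rho> \<Rrightarrow> UNat \<Rrightarrow> \<rho>)"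
  shows "ap (ap (ap (recE \<rho>) (num 0)) y) z = y"
  using assms by (elim CarE) (simp add: recE_rep ev_R2_0 del: per.simps)

lemma recE_Suc [simp]:
  assumes "y \<in> Car \<rho>" "z \<in> Car (\<rho> \<Rrightarrow> UNat \<Rrightarrow> \<rho>)"
  shows "ap (ap (ap (recE \<rho>) (num (Suc n))) y) z = ap (ap z (ap (ap (ap (recE \<rho>) (num n)) y) z)) (num n)"
proof -
  from assms obtain a b where ab: "y = cls \<rho> a" "per \<rho> a a"
    "z = cls (\<rho> \<Rrightarrow> UNat \<Rrightarrow> \<rho>) b" "per (\<rho> \<Rrightarrow> UNat \<Rrightarrow> \<rho>) b b" by (elim CarE)
  obtain r r' where r: "app (R2 (VN n) a) b r" "per \<rho> r r'" using per_R2_aux[OF ab(2,4)] by blast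
  then have rr: "per \<rho> r r" using per_refl by blast
  obtain u where u: "app b r u" "ap (cls (\<rho> \<Rrightarrow> UNat \<Rrightarrow> \<rho>) b) (cls \<rho> r) = cls (UNat \<Rrightarrow> \<rho>) u"
    "per (UNat \<Rrightarrow> \<rho>) u u" using ap_clsE[OF ab(4) rr] by metis
  have n: "per UNat (VN n) (VN n)" by simp
  obtain v where v: "app u (VN n) v" "ap (cls (UNat \<Rrightarrow> \<rho>) u) (cls UNat (VN n)) = cls \<rho> v"
    using ap_clsE[OF u(3) n] by metis
  show ?thesis unfolding ab
    by (simp only: recE_rep[OF ab(2,4) r(1)] recE_rep[OF ab(2,4) ev_R2_Suc[OF r(1) u(1) v(1)]] u(2)
        v(2)[folded num_cls])
qed

definition consE :: "uty \<Rightarrow> elt" where "consE \<sigma> = cls (\<sigma> \<Rrightarrow> USeq \<sigma> \<Rrightarrow> USeq \<sigma>) Cons0"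

lemma per_Cons1: "per \<sigma> x y \<Longrightarrow> per (USeq \<sigma> \<Rrightarrow> USeq \<sigma>) (Cons1 x) (Cons1 y)"
  unfolding per.simps by (blast intro: ev_Cons1 list_all2_Cons[THEN iffD2])

lemma per_Cons0: "per (\<sigma> \<Rrightarrow> USeq \<sigma> \<Rrightarrow> USeq \<sigma>) Cons0 Cons0"
  by (rule per_FunI[where F = Cons1 and G = Cons1]) (simp add: ev_Cons0 per_Cons1 del: per.simps)

lemma consE_in [simp, intro]: "consE \<sigma> \<in> Car (\<sigma> \<Rrightarrow> USeq \<sigma> \<Rrightarrow> USeq \<sigma>)"
  unfolding consE_def by (rule cls_in[OF per_Cons0])

lemma consE:
  assumes "x \<in> Car \<sigma>" "set xs \<subseteq> Car \<sigma>"
  shows "ap (ap (consE \<sigma>) x) (lst xs) = lst (x # xs)"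
proof -
  from assms obtain a vs where a: "x = cls \<sigma> a" "per \<sigma> a a" "xs = map (cls \<sigma>) vs" "list_all2 (per \<sigma>) vs vs"
    by (elim CarE Car_list_E)
  then have vs: "per (USeq \<sigma>) (VL vs) (VL vs)" by simp
  have "lst (x # xs) = cls (USeq \<sigma>) (VL (a # vs))" using a lst_cls[of \<sigma> "a # vs"] by simp
  then show ?thesis unfolding a consE_def lst_cls
    by (simp only: ap_cls[OF per_Cons0 a(2) ev_Cons0] ap_cls[OF per_Cons1[OF a(2)] vs ev_Cons1])
qed

definition lrecE :: "uty \<Rightarrow> uty \<Rightarrow> elt" where
  "lrecE \<sigma> \<rho> = cls (USeq \<sigma> \<Rrightarrow> \<rho> \<Rrightarrow> (\<rho> \<Rrightarrow> \<sigma> \<Rrightarrow> \<rho>) \<Rrightarrow> \<rho>) L0"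

lemma per_L2_aux:
  assumes "per \<rho> y y'" "per (\<rho> \<Rrightarrow> \<sigma> \<Rrightarrow> \<rho>) z z'"
  shows "list_all2 (per \<sigma>) xs xs' \<Longrightarrow>
    \<exists>u v. app (L2 (VL xs) y) z u \<and> app (L2 (VL xs') y') z' v \<and> per \<rho> u v"
proof (induction rule: list_all2_induct)
  case Nil
  then show ?case using assms(1) ev_L2_Nil by blast
next
  case (Cons x xs x' xs')
  then obtain u v where uv: "app (L2 (VL xs) y) z u" "app (L2 (VL xs') y') z' v" "per \<rho> u v" by blast
  from assms(2) uv(3) obtain a b where ab: "app z u a" "app z' v b" "per (\<sigma> \<Rrightarrow> \<rho>) a b" by (rule per_FunE)
  from ab(3) Cons(1) obtain r r' where "app a x r" "app b x' r'" "per \<rho> r r'" by (rule per_FunE)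
  then show ?case using uv ab ev_L2_Cons by blast
qed

lemma per_L2:
  assumes "per (USeq \<sigma>) l l'" "per \<rho> y y'"
  shows "per ((\<rho> \<Rrightarrow> \<sigma> \<Rrightarrow> \<rho>) \<Rrightarrow> \<rho>) (L2 l y) (L2 l' y')"
proof -
  from assms(1) obtain xs xs' where "l = VL xs" "l' = VL xs'" "list_all2 (per \<sigma>) xs xs'" by auto
  then show ?thesis
    unfolding per.simps(2)[of "\<rho> \<Rrightarrow> \<sigma> \<Rrightarrow> \<rho>"] using per_L2_aux[OF assms(2)] by blast
qed

lemma per_L1: "per (USeq \<sigma>) l l' \<Longrightarrow> per (\<rho> \<Rrightarrow> (\<rho> \<Rrightarrow> \<sigma> \<Rrightarrow> \<rho>) \<Rrightarrow> \<rho>) (L1 l) (L1 l')"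
  by (rule per_FunI[where F = "L2 l" and G = "L2 l'"]) (simp add: ev_L1 per_L2 del: per.simps)

lemma per_L0: "per (USeq \<sigma> \<Rrightarrow> \<rho> \<Rrightarrow> (\<rho> \<Rrightarrow> \<sigma> \<Rrightarrow> \<rho>) \<Rrightarrow> \<rho>) L0 L0"
  by (rule per_FunI[where F = L1 and G = L1]) (simp add: ev_L0 per_L1 del: per.simps)

lemma lrecE_in [simp, intro]: "lrecE \<sigma> \<rho> \<in> Car (USeq \<sigma> \<Rrightarrow> \<rho> \<Rrightarrow> (\<rho> \<Rrightarrow> \<sigma> \<Rrightarrow> \<rho>) \<Rrightarrow> \<rho>)"
  unfolding lrecE_def by (rule cls_in[OF per_L0])

lemma lrecE_rep:
  assumes "list_all2 (per \<sigma>) vs vs" "per \<rho> y y" "per (\<rho> \<Rrightarrow> \<sigma> \<Rrightarrow> \<rho>) z z" "app (L2 (VL vs) y) z r"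
  shows "ap (ap (ap (lrecE \<sigma> \<rho>) (cls (USeq \<sigma>) (VL vs))) (cls \<rho> y)) (cls (\<rho> \<Rrightarrow> \<sigma> \<Rrightarrow> \<rho>) z) = cls \<rho> r"
proof -
  from assms have n: "per (USeq \<sigma>) (VL vs) (VL vs)" by simp
  show ?thesis unfolding lrecE_def
    by (simp only: ap_cls[OF per_L0 n ev_L0] ap_cls[OF per_L1[OF n] assms(2) ev_L1]
        ap_cls[OF per_L2[OF n assms(2)] assms(3) assms(4)])
qed

lemma lrecE_Nil:
  assumes "y \<in> Car \<rho>" "z \<in> Car (\<rho> \<Rrightarrow> \<sigma> \<Rrightarrow> \<rho>)"
  shows "ap (ap (ap (lrecE \<sigma> \<rho>) (lst [])) y) z = y"
  using assms lst_cls[of \<sigma> "[]"] by (elim CarE) (simp add: lrecE_rep ev_L2_Nil del: per.simps)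

lemma lrecE_Cons:
  assumes "x \<in> Car \<sigma>" "set xs \<subseteq> Car \<sigma>" "y \<in> Car \<rho>" "z \<in> Car (\<rho> \<Rrightarrow> \<sigma> \<Rrightarrow> \<rho>)"
  shows "ap (ap (ap (lrecE \<sigma> \<rho>) (lst (x # xs))) y) z
    = ap (ap z (ap (ap (ap (lrecE \<sigma> \<rho>) (lst xs)) y) z)) x"
proof -
  from assms obtain a b c vs where ab: "y = cls \<rho> a" "per \<rho> a a"
    "z = cls (\<rho> \<Rrightarrow> \<sigma> \<Rrightarrow> \<rho>) b" "per (\<rho> \<Rrightarrow> \<sigma> \<Rrightarrow> \<rho>) b b" "x = cls \<sigma> c" "per \<sigma> c c"
    "xs = map (cls \<sigma>) vs" "list_all2 (per \<sigma>) vs vs" by (elim CarE Car_list_E)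
  obtain r r' where r: "app (L2 (VL vs) a) b r" "per \<rho> r r'" using per_L2_aux[OF ab(2,4,8)] by blast
  then have rr: "per \<rho> r r" using per_refl by blast
  obtain u where u: "app b r u" "ap (cls (\<rho> \<Rrightarrow> \<sigma> \<Rrightarrow> \<rho>) b) (cls \<rho> r) = cls (\<sigma> \<Rrightarrow> \<rho>) u"
    "per (\<sigma> \<Rrightarrow> \<rho>) u u" using ap_clsE[OF ab(4) rr] by metis
  obtain v where v: "app u c v" "ap (cls (\<sigma> \<Rrightarrow> \<rho>) u) (cls \<sigma> c) = cls \<rho> v"
    using ap_clsE[OF u(3) ab(6)] by metis
  have cvs: "list_all2 (per \<sigma>) (c # vs) (c # vs)" using ab by simp
  have l: "lst (x # xs) = cls (USeq \<sigma>) (VL (c # vs))" using ab lst_cls[of \<sigma> "c # vs"] by simp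
  show ?thesis unfolding l unfolding ab lst_cls
    by (simp only: lrecE_rep[OF ab(8,2,4) r(1)] lrecE_rep[OF cvs ab(2,4) ev_L2_Cons[OF r(1) u(1) v(1)]] u(2) v(2))
qed

text \<open>Sequence recursion is a right fold whose step takes the recursive value before the
  entry, hence the swapped arguments.\<close>

lemma lrecE:
  assumes "l \<in> Car (USeq \<sigma>)" "y \<in> Car \<rho>" "z \<in> Car (\<rho> \<Rrightarrow> \<sigma> \<Rrightarrow> \<rho>)"
  shows "ap (ap (ap (lrecE \<sigma> \<rho>) l) y) z = foldr (\<lambda>x r. ap (ap z r) x) (elems l) y"
proof -
  from assms(1) obtain xs where l: "l = lst xs" "set xs \<subseteq> Car \<sigma>" by (rule Car_USeq_E)
  from l(2) have "ap (ap (ap (lrecE \<sigma> \<rho>) (lst xs)) y) z = foldr (\<lambda>x r. ap (ap z r) x) xs y"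
  proof (induction xs)
    case Nil
    then show ?case by (simp add: lrecE_Nil assms)
  next
    case (Cons x xs)
    then show ?case using assms by (simp add: lrecE_Cons)
  qed
  then show ?thesis using l by simp
qed

definition prE :: "uty \<Rightarrow> uty \<Rightarrow> elt" where "prE \<sigma> \<tau> = cls (\<sigma> \<Rrightarrow> \<tau> \<Rrightarrow> \<sigma> \<otimes> \<tau>) P0"

lemma per_P1: "per \<sigma> x y \<Longrightarrow> per (\<tau> \<Rrightarrow> \<sigma> \<otimes> \<tau>) (P1 x) (P1 y)"
  by (rule per_FunI[where F = "VP x" and G = "VP y"]) (simp add: ev_P1)

lemma per_P0: "per (\<sigma> \<Rrightarrow> \<tau> \<Rrightarrow> \<sigma> \<otimes> \<tau>) P0 P0"
  by (rule per_FunI[where F = P1 and G = P1]) (simp add: ev_P0 per_P1 del: per.simps)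

lemma prE_in [simp, intro]: "prE \<sigma> \<tau> \<in> Car (\<sigma> \<Rrightarrow> \<tau> \<Rrightarrow> \<sigma> \<otimes> \<tau>)"
  unfolding prE_def by (rule cls_in[OF per_P0])

lemma prE [simp]: "x \<in> Car \<sigma> \<Longrightarrow> y \<in> Car \<tau> \<Longrightarrow> ap (ap (prE \<sigma> \<tau>) x) y = pr x y"
  unfolding prE_def
  by (elim CarE) (simp add: ap_cls[OF per_P0 _ ev_P0] ap_cls[OF per_P1 _ ev_P1] pr_cls del: per.simps)

definition fstE :: "uty \<Rightarrow> uty \<Rightarrow> elt" where "fstE \<sigma> \<tau> = cls (\<sigma> \<otimes> \<tau> \<Rrightarrow> \<sigma>) Fst0"
definition sndE :: "uty \<Rightarrow> uty \<Rightarrow> elt" where "sndE \<sigma> \<tau> = cls (\<sigma> \<otimes> \<tau> \<Rrightarrow> \<tau>) Snd0"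

lemma per_Fst0: "per (\<sigma> \<otimes> \<tau> \<Rrightarrow> \<sigma>) Fst0 Fst0" and per_Snd0: "per (\<sigma> \<otimes> \<tau> \<Rrightarrow> \<tau>) Snd0 Snd0"
  unfolding per.simps using ev_Fst ev_Snd by blast+

lemma fstE_in [simp, intro]: "fstE \<sigma> \<tau> \<in> Car (\<sigma> \<otimes> \<tau> \<Rrightarrow> \<sigma>)"
  unfolding fstE_def by (rule cls_in[OF per_Fst0])

lemma sndE_in [simp, intro]: "sndE \<sigma> \<tau> \<in> Car (\<sigma> \<otimes> \<tau> \<Rrightarrow> \<tau>)"
  unfolding sndE_def by (rule cls_in[OF per_Snd0])

lemma fstE [simp]: "p \<in> Car (\<sigma> \<otimes> \<tau>) \<Longrightarrow> ap (fstE \<sigma> \<tau>) p = pfst p"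
  and sndE [simp]: "p \<in> Car (\<sigma> \<otimes> \<tau>) \<Longrightarrow> ap (sndE \<sigma> \<tau>) p = psnd p"
proof -
  assume "p \<in> Car (\<sigma> \<otimes> \<tau>)"
  then obtain x y where "p = pr x y" "x \<in> Car \<sigma>" "y \<in> Car \<tau>" by (rule Car_UProd_E)
  then obtain a b where *: "p = pr (cls \<sigma> a) (cls \<tau> b)" "per \<sigma> a a" "per \<tau> b b"
    by (metis CarE)
  then have ab: "per (\<sigma> \<otimes> \<tau>) (VP a b) (VP a b)" by simp
  show "ap (fstE \<sigma> \<tau>) p = pfst p" "ap (sndE \<sigma> \<tau>) p = psnd p"
    unfolding *(1) elt.sel fstE_def sndE_def unfolding pr_cls
    by (rule ap_cls[OF per_Fst0 ab ev_Fst], rule ap_cls[OF per_Snd0 ab ev_Snd])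
qed

section \<open>The two functionals of type 2\<close>

definition muE :: elt where "muE = cls ((UNat \<Rrightarrow> UNat) \<Rrightarrow> UNat) Mu0"
definition orcE :: elt where "orcE = cls ((UNat \<Rrightarrow> UNat) \<Rrightarrow> UNat) Orc0"

text \<open>Numerals are related only to themselves, so equivalent codes of type 1 tabulate the same
  \<open>h\<close>. The results of \<open>Mu0\<close> and \<open>Orc0\<close> are determined by
  \<open>h\<close>, and therefore respect the equivalence.\<close>

lemma per_type1E:
  assumes "per (UNat \<Rrightarrow> UNat) f f'"
  obtains h where "\<And>k. app f (VN k) (VN (h k))" "\<And>k. app f' (VN k) (VN (h k))"
proof -
  have "\<forall>k. \<exists>n. app f (VN k) (VN n) \<and> app f' (VN k) (VN n)"
    using assms by (simp) metis
  then show ?thesis using that by metis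
qed

lemma per_Mu0: "per ((UNat \<Rrightarrow> UNat) \<Rrightarrow> UNat) Mu0 Mu0"
  unfolding per.simps(2)[of "UNat \<Rrightarrow> UNat"]
proof (intro allI impI)
  fix f f' assume "per (UNat \<Rrightarrow> UNat) f f'"
  then obtain h where "\<And>k. app f (VN k) (VN (h k))" "\<And>k. app f' (VN k) (VN (h k))"
    by (rule per_type1E) blast
  then have "app Mu0 f (VN (LEAST n. h n = 0))" "app Mu0 f' (VN (LEAST n. h n = 0))"
    by (blast intro: ev_Mu)+
  then show "\<exists>u v. app Mu0 f u \<and> app Mu0 f' v \<and> per UNat u v" by (force simp: per.simps(1))
qed

lemma per_Orc0: "per ((UNat \<Rrightarrow> UNat) \<Rrightarrow> UNat) Orc0 Orc0"
  unfolding per.simps(2)[of "UNat \<Rrightarrow> UNat"]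
proof (intro allI impI)
  fix f f' assume "per (UNat \<Rrightarrow> UNat) f f'"
  then obtain h where h: "\<And>k. app f (VN k) (VN (h k))" "\<And>k. app f' (VN k) (VN (h k))"
    by (rule per_type1E) blast
  then have "represents canon f h" by (simp add: represents_def)
  then obtain c where c: "(h, c) \<in> canon" using canon(3) by blast
  have "app Orc0 f (VN (to_nat c))" "app Orc0 f' (VN (to_nat c))"
    by (rule ev_Orc[OF h(1) c], rule ev_Orc[OF h(2) c])
  then show "\<exists>u v. app Orc0 f u \<and> app Orc0 f' v \<and> per UNat u v" by (force simp: per.simps(1))
qed

lemma muE_in [simp, intro]: "muE \<in> Car ((UNat \<Rrightarrow> UNat) \<Rrightarrow> UNat)"
  unfolding muE_def by (rule cls_in[OF per_Mu0])

lemma orcE_in [simp, intro]: "orcE \<in> Car ((UNat \<Rrightarrow> UNat) \<Rrightarrow> UNat)"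
  unfolding orcE_def by (rule cls_in[OF per_Orc0])

lemma type1_rep:
  assumes "f \<in> Car (UNat \<Rrightarrow> UNat)"
  obtains a h where "f = cls (UNat \<Rrightarrow> UNat) a" "per (UNat \<Rrightarrow> UNat) a a"
    "\<And>k. app a (VN k) (VN (h k))" "\<And>k. ap f (num k) = num (h k)"
proof -
  from assms obtain a where a: "f = cls (UNat \<Rrightarrow> UNat) a" "per (UNat \<Rrightarrow> UNat) a a" by (rule CarE)
  from a(2) obtain h where h: "\<And>k. app a (VN k) (VN (h k))" by (rule per_type1E) blast
  have "per UNat (VN k) (VN k)" for k by simp
  then have "ap f (num k) = num (h k)" for k
    unfolding a(1) num_cls by (rule ap_cls[OF a(2) _ h])
  with a h show ?thesis using that by blast
qed

lemma muE_zero: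
  assumes "f \<in> Car (UNat \<Rrightarrow> UNat)" "ap f (num m) = num 0"
  shows "ap f (ap muE f) = num 0"
proof -
  from assms(1) obtain a h where a: "f = cls (UNat \<Rrightarrow> UNat) a" "per (UNat \<Rrightarrow> UNat) a a"
    "\<And>k. app a (VN k) (VN (h k))" "\<And>k. ap f (num k) = num (h k)" using type1_rep by metis
  have "ap muE f = num (LEAST n. h n = 0)"
    unfolding a(1) muE_def num_cls by (rule ap_cls[OF per_Mu0 a(2) ev_Mu[OF a(3)]])
  moreover have "h m = 0" using assms(2) a(4) by simp
  ultimately show ?thesis using a(4) by (metis (mono_tags) LeastI)
qed

text \<open>The number determines the selected code, that code represents the function it was
  selected for, and evaluation is deterministic. So equal values force equal functions on the
  numerals, which exhaust \<open>Car UNat\<close>.\<close>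

lemma orcE_inj:
  assumes "f \<in> Car (UNat \<Rrightarrow> UNat)" "g \<in> Car (UNat \<Rrightarrow> UNat)" "ap orcE f = ap orcE g"
  shows "f = g"
proof -
  have *: "\<exists>h c. (h, c) \<in> canon \<and> ap orcE f = num (to_nat c) \<and> (\<forall>k. ap f (num k) = num (h k))"
    if "f \<in> Car (UNat \<Rrightarrow> UNat)" for f
  proof -
    from that obtain a h where a: "f = cls (UNat \<Rrightarrow> UNat) a" "per (UNat \<Rrightarrow> UNat) a a"
      "\<And>k. app a (VN k) (VN (h k))" "\<And>k. ap f (num k) = num (h k)" using type1_rep by metis
    then have "represents canon a h" by (simp add: represents_def)
    then obtain c where c: "(h, c) \<in> canon" using canon(3) by blast
    have "ap orcE f = num (to_nat c)"
      unfolding a(1) orcE_def num_cls by (rule ap_cls[OF per_Orc0 a(2) ev_Orc[OF a(3) c]])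
    with a c show ?thesis by blast
  qed
  from *[OF assms(1)] *[OF assms(2)] obtain h c h' c' where
    hc: "(h, c) \<in> canon" "ap orcE f = num (to_nat c)" "\<And>k. ap f (num k) = num (h k)"
      "(h', c') \<in> canon" "ap orcE g = num (to_nat c')" "\<And>k. ap g (num k) = num (h' k)" by blast
  then have "c = c'" using assms(3) by simp
  then have "represents canon c h" "represents canon c h'" using hc canon(2) by auto
  then have "h = h'" unfolding represents_def fun_eq_iff using app_det by (metis val.inject(1))
  then show ?thesis using hc assms by (intro fun_ext[of f UNat UNat g]) (auto simp: Car_UNat)
qed

section \<open>Definable functions\<close>

text \<open>Strategies are written as HOL functions; \<open>dfn\<close> says that such a function is
  given on the carrier by an element of the model. The closure rules below compile lambda terms to
  combinators, so that definability of a realizer follows by backward application of rules.\<close>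

definition dfn :: "uty \<Rightarrow> uty \<Rightarrow> (elt \<Rightarrow> elt) \<Rightarrow> bool" where
  "dfn \<sigma> \<tau> F \<longleftrightarrow> (\<exists>f\<in>Car (\<sigma> \<Rrightarrow> \<tau>). \<forall>x\<in>Car \<sigma>. ap f x = F x)"

definition dfnl :: "uty \<Rightarrow> uty \<Rightarrow> (elt \<Rightarrow> elt list) \<Rightarrow> bool" where
  "dfnl \<sigma> \<tau> F \<longleftrightarrow> dfn \<sigma> (USeq \<tau>) (\<lambda>x. lst (F x))"

definition LAM :: "uty \<Rightarrow> uty \<Rightarrow> (elt \<Rightarrow> elt) \<Rightarrow> elt" where
  "LAM \<sigma> \<tau> F = (THE f. f \<in> Car (\<sigma> \<Rrightarrow> \<tau>) \<and> (\<forall>x\<in>Car \<sigma>. ap f x = F x))"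

lemma dfnI: "f \<in> Car (\<sigma> \<Rrightarrow> \<tau>) \<Longrightarrow> (\<And>x. x \<in> Car \<sigma> \<Longrightarrow> ap f x = F x) \<Longrightarrow> dfn \<sigma> \<tau> F"
  by (auto simp: dfn_def)

lemma dfnE:
  assumes "dfn \<sigma> \<tau> F" obtains f where "f \<in> Car (\<sigma> \<Rrightarrow> \<tau>)" "\<And>x. x \<in> Car \<sigma> \<Longrightarrow> ap f x = F x"
  using assms by (auto simp: dfn_def)

lemma LAM_eqI:
  assumes "f \<in> Car (\<sigma> \<Rrightarrow> \<tau>)" "\<And>x. x \<in> Car \<sigma> \<Longrightarrow> ap f x = F x"
  shows "LAM \<sigma> \<tau> F = f"
  unfolding LAM_def by (rule the_equality) (use assms in \<open>auto intro: fun_ext\<close>)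

lemma LAM_in: "dfn \<sigma> \<tau> F \<Longrightarrow> LAM \<sigma> \<tau> F \<in> Car (\<sigma> \<Rrightarrow> \<tau>)"
  and ap_LAM: "dfn \<sigma> \<tau> F \<Longrightarrow> x \<in> Car \<sigma> \<Longrightarrow> ap (LAM \<sigma> \<tau> F) x = F x"
  by (erule dfnE, simp add: LAM_eqI)+

lemma dfn_in: "dfn \<sigma> \<tau> F \<Longrightarrow> x \<in> Car \<sigma> \<Longrightarrow> F x \<in> Car \<tau>"
  by (metis dfnE ap_in)

lemma dfnl_in: "dfnl \<sigma> \<tau> F \<Longrightarrow> x \<in> Car \<sigma> \<Longrightarrow> set (F x) \<subseteq> Car \<tau>"
  unfolding dfnl_def by (drule (1) dfn_in) simp

lemma dfn_cong: "dfn \<sigma> \<tau> G \<Longrightarrow> (\<And>x. x \<in> Car \<sigma> \<Longrightarrow> F x = G x) \<Longrightarrow> dfn \<sigma> \<tau> F"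
  by (auto simp: dfn_def)

lemma dfn_const: "d \<in> Car \<tau> \<Longrightarrow> dfn \<sigma> \<tau> (\<lambda>_. d)"
  by (rule dfnI[of "ap (kE \<tau> \<sigma>) d"]) auto

lemma dfn_id: "dfn \<sigma> \<sigma> (\<lambda>x. x)"
proof (rule dfnI)
  show "ap (ap (sE \<sigma> (\<sigma> \<Rrightarrow> \<sigma>) \<sigma>) (kE \<sigma> (\<sigma> \<Rrightarrow> \<sigma>))) (kE \<sigma> \<sigma>) \<in> Car (\<sigma> \<Rrightarrow> \<sigma>)" by auto
  fix x assume x: "x \<in> Car \<sigma>"
  then have "ap (kE \<sigma> \<sigma>) x \<in> Car (\<sigma> \<Rrightarrow> \<sigma>)" by auto
  with x show "ap (ap (ap (sE \<sigma> (\<sigma> \<Rrightarrow> \<sigma>) \<sigma>) (kE \<sigma> (\<sigma> \<Rrightarrow> \<sigma>))) (kE \<sigma> \<sigma>)) x = x" by simp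
qed

lemma dfn_ap:
  assumes "dfn \<rho> (\<sigma> \<Rrightarrow> \<tau>) F" "dfn \<rho> \<sigma> G"
  shows "dfn \<rho> \<tau> (\<lambda>r. ap (F r) (G r))"
proof -
  from assms obtain f g where fg: "f \<in> Car (\<rho> \<Rrightarrow> \<sigma> \<Rrightarrow> \<tau>)" "\<And>x. x \<in> Car \<rho> \<Longrightarrow> ap f x = F x"
    "g \<in> Car (\<rho> \<Rrightarrow> \<sigma>)" "\<And>x. x \<in> Car \<rho> \<Longrightarrow> ap g x = G x" by (metis dfnE)
  show ?thesis
  proof (rule dfnI)
    show "ap (ap (sE \<rho> \<sigma> \<tau>) f) g \<in> Car (\<rho> \<Rrightarrow> \<tau>)" using fg(1,3) by auto
  qed (simp add: fg)
qed

lemma dfn_ap_const: "f \<in> Car (\<sigma> \<Rrightarrow> \<tau>) \<Longrightarrow> dfn \<rho> \<sigma> G \<Longrightarrow> dfn \<rho> \<tau> (\<lambda>r. ap f (G r))"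
  by (rule dfn_ap[OF dfn_const])

lemma dfn_comp:
  assumes "dfn \<sigma> \<tau> F" "dfn \<rho> \<sigma> G"
  shows "dfn \<rho> \<tau> (\<lambda>r. F (G r))"
proof -
  from assms(1) obtain f where f: "f \<in> Car (\<sigma> \<Rrightarrow> \<tau>)" "\<And>x. x \<in> Car \<sigma> \<Longrightarrow> ap f x = F x" by (rule dfnE) blast
  show ?thesis by (rule dfn_cong[OF dfn_ap_const[OF f(1) assms(2)]]) (simp add: f(2) dfn_in[OF assms(2)])
qed

lemma dfn_pfst:
  assumes "dfn \<rho> (\<sigma> \<otimes> \<tau>) F"
  shows "dfn \<rho> \<sigma> (\<lambda>r. pfst (F r))"
  by (rule dfn_cong[OF dfn_ap_const[OF fstE_in assms]]) (simp add: dfn_in[OF assms])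

lemma dfn_psnd:
  assumes "dfn \<rho> (\<sigma> \<otimes> \<tau>) F"
  shows "dfn \<rho> \<tau> (\<lambda>r. psnd (F r))"
  by (rule dfn_cong[OF dfn_ap_const[OF sndE_in assms]]) (simp add: dfn_in[OF assms])

lemma dfn_pr:
  assumes "dfn \<rho> \<sigma> F" "dfn \<rho> \<tau> G"
  shows "dfn \<rho> (\<sigma> \<otimes> \<tau>) (\<lambda>r. pr (F r) (G r))"
  by (rule dfn_cong[OF dfn_ap[OF dfn_ap_const[OF prE_in assms(1)] assms(2)]])
    (simp add: dfn_in[OF assms(1)] dfn_in[OF assms(2)])

text \<open>A parameter and a bound variable are treated as a pair. If \<open>f\<close> represents
  the function of the pair, the abstraction is S applied to the constant function with value
  \<open>f\<close> and to pairing with \<open>r\<close>. The second claim is what beta reduction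
  under \<open>ap_LAM\<close> requires.\<close>

lemma dfn_lam:
  assumes "dfn (\<rho> \<otimes> \<sigma>) \<tau> (\<lambda>p. F (pfst p) (psnd p))"
  shows "dfn \<rho> (\<sigma> \<Rrightarrow> \<tau>) (\<lambda>r. LAM \<sigma> \<tau> (F r))"
    and "r \<in> Car \<rho> \<Longrightarrow> dfn \<sigma> \<tau> (F r)"
proof -
  from assms obtain f where f: "f \<in> Car (\<rho> \<otimes> \<sigma> \<Rrightarrow> \<tau>)"
    "\<And>r x. r \<in> Car \<rho> \<Longrightarrow> x \<in> Car \<sigma> \<Longrightarrow> ap f (pr r x) = F r x"
    by (rule dfnE) auto
  have c: "dfn \<rho> (\<sigma> \<Rrightarrow> \<tau>) (\<lambda>r. ap (ap (sE \<sigma> (\<rho> \<otimes> \<sigma>) \<tau>) (ap (kE (\<rho> \<otimes> \<sigma> \<Rrightarrow> \<tau>) \<sigma>) f)) (ap (prE \<rho> \<sigma>) r))"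
    by (intro dfn_ap_const[where \<sigma> = "\<sigma> \<Rrightarrow> \<rho> \<otimes> \<sigma>"] dfn_ap_const[OF prE_in] dfn_id ap_in[OF sE_in] ap_in[OF kE_in] f(1))
  have e: "ap (ap (ap (sE \<sigma> (\<rho> \<otimes> \<sigma>) \<tau>) (ap (kE (\<rho> \<otimes> \<sigma> \<Rrightarrow> \<tau>) \<sigma>) f)) (ap (prE \<rho> \<sigma>) r)) x = F r x"
    if "r \<in> Car \<rho>" "x \<in> Car \<sigma>" for r x
    using that f by (simp add: ap_in[OF kE_in] ap_in[OF prE_in])
  show "dfn \<rho> (\<sigma> \<Rrightarrow> \<tau>) (\<lambda>r. LAM \<sigma> \<tau> (F r))"
    by (rule dfn_cong[OF c]) (rule LAM_eqI[OF dfn_in[OF c] e])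
  show "dfn \<sigma> \<tau> (F r)" if "r \<in> Car \<rho>" using dfn_in[OF c that] e[OF that] by (rule dfnI)
qed

lemma dfnl_elems:
  assumes "dfn \<rho> (USeq \<sigma>) L"
  shows "dfnl \<rho> \<sigma> (\<lambda>r. elems (L r))"
  unfolding dfnl_def
proof (rule dfn_cong[OF assms])
  fix r assume "r \<in> Car \<rho>"
  then have "L r \<in> Car (USeq \<sigma>)" by (rule dfn_in[OF assms])
  then show "lst (elems (L r)) = L r" by (rule Car_USeq_E) simp
qed

lemma dfn_lst: "dfnl \<rho> \<sigma> L \<Longrightarrow> dfn \<rho> (USeq \<sigma>) (\<lambda>r. lst (L r))"
  by (simp add: dfnl_def)

lemma dfnl_Nil: "dfnl \<rho> \<sigma> (\<lambda>r. [])"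
  unfolding dfnl_def by (rule dfn_const) simp

lemma dfnl_Cons:
  assumes "dfn \<rho> \<sigma> X" "dfnl \<rho> \<sigma> L"
  shows "dfnl \<rho> \<sigma> (\<lambda>r. X r # L r)"
  unfolding dfnl_def
  by (rule dfn_cong[OF dfn_ap[OF dfn_ap_const[OF consE_in assms(1)] assms(2)[unfolded dfnl_def]]])
    (simp add: dfn_in[OF assms(1)] dfnl_in[OF assms(2)] consE)

text \<open>Parameter, accumulated value and entry are packed into nested pairs, so that
  definability of the step is again a statement about a function of one argument.\<close>

lemma dfn_foldr:
  assumes L: "dfnl \<rho> \<sigma> L" and Y: "dfn \<rho> \<tau> Y"
    and F: "dfn ((\<rho> \<otimes> \<tau>) \<otimes> \<sigma>) \<tau> (\<lambda>p. F (pfst (pfst p)) (psnd p) (psnd (pfst p)))"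
  shows "dfn \<rho> \<tau> (\<lambda>r. foldr (F r) (L r) (Y r))"
proof (rule dfn_cong)
  let ?Z = "\<lambda>r. LAM \<tau> (\<sigma> \<Rrightarrow> \<tau>) (\<lambda>a. LAM \<sigma> \<tau> (\<lambda>x. F r x a))"
  have 1: "dfn (\<rho> \<otimes> \<tau>) (\<sigma> \<Rrightarrow> \<tau>) (\<lambda>p. LAM \<sigma> \<tau> (\<lambda>x. F (pfst p) x (psnd p)))"
    by (rule dfn_lam(1)) (rule F)
  have 2: "dfn \<rho> (\<tau> \<Rrightarrow> \<sigma> \<Rrightarrow> \<tau>) ?Z"
    by (rule dfn_lam(1)) (rule 1)
  show "dfn \<rho> \<tau> (\<lambda>r. ap (ap (ap (lrecE \<sigma> \<tau>) (lst (L r))) (Y r)) (?Z r))"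
    using L unfolding dfnl_def by (intro dfn_ap[OF _ 2] dfn_ap[OF _ Y] dfn_ap_const[OF lrecE_in])
  fix r assume r: "r \<in> Car \<rho>"
  have L': "set (L r) \<subseteq> Car \<sigma>" using dfnl_in[OF L r] .
  have e: "ap (ap (?Z r) a) x = F r x a" if "x \<in> Car \<sigma>" "a \<in> Car \<tau>" for x a
  proof -
    have "dfn \<sigma> \<tau> (\<lambda>x. F r x a)" using dfn_lam(2)[of "\<rho> \<otimes> \<tau>" \<sigma> \<tau> "\<lambda>p x. F (pfst p) x (psnd p)" "pr r a"] F r that by simp
    with that dfn_lam(2)[OF 1 r] show ?thesis by (simp add: ap_LAM)
  qed
  have FC: "F r x a \<in> Car \<tau>" if "x \<in> Car \<sigma>" "a \<in> Car \<tau>" for x a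
    using dfn_in[OF F, of "pr (pr r a) x"] that r by simp
  have Y': "Y r \<in> Car \<tau>" using dfn_in[OF Y r] .
  have "foldr (\<lambda>x a. ap (ap (?Z r) a) x) xs (Y r) = foldr (F r) xs (Y r) \<and> foldr (F r) xs (Y r) \<in> Car \<tau>"
    if "set xs \<subseteq> Car \<sigma>" for xs
    using that by (induction xs) (simp_all add: Y' e FC)
  with L' show "foldr (F r) (L r) (Y r) = ap (ap (ap (lrecE \<sigma> \<tau>) (lst (L r))) (Y r)) (?Z r)"
    using lrecE[OF _ Y' dfn_in[OF 2 r], of "lst (L r)"] by simp
qed

lemma dfn_rec_nat:
  assumes N: "dfn \<rho> UNat N" and Y: "dfn \<rho> \<tau> Y"
    and F: "dfn ((\<rho> \<otimes> \<tau>) \<otimes> UNat) \<tau> (\<lambda>p. F (pfst (pfst p)) (psnd p) (psnd (pfst p)))"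
  shows "dfn \<rho> \<tau> (\<lambda>r. rec_nat (Y r) (\<lambda>k. F r (num k)) (natof (N r)))"
proof (rule dfn_cong)
  let ?Z = "\<lambda>r. LAM \<tau> (UNat \<Rrightarrow> \<tau>) (\<lambda>a. LAM UNat \<tau> (\<lambda>x. F r x a))"
  have 1: "dfn (\<rho> \<otimes> \<tau>) (UNat \<Rrightarrow> \<tau>) (\<lambda>p. LAM UNat \<tau> (\<lambda>x. F (pfst p) x (psnd p)))"
    by (rule dfn_lam(1)) (rule F)
  have 2: "dfn \<rho> (\<tau> \<Rrightarrow> UNat \<Rrightarrow> \<tau>) ?Z"
    by (rule dfn_lam(1)) (rule 1)
  show "dfn \<rho> \<tau> (\<lambda>r. ap (ap (ap (recE \<tau>) (N r)) (Y r)) (?Z r))"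
    by (intro dfn_ap[OF _ 2] dfn_ap[OF _ Y] dfn_ap_const[OF recE_in] N)
  fix r assume r: "r \<in> Car \<rho>"
  have e: "ap (ap (?Z r) a) x = F r x a" if "x \<in> Car UNat" "a \<in> Car \<tau>" for x a
  proof -
    have "dfn UNat \<tau> (\<lambda>x. F r x a)" using dfn_lam(2)[of "\<rho> \<otimes> \<tau>" UNat \<tau> "\<lambda>p x. F (pfst p) x (psnd p)" "pr r a"] F r that by simp
    with that dfn_lam(2)[OF 1 r] show ?thesis by (simp add: ap_LAM)
  qed
  have FC: "F r x a \<in> Car \<tau>" if "x \<in> Car UNat" "a \<in> Car \<tau>" for x a
    using dfn_in[OF F, of "pr (pr r a) x"] that r by simp
  have Y': "Y r \<in> Car \<tau>" using dfn_in[OF Y r] .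
  have "ap (ap (ap (recE \<tau>) (num n)) (Y r)) (?Z r) = rec_nat (Y r) (\<lambda>k. F r (num k)) n
     \<and> rec_nat (Y r) (\<lambda>k. F r (num k)) n \<in> Car \<tau>" for n
    using dfn_in[OF 2 r] by (induction n) (simp_all add: Y' e FC)
  moreover obtain n where "N r = num n" using dfn_in[OF N r] by (auto simp: Car_UNat)
  ultimately show "rec_nat (Y r) (\<lambda>k. F r (num k)) (natof (N r)) = ap (ap (ap (recE \<tau>) (N r)) (Y r)) (?Z r)"
    by simp
qed

lemmas dfn_basics = dfn_const dfn_id dfn_ap dfn_pfst dfn_psnd dfn_pr dfn_lam(1) dfnl_elems dfn_lst dfnl_Nil dfnl_Cons

section \<open>Definable operations on lists\<close>

lemma dfnl_append:
  assumes "dfnl \<rho> \<sigma> L" "dfnl \<rho> \<sigma> M"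
  shows "dfnl \<rho> \<sigma> (\<lambda>r. L r @ M r)"
proof -
  have "dfn \<rho> (USeq \<sigma>) (\<lambda>r. foldr (\<lambda>x a. lst (x # elems a)) (L r) (lst (M r)))"
    by (rule dfn_foldr[OF assms(1)] dfn_lst[OF assms(2)] dfn_basics)+
  moreover have "foldr (\<lambda>x a. lst (x # elems a)) xs (lst ys) = lst (xs @ ys)" for xs ys
    by (induction xs) auto
  ultimately show ?thesis by (simp add: dfnl_def)
qed

lemma dfnl_map:
  assumes "dfnl \<rho> \<sigma> L" "dfn (\<rho> \<otimes> \<sigma>) \<tau> (\<lambda>p. F (pfst p) (psnd p))"
  shows "dfnl \<rho> \<tau> (\<lambda>r. map (F r) (L r))"
proof -
  have "dfn ((\<rho> \<otimes> USeq \<tau>) \<otimes> \<sigma>) (\<rho> \<otimes> \<sigma>) (\<lambda>p. pr (pfst (pfst p)) (psnd p))"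
    by (rule dfn_basics)+
  from dfn_comp[OF assms(2) this] have "dfn ((\<rho> \<otimes> USeq \<tau>) \<otimes> \<sigma>) \<tau> (\<lambda>p. F (pfst (pfst p)) (psnd p))"
    by simp
  then have "dfn \<rho> (USeq \<tau>) (\<lambda>r. foldr (\<lambda>x a. lst (F r x # elems a)) (L r) (lst []))"
    by - (rule dfn_foldr[OF assms(1)] dfn_basics | assumption)+
  moreover have "foldr (\<lambda>x a. lst (F r x # elems a)) xs (lst []) = lst (map (F r) xs)" for r xs
    by (induction xs) auto
  ultimately show ?thesis by (simp add: dfnl_def)
qed

lemma dfnl_concat_map:
  assumes "dfnl \<rho> \<sigma> L" "dfnl (\<rho> \<otimes> \<sigma>) \<tau> (\<lambda>p. F (pfst p) (psnd p))"
  shows "dfnl \<rho> \<tau> (\<lambda>r. concat (map (F r) (L r)))"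
proof -
  have "dfn ((\<rho> \<otimes> USeq \<tau>) \<otimes> \<sigma>) (\<rho> \<otimes> \<sigma>) (\<lambda>p. pr (pfst (pfst p)) (psnd p))"
    by (rule dfn_basics)+
  from dfn_comp[OF assms(2)[unfolded dfnl_def] this]
  have "dfnl ((\<rho> \<otimes> USeq \<tau>) \<otimes> \<sigma>) \<tau> (\<lambda>p. F (pfst (pfst p)) (psnd p))"
    by (simp add: dfnl_def)
  then have "dfn \<rho> (USeq \<tau>) (\<lambda>r. foldr (\<lambda>x a. lst (F r x @ elems a)) (L r) (lst []))"
    by - (rule dfn_foldr[OF assms(1)] dfnl_append dfn_basics | assumption)+
  moreover have "foldr (\<lambda>x a. lst (F r x @ elems a)) xs (lst []) = lst (concat (map (F r) xs))" for r xs
    by (induction xs) auto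
  ultimately show ?thesis by (simp add: dfnl_def)
qed

section \<open>Default elements and joins of responses\<close>

primrec dfl :: "uty \<Rightarrow> elt" where
  "dfl UNat = num 0"
| "dfl (\<sigma> \<Rrightarrow> \<tau>) = ap (kE \<tau> \<sigma>) (dfl \<tau>)"
| "dfl (USeq \<sigma>) = lst []"
| "dfl (\<sigma> \<otimes> \<tau>) = pr (dfl \<sigma>) (dfl \<tau>)"

lemma dfl_in [simp, intro]: "dfl \<tau> \<in> Car \<tau>"
  by (induction \<tau>) auto

text \<open>Taking the first argument is harmless at numbers, which stand in responses only for the
  empty data of \<open>Fls\<close> and equations. The information sits in the sequences, where
  concatenation keeps the content of both arguments.\<close>

primrec join :: "uty \<Rightarrow> elt \<Rightarrow> elt \<Rightarrow> elt" where
  "join UNat a b = a"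
| "join (\<sigma> \<Rrightarrow> \<tau>) a b = a"
| "join (USeq \<sigma>) a b = lst (elems a @ elems b)"
| "join (\<sigma> \<otimes> \<tau>) a b = pr (join \<sigma> (pfst a) (pfst b)) (join \<tau> (psnd a) (psnd b))"

lemma dfn_join: "dfn \<rho> \<tau> F \<Longrightarrow> dfn \<rho> \<tau> G \<Longrightarrow> dfn \<rho> \<tau> (\<lambda>r. join \<tau> (F r) (G r))"
proof (induction \<tau> arbitrary: F G)
  case (USeq \<sigma>)
  then show ?case unfolding join.simps by - (rule dfn_lst dfnl_append dfnl_elems | assumption)+
next
  case (UProd \<sigma> \<tau>)
  show ?case unfolding join.simps
    by (rule dfn_pr UProd.IH dfn_pfst[OF UProd.prems(1)] dfn_pfst[OF UProd.prems(2)]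
        dfn_psnd[OF UProd.prems(1)] dfn_psnd[OF UProd.prems(2)])+
qed simp_all

definition joins :: "uty \<Rightarrow> elt list \<Rightarrow> elt" where
  "joins \<tau> xs = foldr (join \<tau>) xs (dfl \<tau>)"

lemma dfn_joins:
  assumes "dfnl \<rho> \<tau> L"
  shows "dfn \<rho> \<tau> (\<lambda>r. joins \<tau> (L r))"
  unfolding joins_def by (rule dfn_foldr[OF assms] dfn_join dfn_basics dfl_in)+

lemmas dfn_rules = dfn_basics dfnl_append dfnl_map dfnl_concat_map dfn_joins num_in dfl_in

section \<open>The functional interpretation of formulas\<close>

primrec emb :: "ty \<Rightarrow> uty" where
  "emb Num = UNat"
| "emb (\<sigma> \<leadsto> \<tau>) = (emb \<sigma> \<Rrightarrow> emb \<tau>)"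
| "emb (Sq \<sigma>) = USeq (emb \<sigma>)"

primrec cE :: "cnst \<Rightarrow> elt" where
  "cE Zero = num 0"
| "cE Succ = sucE"
| "cE (CombK \<sigma> \<tau>) = kE (emb \<sigma>) (emb \<tau>)"
| "cE (CombS \<rho> \<sigma> \<tau>) = sE (emb \<rho>) (emb \<sigma>) (emb \<tau>)"
| "cE (Rec \<rho>) = recE (emb \<rho>)"
| "cE (SNil \<sigma>) = lst []"
| "cE (SCons \<sigma>) = consE (emb \<sigma>)"
| "cE (SRec \<sigma> \<rho>) = lrecE (emb \<sigma>) (emb \<rho>)"

lemma cE_in [simp]: "cE c \<in> Car (emb (cty c))"
  by (cases c) auto

type_synonym env = "var \<Rightarrow> elt"

definition Env :: "env set" where "Env = {e. \<forall>x. e x \<in> Car (emb (snd x))}"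

lemma EnvD [intro]: "e \<in> Env \<Longrightarrow> e x \<in> Car (emb (snd x))"
  unfolding Env_def by blast

lemma Env_upd [simp, intro]: "e \<in> Env \<Longrightarrow> d \<in> Car (emb (snd x)) \<Longrightarrow> e(x := d) \<in> Env"
  unfolding Env_def by (auto simp del: split_paired_All)

lemma ex_Env: "\<exists>e. e \<in> Env"
  by (rule exI[of _ "\<lambda>x. dfl (emb (snd x))"]) (simp add: Env_def)

primrec tval :: "env \<Rightarrow> tm \<Rightarrow> elt" where
  "tval e (Var x) = e x"
| "tval e (Cn c) = cE c"
| "tval e (s \<cdot> t) = ap (tval e s) (tval e t)"

lemma tval_in: "wt t \<Longrightarrow> e \<in> Env \<Longrightarrow> tval e t \<in> Car (emb (ty_of t))"
proof (induction t)
  case (App s t)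
  then obtain \<tau> where "ty_of s = ty_of t \<leadsto> \<tau>" by auto
  with App show ?case by auto
qed auto

lemma tval_in': "wt t \<Longrightarrow> e \<in> Env \<Longrightarrow> ty_of t = \<tau> \<Longrightarrow> tval e t \<in> Car (emb \<tau>)"
  using tval_in by blast

lemma ty_of_subst: "ty_of t = snd x \<Longrightarrow> ty_of (subst_tm x t s) = ty_of s"
  by (induction s) auto

lemma tval_subst: "tval e (subst_tm x t s) = tval (e(x := tval e t)) s"
  by (induction s) auto

lemma tval_cong: "(\<And>v. v \<in> fvt t \<Longrightarrow> e v = e' v) \<Longrightarrow> tval e t = tval e' t"
  by (induction t) auto

lemma tval_upd [simp]: "x \<notin> fvt t \<Longrightarrow> tval (e(x := d)) t = tval e t"
  by (rule tval_cong) auto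

text \<open>The first component types challenges, the second responses. To challenge an implication
  is to bring a strategy for the antecedent and a challenge to the consequent; the response consists
  of finitely many tests of that strategy and a response to the consequent. This is the implication
  of Shoenfield's interpretation, with finite lists of tests in place of a single one.\<close>

primrec game :: "fm \<Rightarrow> uty \<times> uty" where
  "game Fls = (UNat, UNat)"
| "game (s \<doteq> t) = (UNat, UNat)"
| "game (St t) = (UNat, USeq (emb (ty_of t)))"
| "game (A \<^bold>\<longrightarrow> B) = ((fst (game A) \<Rrightarrow> snd (game A)) \<otimes> fst (game B), USeq (fst (game A)) \<otimes> snd (game B))"
| "game (Forall x A) = game A"

definition chal :: "fm \<Rightarrow> uty" where "chal A = fst (game A)"
definition resp :: "fm \<Rightarrow> uty" where "resp A = snd (game A)"

lemma chal_simps [simp]: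
  "chal Fls = UNat" "chal (s \<doteq> t) = UNat" "chal (St t) = UNat"
  "chal (A \<^bold>\<longrightarrow> B) = (chal A \<Rrightarrow> resp A) \<otimes> chal B" "chal (Forall x A) = chal A"
  by (simp_all add: chal_def resp_def)

lemma resp_simps [simp]:
  "resp Fls = UNat" "resp (s \<doteq> t) = UNat" "resp (St t) = USeq (emb (ty_of t))"
  "resp (A \<^bold>\<longrightarrow> B) = USeq (chal A) \<otimes> resp B" "resp (Forall x A) = resp A"
  by (simp_all add: chal_def resp_def)

text \<open>\<open>rl A e x y\<close> says that the response \<open>y\<close> meets the challenge \<open>x\<close> to \<open>A\<close>. Quantifiers are uniform,
  so only \<open>St\<close> asks for data: a list containing the value of the term.
  The default challenge in the clause for implication makes the finite set of challenges
  nonempty, so that internal formulas get their plain truth value.\<close>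

primrec rl :: "fm \<Rightarrow> env \<Rightarrow> elt \<Rightarrow> elt \<Rightarrow> bool" where
  "rl Fls e x y \<longleftrightarrow> False"
| "rl (s \<doteq> t) e x y \<longleftrightarrow> tval e s = tval e t"
| "rl (St t) e x y \<longleftrightarrow> tval e t \<in> set (elems y)"
| "rl (A \<^bold>\<longrightarrow> B) e x y \<longleftrightarrow>
     ((\<forall>a\<in>set (dfl (chal A) # elems (pfst y)). rl A e a (ap (pfst x) a)) \<longrightarrow> rl B e (psnd x) (psnd y))"
| "rl (Forall v A) e x y \<longleftrightarrow> (\<forall>d\<in>Car (emb (snd v)). rl A (e(v := d)) x y)"

primrec sat :: "fm \<Rightarrow> env \<Rightarrow> bool" where
  "sat Fls e \<longleftrightarrow> False"
| "sat (s \<doteq> t) e \<longleftrightarrow> tval e s = tval e t"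
| "sat (St t) e \<longleftrightarrow> True"
| "sat (A \<^bold>\<longrightarrow> B) e \<longleftrightarrow> (sat A e \<longrightarrow> sat B e)"
| "sat (Forall v A) e \<longleftrightarrow> (\<forall>d\<in>Car (emb (snd v)). sat A (e(v := d)))"

text \<open>This trades realizability for truth in the model: the internal matrices of idealisation
  and choice can be evaluated by \<open>sat\<close>, whatever challenges and responses have come up
  in the play.\<close>

lemma rl_internal:
  "internal A \<Longrightarrow> x \<in> Car (chal A) \<Longrightarrow> y \<in> Car (resp A) \<Longrightarrow> rl A e x y \<longleftrightarrow> sat A e"
proof (induction A arbitrary: e x y)
  case (Imp A B)
  then have x: "pfst x \<in> Car (chal A \<Rrightarrow> resp A)" "psnd x \<in> Car (chal B)"
    and y: "pfst y \<in> Car (USeq (chal A))" "psnd y \<in> Car (resp B)" by auto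
  have "rl A e a (ap (pfst x) a) \<longleftrightarrow> sat A e" if "a \<in> set (dfl (chal A) # elems (pfst y))" for a
  proof -
    have "a \<in> Car (chal A)" using that elems_in[OF y(1)] by auto
    with x(1) have "ap (pfst x) a \<in> Car (resp A)" by (rule ap_in)
    with \<open>a \<in> Car (chal A)\<close> show ?thesis using Imp.IH(1) Imp.prems(1) by simp
  qed
  moreover have "rl B e (psnd x) (psnd y) \<longleftrightarrow> sat B e" using Imp x y by auto
  ultimately show ?case by auto
qed auto

lemma rl_cong: "(\<And>v. v \<in> fv A \<Longrightarrow> e v = e' v) \<Longrightarrow> rl A e x y = rl A e' x y"
proof (induction A arbitrary: e e' x y)
  case (Eq s t)
  then have "tval e s = tval e' s" "tval e t = tval e' t" by (auto intro: tval_cong)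
  then show ?case by simp
next
  case (St t)
  then have "tval e t = tval e' t" by (auto intro: tval_cong)
  then show ?case by simp
next
  case (Imp A B)
  have "rl A e x y = rl A e' x y" "rl B e x y = rl B e' x y" for x y
    by (rule Imp.IH; simp add: Imp.prems)+
  then show ?case by simp
next
  case (Forall v A)
  have "rl A (e(v := d)) x y = rl A (e'(v := d)) x y" for d
    by (rule Forall.IH) (use Forall.prems in auto)
  then show ?case by simp
qed simp

lemma sat_cong: "(\<And>v. v \<in> fv A \<Longrightarrow> e v = e' v) \<Longrightarrow> sat A e = sat A e'"
proof (induction A arbitrary: e e')
  case (Eq s t)
  then have "tval e s = tval e' s" "tval e t = tval e' t" by (auto intro: tval_cong)
  then show ?case by simp
next
  case (Imp A B)
  have "sat A e = sat A e'" "sat B e = sat B e'"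
    by (rule Imp.IH; simp add: Imp.prems)+
  then show ?case by simp
next
  case (Forall v A)
  have "sat A (e(v := d)) = sat A (e'(v := d))" for d
    by (rule Forall.IH) (use Forall.prems in auto)
  then show ?case by simp
qed simp_all

lemma rl_upd [simp]: "x \<notin> fv A \<Longrightarrow> rl A (e(x := d)) = rl A e"
  unfolding fun_eq_iff by (intro allI rl_cong) auto

lemma game_subst: "ty_of t = snd x \<Longrightarrow> game (subst x t A) = game A"
  by (induction A) (simp_all add: ty_of_subst)

lemma chal_subst: "ty_of t = snd x \<Longrightarrow> chal (subst x t A) = chal A"
  and resp_subst: "ty_of t = snd x \<Longrightarrow> resp (subst x t A) = resp A"
  by (simp_all add: chal_def resp_def game_subst)

lemma subst_tm_notin: "x \<notin> fvt s \<Longrightarrow> subst_tm x t s = s"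
  by (induction s) auto

lemma subst_notin: "x \<notin> fv A \<Longrightarrow> subst x t A = A"
  by (induction A) (auto simp: subst_tm_notin)

lemma rl_subst:
  "free_for t x A \<Longrightarrow> ty_of t = snd x \<Longrightarrow> rl (subst x t A) e = rl A (e(x := tval e t))"
proof (induction A arbitrary: e)
  case (Forall y A)
  show ?case
  proof (cases "x \<in> fv (Forall y A)")
    case True
    then have "y \<notin> fvt t" "free_for t x A" "y \<noteq> x" using Forall.prems by auto
    then have "rl (subst x t A) (e(y := d)) = rl A (e(y := d, x := tval e t))" for d
      using Forall.IH[of "e(y := d)"] Forall.prems(2) tval_upd[OF \<open>y \<notin> fvt t\<close>, of e d]
        \<open>free_for t x A\<close> by metis
    then show ?thesis using \<open>y \<noteq> x\<close> unfolding fun_eq_iff by (simp add: fun_upd_twist)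
  next
    case False
    then show ?thesis by (simp only: subst_notin rl_upd not_False_eq_True)
  qed
qed (auto simp: fun_eq_iff tval_subst chal_subst)

lemma internal_subst: "internal (subst x t A) = internal A"
  by (induction A) auto

lemma sat_rl: "internal A \<Longrightarrow> sat A e \<longleftrightarrow> rl A e (dfl (chal A)) (dfl (resp A))"
  by (simp add: rl_internal)

lemma sat_subst:
  "internal A \<Longrightarrow> free_for t x A \<Longrightarrow> ty_of t = snd x \<Longrightarrow> sat (subst x t A) e = sat A (e(x := tval e t))"
  by (simp add: sat_rl internal_subst rl_subst chal_subst resp_subst)

lemma free_forI: "fvt t \<subseteq> {x} \<Longrightarrow> free_for t x A"
  by (induction A) auto

text \<open>Responses act positively: more tests make the antecedent of the implication clause
  harder to satisfy, and a longer list for \<open>St\<close> contains more values. A player who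
  cannot tell which of finitely many responses is right may thus give all of them at once.\<close>

lemma rl_join: "rl A e x y \<or> rl A e x y' \<Longrightarrow> rl A e x (join (resp A) y y')"
proof (induction A arbitrary: e x y y')
  case (Imp A B)
  then show ?case by auto
next
  case (Forall v A)
  then show ?case by simp blast
qed auto

lemma rl_joins: "y \<in> set ys \<Longrightarrow> rl A e x y \<Longrightarrow> rl A e x (joins (resp A) ys)"
  unfolding joins_def by (induction ys) (auto intro: rl_join)

section \<open>Realizability and the logical axioms\<close>

definition realizable :: "fm \<Rightarrow> bool" where
  "realizable A \<longleftrightarrow> (\<exists>Y\<in>Car (chal A \<Rrightarrow> resp A). \<forall>e\<in>Env. \<forall>x\<in>Car (chal A). rl A e x (ap Y x))"

lemma realizableI:
  assumes "dfn (chal A) (resp A) F" "\<And>e x. e \<in> Env \<Longrightarrow> x \<in> Car (chal A) \<Longrightarrow> rl A e x (F x)"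
  shows "realizable A"
  using assms(1)
proof (rule dfnE)
  fix f assume "f \<in> Car (chal A \<Rrightarrow> resp A)" "\<And>x. x \<in> Car (chal A) \<Longrightarrow> ap f x = F x"
  then show ?thesis unfolding realizable_def by (intro bexI[of _ f] ballI) (simp_all add: assms(2))
qed

lemma realizableE:
  assumes "realizable A"
  obtains Y where "Y \<in> Car (chal A \<Rrightarrow> resp A)"
    "\<And>e x. e \<in> Env \<Longrightarrow> x \<in> Car (chal A) \<Longrightarrow> rl A e x (ap Y x)"
  using assms by (auto simp: realizable_def)

lemma realizable_internal:
  assumes "internal A" "\<And>e. e \<in> Env \<Longrightarrow> sat A e"
  shows "realizable A"
  by (rule realizableI[where F = "\<lambda>_. dfl (resp A)"])
    (auto simp: rl_internal assms intro: dfn_const)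

text \<open>Play the strategy for the implication against the one for \<open>A\<close>, which passes
  all tests that are asked for.\<close>

lemma realizable_MP:
  assumes "realizable (A \<^bold>\<longrightarrow> B)" "realizable A"
  shows "realizable B"
proof -
  obtain R where R: "R \<in> Car (chal (A \<^bold>\<longrightarrow> B) \<Rrightarrow> resp (A \<^bold>\<longrightarrow> B))"
    "\<And>e x. e \<in> Env \<Longrightarrow> x \<in> Car (chal (A \<^bold>\<longrightarrow> B)) \<Longrightarrow> rl (A \<^bold>\<longrightarrow> B) e x (ap R x)"
    using assms(1) by (rule realizableE) blast
  obtain Y where Y: "Y \<in> Car (chal A \<Rrightarrow> resp A)"
    "\<And>e x. e \<in> Env \<Longrightarrow> x \<in> Car (chal A) \<Longrightarrow> rl A e x (ap Y x)"
    using assms(2) by (rule realizableE) blast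
  show ?thesis
  proof (rule realizableI[where F = "\<lambda>u. psnd (ap R (pr Y u))"])
    show "dfn (chal B) (resp B) (\<lambda>u. psnd (ap R (pr Y u)))"
      using R(1) Y(1) by - (rule dfn_rules | simp)+
    fix e u assume e: "e \<in> Env" and u: "u \<in> Car (chal B)"
    have p: "pr Y u \<in> Car (chal (A \<^bold>\<longrightarrow> B))" using Y u by simp
    have "pfst (ap R (pr Y u)) \<in> Car (USeq (chal A))" using ap_in[OF R(1) p] by auto
    then have "set (elems (pfst (ap R (pr Y u)))) \<subseteq> Car (chal A)" by (rule elems_in)
    then show "rl B e u (psnd (ap R (pr Y u)))"
      using R(2)[OF e p] Y(2)[OF e] by auto
  qed
qed

text \<open>A realizer is chosen before the environment, so it already meets the uniform reading of
  the quantifier.\<close>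

lemma realizable_Gen:
  assumes "realizable A"
  shows "realizable (Forall x A)"
  using assms by (auto simp: realizable_def)

lemma realizable_ImpK: "realizable (A \<^bold>\<longrightarrow> B \<^bold>\<longrightarrow> A)"
proof (rule realizableI)
  let ?F = "\<lambda>p. pr (lst [psnd (psnd p)]) (pr (lst []) (ap (pfst p) (psnd (psnd p))))"
  show "dfn (chal (A \<^bold>\<longrightarrow> B \<^bold>\<longrightarrow> A)) (resp (A \<^bold>\<longrightarrow> B \<^bold>\<longrightarrow> A)) ?F"
    by (simp only: chal_simps resp_simps) (rule dfn_rules)+
qed auto

lemma realizable_ImpS: "realizable ((A \<^bold>\<longrightarrow> B \<^bold>\<longrightarrow> C) \<^bold>\<longrightarrow> (A \<^bold>\<longrightarrow> B) \<^bold>\<longrightarrow> A \<^bold>\<longrightarrow> C)"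
proof (rule realizableI)
  \<comment> \<open>The challenge \<open>p\<close> packs strategies for the three antecedents and a
    challenge to \<open>C\<close>. Here \<open>?Q p u\<close> is the answer of the second strategy
    when it is given the third and challenged with \<open>u\<close> on \<open>B\<close>. The
    challenge \<open>?q\<close> plays the first strategy against the third and against the strategy
    for \<open>B\<close> so obtained, and \<open>?us\<close> are the tests of \<open>B\<close> that
    it then asks for.\<close>
  let ?Q = "\<lambda>p u. ap (pfst (psnd p)) (pr (pfst (psnd (psnd p))) u)"
  let ?q = "\<lambda>p. pr (pfst (psnd (psnd p))) (pr (LAM (chal B) (resp B) (\<lambda>u. psnd (?Q p u))) (psnd (psnd (psnd p))))"
  let ?o = "\<lambda>p. ap (pfst p) (?q p)"
  let ?us = "\<lambda>p. dfl (chal B) # elems (pfst (psnd (?o p)))"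
  let ?F = "\<lambda>p. pr (lst [?q p]) (pr (lst (map (\<lambda>u. pr (pfst (psnd (psnd p))) u) (?us p)))
    (pr (lst (elems (pfst (?o p)) @ concat (map (\<lambda>u. elems (pfst (?Q p u))) (?us p)))) (psnd (psnd (?o p)))))"
  let ?X = "(A \<^bold>\<longrightarrow> B \<^bold>\<longrightarrow> C) \<^bold>\<longrightarrow> (A \<^bold>\<longrightarrow> B) \<^bold>\<longrightarrow> A \<^bold>\<longrightarrow> C"
  show "dfn (chal ?X) (resp ?X) ?F"
    by (simp only: chal_simps resp_simps) (rule dfn_rules)+
  fix e p assume e: "e \<in> Env" and p: "p \<in> Car (chal ?X)"
  have beta: "ap (LAM (chal B) (resp B) (\<lambda>u. psnd (?Q p u))) u = psnd (?Q p u)" if "u \<in> Car (chal B)" for u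
    by (rule ap_LAM[OF dfn_lam(2)[OF _ p] that])
      (simp only: chal_simps resp_simps, (rule dfn_rules)+)
  have us: "set (?us p) \<subseteq> Car (chal B)"
  proof -
    have "dfnl (chal ?X) (chal B) ?us"
      by (simp only: chal_simps resp_simps) (rule dfn_rules)+
    from dfnl_in[OF this p] show ?thesis .
  qed
  show "rl ?X e p (?F p)"
    unfolding rl.simps(4)[of "A \<^bold>\<longrightarrow> B \<^bold>\<longrightarrow> C"] rl.simps(4)[of "A \<^bold>\<longrightarrow> B" "A \<^bold>\<longrightarrow> C"] rl.simps(4)[of A C] elt.sel
  proof (intro impI)
    assume H: "\<forall>a\<in>set (dfl (chal (A \<^bold>\<longrightarrow> B \<^bold>\<longrightarrow> C)) # [?q p]). rl (A \<^bold>\<longrightarrow> B \<^bold>\<longrightarrow> C) e a (ap (pfst p) a)"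
      "\<forall>a\<in>set (dfl (chal (A \<^bold>\<longrightarrow> B)) # map (pr (pfst (psnd (psnd p)))) (?us p)).
         rl (A \<^bold>\<longrightarrow> B) e a (ap (pfst (psnd p)) a)"
      "\<forall>a\<in>set (dfl (chal A) # elems (pfst (?o p)) @ concat (map (\<lambda>u. elems (pfst (?Q p u))) (?us p))).
         rl A e a (ap (pfst (psnd (psnd p))) a)"
    have B: "rl B e u (psnd (?Q p u))" if "u \<in> set (?us p)" for u
    proof -
      have "rl (A \<^bold>\<longrightarrow> B) e (pr (pfst (psnd (psnd p))) u) (?Q p u)" using H(2) that by auto
      with H(3) that show ?thesis unfolding rl.simps(4)[of A B] elt.sel by auto
    qed
    have "rl (A \<^bold>\<longrightarrow> B \<^bold>\<longrightarrow> C) e (?q p) (?o p)" using H(1) by auto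
    then have "rl (B \<^bold>\<longrightarrow> C) e (psnd (?q p)) (psnd (?o p))"
      using H(3) unfolding rl.simps(4)[of A "B \<^bold>\<longrightarrow> C"] elt.sel by auto
    moreover have "rl B e u (ap (pfst (psnd (?q p))) u)" if "u \<in> set (?us p)" for u
      using B[OF that] beta[of u] us that unfolding elt.sel by auto
    ultimately show "rl C e (psnd (psnd (psnd p))) (psnd (psnd (?o p)))"
      unfolding rl.simps(4)[of B C] elt.sel by blast
  qed
qed

text \<open>The classical step. The strategy for the double negation is challenged with the strategy
  for \<open>Neg A\<close> that always tests the given challenge to \<open>A\<close>. To defend
  itself it has to produce strategies for \<open>A\<close>, one of which passes this test; as it is
  unknown which one, all their answers are joined.\<close>

lemma realizable_DNeg: "realizable (Neg (Neg A) \<^bold>\<longrightarrow> A)"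
proof (rule realizableI)
  let ?X = "Neg (Neg A) \<^bold>\<longrightarrow> A"
  let ?E = "\<lambda>p. pr (LAM (chal (Neg A)) (resp (Neg A)) (\<lambda>_. pr (lst [psnd p]) (num 0))) (num 0)"
  let ?l = "\<lambda>p. dfl (chal (Neg A)) # elems (pfst (ap (pfst p) (?E p)))"
  let ?F = "\<lambda>p. pr (lst [?E p]) (joins (resp A) (map (\<lambda>q. ap (pfst q) (psnd p)) (?l p)))"
  show "dfn (chal ?X) (resp ?X) ?F"
    by (simp only: chal_simps resp_simps) (rule dfn_rules)+
  fix e p assume e: "e \<in> Env" and p: "p \<in> Car (chal ?X)"
  have beta: "ap (LAM (chal (Neg A)) (resp (Neg A)) (\<lambda>_. pr (lst [psnd p]) (num 0))) u = pr (lst [psnd p]) (num 0)"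
    if "u \<in> Car (chal (Neg A))" for u
    by (rule ap_LAM[OF dfn_lam(2)[OF _ p] that])
      (simp only: chal_simps resp_simps, (rule dfn_rules)+)
  have l: "set (?l p) \<subseteq> Car (chal (Neg A))"
  proof -
    have "dfnl (chal ?X) (chal (Neg A)) ?l"
      by (simp only: chal_simps resp_simps) (rule dfn_rules)+
    from dfnl_in[OF this p] show ?thesis .
  qed
  show "rl ?X e p (?F p)"
    unfolding rl.simps(4)[of "Neg (Neg A)" A] elt.sel
  proof
    assume "\<forall>a\<in>set (dfl (chal (Neg (Neg A))) # [?E p]). rl (Neg (Neg A)) e a (ap (pfst p) a)"
    then have "rl (Neg (Neg A)) e (?E p) (ap (pfst p) (?E p))" by simp
    then obtain q where q: "q \<in> set (?l p)" "\<not> rl (Neg A) e q (ap (pfst (?E p)) q)"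
      unfolding rl.simps(4)[of "Neg A" Fls] rl.simps(1) by blast
    then have "\<not> rl (Neg A) e q (pr (lst [psnd p]) (num 0))" using beta l by auto
    then have "rl A e (psnd p) (ap (pfst q) (psnd p))" by simp
    then show "rl A e (psnd p) (joins (resp A) (map (\<lambda>q. ap (pfst q) (psnd p)) (?l p)))"
      by (rule rl_joins[rotated]) (use q in auto)
  qed
qed

text \<open>Copying the response suffices: by uniformity it is correct for every value of
  \<open>x\<close>, in particular for that of \<open>t\<close>.\<close>

lemma realizable_Inst:
  assumes "ty_of t = snd x" "free_for t x A" "wt t"
  shows "realizable (Forall x A \<^bold>\<longrightarrow> subst x t A)"
proof (rule realizableI)
  let ?F = "\<lambda>p. pr (lst [psnd p]) (ap (pfst p) (psnd p))"
  show "dfn (chal (Forall x A \<^bold>\<longrightarrow> subst x t A)) (resp (Forall x A \<^bold>\<longrightarrow> subst x t A)) ?F"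
    by (simp only: chal_simps resp_simps chal_subst[OF assms(1)] resp_subst[OF assms(1)]) (rule dfn_rules)+
  fix e p assume "e \<in> Env"
  then have "tval e t \<in> Car (emb (snd x))" using tval_in assms by metis
  then show "rl (Forall x A \<^bold>\<longrightarrow> subst x t A) e p (?F p)"
    by (auto simp: rl_subst[OF assms(2,1)])
qed

lemma realizable_AllImp:
  assumes "x \<notin> fv A"
  shows "realizable (Forall x (A \<^bold>\<longrightarrow> B) \<^bold>\<longrightarrow> A \<^bold>\<longrightarrow> Forall x B)"
proof (rule realizableI)
  let ?F = "\<lambda>p. pr (lst [psnd p]) (ap (pfst p) (psnd p))"
  let ?X = "Forall x (A \<^bold>\<longrightarrow> B) \<^bold>\<longrightarrow> A \<^bold>\<longrightarrow> Forall x B"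
  show "dfn (chal ?X) (resp ?X) ?F"
    by (simp only: chal_simps resp_simps) (rule dfn_rules)+
  show "rl ?X e p (?F p)" for e p using assms by auto
qed

text \<open>Axioms with a conjunctive premise have simpler realizers in curried form. A conjunction
  abbreviates a negated implication, so the passage between the two forms repeats the argument for
  double negation.\<close>

lemma realizable_uncurry:
  assumes "realizable (A \<^bold>\<longrightarrow> B \<^bold>\<longrightarrow> C)"
  shows "realizable (A \<^bold>\<and> B \<^bold>\<longrightarrow> C)"
proof -
  obtain R where R: "R \<in> Car (chal (A \<^bold>\<longrightarrow> B \<^bold>\<longrightarrow> C) \<Rrightarrow> resp (A \<^bold>\<longrightarrow> B \<^bold>\<longrightarrow> C))"
    "\<And>e x. e \<in> Env \<Longrightarrow> x \<in> Car (chal (A \<^bold>\<longrightarrow> B \<^bold>\<longrightarrow> C)) \<Longrightarrow> rl (A \<^bold>\<longrightarrow> B \<^bold>\<longrightarrow> C) e x (ap R x)"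
    using assms by (rule realizableE) blast
  let ?X = "A \<^bold>\<and> B \<^bold>\<longrightarrow> C" and ?D = "A \<^bold>\<longrightarrow> Neg B"
  \<comment> \<open>With the strategies for \<open>A\<close> and \<open>B\<close> contained in
    \<open>q\<close>, run \<open>R\<close>; \<open>?f\<close> returns the tests that
    \<open>R\<close> asks for, which is a strategy for \<open>?D\<close>. A challenge
    \<open>q\<close> at which it fails is one where all these tests are passed, so there the answer
    of \<open>R\<close> to \<open>C\<close> is correct.\<close>
  let ?o = "\<lambda>p q. ap R (pr (pfst q) (pr (pfst (psnd q)) (psnd p)))"
  let ?f = "\<lambda>p q. pr (pfst (?o p q)) (pr (pfst (psnd (?o p q))) (num 0))"
  let ?q = "\<lambda>p. pr (LAM (chal ?D) (resp ?D) (?f p)) (num 0)"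
  let ?l = "\<lambda>p. dfl (chal ?D) # elems (pfst (ap (pfst p) (?q p)))"
  let ?F = "\<lambda>p. pr (lst [?q p]) (joins (resp C) (map (\<lambda>q. psnd (psnd (?o p q))) (?l p)))"
  show ?thesis
  proof (rule realizableI)
    note R' = R(1)[unfolded chal_simps resp_simps]
    show "dfn (chal ?X) (resp ?X) ?F"
      by (simp only: chal_simps resp_simps) (rule dfn_rules R')+
    fix e p assume e: "e \<in> Env" and p: "p \<in> Car (chal ?X)"
    have beta: "ap (LAM (chal ?D) (resp ?D) (?f p)) u = ?f p u"
      if "u \<in> Car (chal ?D)" for u
      by (rule ap_LAM[OF dfn_lam(2)[OF _ p] that])
        (simp only: chal_simps resp_simps, (rule dfn_rules R')+)
    have l: "set (?l p) \<subseteq> Car (chal ?D)"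
    proof -
      have "dfnl (chal ?X) (chal ?D) ?l"
        by (simp only: chal_simps resp_simps) (rule dfn_rules R')+
      from dfnl_in[OF this p] show ?thesis .
    qed
    show "rl ?X e p (?F p)"
      unfolding rl.simps(4)[of "A \<^bold>\<and> B" C] elt.sel
    proof
      assume "\<forall>a\<in>set (dfl (chal (A \<^bold>\<and> B)) # [?q p]). rl (A \<^bold>\<and> B) e a (ap (pfst p) a)"
      then have "rl (A \<^bold>\<and> B) e (?q p) (ap (pfst p) (?q p))" by simp
      then obtain q where q: "q \<in> set (?l p)" "\<not> rl ?D e q (ap (pfst (?q p)) q)"
        unfolding rl.simps(4)[of ?D Fls] rl.simps(1) by blast
      then have q': "q \<in> Car (chal ?D)" using l by blast
      then have n: "\<not> rl ?D e q (?f p q)" using beta q by auto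
      have "psnd p \<in> Car (chal C)" using p by auto
      with q' have "pr (pfst q) (pr (pfst (psnd q)) (psnd p)) \<in> Car (chal (A \<^bold>\<longrightarrow> B \<^bold>\<longrightarrow> C))" by auto
      from R(2)[OF e this] n have "rl C e (psnd p) (psnd (psnd (?o p q)))" by auto
      then show "rl C e (psnd p) (joins (resp C) (map (\<lambda>q. psnd (psnd (?o p q))) (?l p)))"
        by (rule rl_joins[rotated]) (use q in auto)
    qed
  qed
qed

section \<open>Truth of the internal axioms\<close>

lemma tval_lam:
  "wt t \<Longrightarrow> e \<in> Env \<Longrightarrow> d \<in> Car (emb (snd x)) \<Longrightarrow> ap (tval e (lam x t)) d = tval (e(x := d)) t"
proof (induction t)
  case (Var y)
  show ?case
  proof (cases "y = x")
    case True
    have "ap (kE (emb (snd x)) (emb (snd x))) d \<in> Car (emb (snd x) \<Rrightarrow> emb (snd x))"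
      using Var by (intro ap_in[OF kE_in])
    with True Var show ?thesis by simp
  next
    case False
    with Var show ?thesis by (simp add: EnvD)
  qed
next
  case (App s t)
  then obtain \<tau> where ty: "ty_of s = ty_of t \<leadsto> \<tau>" by auto
  have "tval e (lam x s) \<in> Car (emb (snd x) \<Rrightarrow> emb (ty_of t) \<Rrightarrow> emb \<tau>)"
    "tval e (lam x t) \<in> Car (emb (snd x) \<Rrightarrow> emb (ty_of t))"
    using App ty tval_in[of "lam x s" e] tval_in[of "lam x t" e] by simp_all
  with App ty show ?case by simp
qed simp

section \<open>Values of the arithmetical and sequence terms\<close>

declare lam.simps [simp del]

lemma fresh_notin: "fresh t \<le> n \<Longrightarrow> (n, \<tau>) \<notin> fvt t"
  by (induction t) auto

lemma tval_suc [simp]: "tval e t = num n \<Longrightarrow> tval e (suc t) = num (Suc n)"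
  by simp

lemma tval_plus:
  assumes "e \<in> Env" "tval e s = num m" "tval e t = num n"
  shows "tval e (plus_tm s t) = num (m + n)"
proof -
  let ?z = "lam (0, Num) (lam (1, Num) (suc (Var (0, Num))))"
  have z: "ap (ap (tval e ?z) (num a)) (num b) = num (Suc a)" for a b
    using assms(1) by (simp add: tval_lam)
  have "tval e ?z \<in> Car (UNat \<Rrightarrow> UNat \<Rrightarrow> UNat)"
    using tval_in[of ?z e] assms(1) by simp
  moreover obtain z where "z = tval e ?z" by simp
  ultimately have "ap (ap (ap (recE UNat) (num n)) (num m)) z = num (m + n)"
    using z by (induction n) (simp_all del: One_nat_def)
  then show ?thesis using assms \<open>z = _\<close> by (simp add: plus_tm_def)
qed

lemma tval_Num: "wt t \<Longrightarrow> e \<in> Env \<Longrightarrow> ty_of t = Num \<Longrightarrow> \<exists>n. tval e t = num n"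
  using tval_in[of t e] by (auto simp: Car_UNat)

lemma sat_le:
  assumes "e \<in> Env" "tval e s = num m" "tval e t = num n"
  shows "sat (le_fm s t) e \<longleftrightarrow> m \<le> n"
proof -
  define k where "k = (max (fresh s) (fresh t), Num)"
  have k: "k \<notin> fvt s" "k \<notin> fvt t" "snd k = Num" by (auto simp: k_def fresh_notin)
  have "tval (e(k := num i)) (plus_tm s (Var k)) = num (m + i)" for i
    by (rule tval_plus) (use assms k in \<open>auto intro!: Env_upd\<close>)
  then show ?thesis using assms k
    by (auto simp: le_fm_def Let_def k_def[symmetric] Car_UNat le_iff_add)
qed

lemma sat_less:
  assumes "e \<in> Env" "tval e s = num m" "tval e t = num n"
  shows "sat (less_fm s t) e \<longleftrightarrow> m < n"
proof -
  define k where "k = (max (fresh s) (fresh t), Num)"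
  have k: "k \<notin> fvt s" "k \<notin> fvt t" "snd k = Num" by (auto simp: k_def fresh_notin)
  have "tval (e(k := num i)) (plus_tm s (suc (Var k))) = num (m + Suc i)" for i
    by (rule tval_plus) (use assms k in \<open>auto intro!: Env_upd\<close>)
  then show ?thesis using assms k
    by (auto simp: less_fm_def Let_def k_def[symmetric] Car_UNat less_iff_Suc_add)
qed

lemma tval_len:
  assumes "e \<in> Env" "tval e s \<in> Car (USeq (emb \<sigma>))"
  shows "tval e (len \<sigma> s) = num (length (elems (tval e s)))"
proof -
  let ?z = "lam (0, Num) (lam (1, \<sigma>) (suc (Var (0, Num))))"
  have z: "ap (ap (tval e ?z) (num a)) x = num (Suc a)" if "x \<in> Car (emb \<sigma>)" for a x
    using assms(1) that by (simp add: tval_lam)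
  have "tval e ?z \<in> Car (UNat \<Rrightarrow> emb \<sigma> \<Rrightarrow> UNat)"
    using tval_in[of ?z e] assms(1) by simp
  then have "tval e (len \<sigma> s) = foldr (\<lambda>x r. ap (ap (tval e ?z) r) x) (elems (tval e s)) (num 0)"
    using assms by (simp add: len_def lrecE)
  moreover have "foldr (\<lambda>x r. ap (ap (tval e ?z) r) x) xs (num 0) = num (length xs)"
    if "set xs \<subseteq> Car (emb \<sigma>)" for xs
    using that by (induction xs) (simp_all add: z del: One_nat_def)
  ultimately show ?thesis using elems_in[OF assms(2)] by simp
qed

lemma tval_entry:
  assumes "e \<in> Env" "tval e s \<in> Car (USeq (emb \<sigma>))" "tval e t = num i" "i < length (elems (tval e s))"
  shows "tval e (entry \<sigma> s t) = elems (tval e s) ! i"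
proof -
  let ?r = "(0, Num \<leadsto> \<sigma>)" and ?x = "(1, \<sigma>)" and ?j = "(2, Num)" and ?q = "(3, \<sigma>)" and ?k = "(4, Num)"
  let ?w = "lam ?q (lam ?k (Var ?r \<cdot> Var ?k))"
  let ?z = "lam ?r (lam ?x (lam ?j (Cn (Rec \<sigma>) \<cdot> Var ?j \<cdot> Var ?x \<cdot> ?w)))"
  have w: "ap (ap (tval e ?w) q) (num k) = ap (e ?r) (num k)"
    "tval e ?w \<in> Car (emb \<sigma> \<Rrightarrow> UNat \<Rrightarrow> emb \<sigma>)"
    if "e \<in> Env" "q \<in> Car (emb \<sigma>)" for e q k
    using that tval_in[of ?w e] by (simp_all add: tval_lam)
  have zt: "tval e ?z \<in> Car ((UNat \<Rrightarrow> emb \<sigma>) \<Rrightarrow> emb \<sigma> \<Rrightarrow> UNat \<Rrightarrow> emb \<sigma>)"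
    using tval_in[of ?z e] assms(1) by simp
  have z: "ap (ap (ap (tval e ?z) r) x) (num j) = (case j of 0 \<Rightarrow> x | Suc k \<Rightarrow> ap r (num k))"
    if "r \<in> Car (UNat \<Rrightarrow> emb \<sigma>)" "x \<in> Car (emb \<sigma>)" for r x j
  proof -
    let ?e = "e(?r := r, ?x := x, ?j := num j)"
    have e: "?e \<in> Env" using that assms(1) by (auto intro!: Env_upd)
    have "ap (ap (ap (tval e ?z) r) x) (num j) = ap (ap (ap (recE (emb \<sigma>)) (num j)) x) (tval ?e ?w)"
      using that assms(1) by (simp add: tval_lam)
    also have "\<dots> = (case j of 0 \<Rightarrow> x | Suc k \<Rightarrow> ap r (num k))"
    proof (cases j)
      case 0
      then show ?thesis using w(2)[OF e that(2)] that by simp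
    next
      case (Suc k)
      have "ap (ap (ap (recE (emb \<sigma>)) (num k)) x) (tval ?e ?w) \<in> Car (emb \<sigma>)"
        using w(2)[OF e that(2)] that(2) by (intro ap_in[OF ap_in[OF ap_in[OF recE_in num_in]]])
      from w(1)[OF e this] Suc show ?thesis using w(2)[OF e that(2)] that by simp
    qed
    finally show ?thesis .
  qed
  let ?y = "tval e (dflt (Num \<leadsto> \<sigma>))"
  have y: "?y \<in> Car (UNat \<Rrightarrow> emb \<sigma>)" using tval_in[of "dflt (Num \<leadsto> \<sigma>)" e] assms(1) by (simp del: dflt.simps)
  have "tval e (entry \<sigma> s t) = ap (foldr (\<lambda>x r. ap (ap (tval e ?z) r) x) (elems (tval e s)) ?y) (num i)"
    using zt y assms by (simp add: entry_def Let_def lrecE del: dflt.simps)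
  \<comment> \<open>Membership in the carrier is carried through the induction, because the equation
    \<open>z\<close> for one step of the fold holds on the carriers only.\<close>
  moreover have "foldr (\<lambda>x r. ap (ap (tval e ?z) r) x) xs ?y \<in> Car (UNat \<Rrightarrow> emb \<sigma>) \<and>
     (\<forall>i<length xs. ap (foldr (\<lambda>x r. ap (ap (tval e ?z) r) x) xs ?y) (num i) = xs ! i)"
    if "set xs \<subseteq> Car (emb \<sigma>)" for xs
    using that
  proof (induction xs)
    case Nil
    then show ?case using y by simp
  next
    case (Cons x xs)
    let ?f = "foldr (\<lambda>x r. ap (ap (tval e ?z) r) x) xs ?y"
    from Cons have f: "?f \<in> Car (UNat \<Rrightarrow> emb \<sigma>)" "x \<in> Car (emb \<sigma>)" by auto
    have "ap (ap (tval e ?z) ?f) x \<in> Car (UNat \<Rrightarrow> emb \<sigma>)" using ap_in[OF ap_in[OF zt f(1)] f(2)] .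
    moreover have "ap (ap (ap (tval e ?z) ?f) x) (num i) = (x # xs) ! i" if "i < length (x # xs)" for i
      unfolding z[OF f] using Cons that by (auto split: nat.split)
    ultimately show ?case by simp
  qed
  ultimately show ?thesis using elems_in[OF assms(2)] assms(4) by simp
qed

lemma sat_mem:
  assumes "e \<in> Env" "wt z" "wt s" "ty_of s = Sq (ty_of z)"
  shows "sat (mem z s) e \<longleftrightarrow> tval e z \<in> set (elems (tval e s))"
proof -
  define i where "i = (max (fresh z) (fresh s), Num)"
  have i: "i \<notin> fvt z" "i \<notin> fvt s" "snd i = Num" by (auto simp: i_def fresh_notin)
  have s: "tval e s \<in> Car (USeq (emb (ty_of z)))" using tval_in[OF assms(3,1)] assms(4) by simp
  have e: "e(i := num n) \<in> Env" for n using assms(1) i by (intro Env_upd) auto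
  have "sat (less_fm (Var i) (len (ty_of z) s) \<^bold>\<and> z \<doteq> entry (ty_of z) s (Var i)) (e(i := num n)) \<longleftrightarrow>
    n < length (elems (tval e s)) \<and> tval e z = elems (tval e s) ! n" for n
  proof -
    have "sat (less_fm (Var i) (len (ty_of z) s)) (e(i := num n)) \<longleftrightarrow> n < length (elems (tval e s))"
      by (rule sat_less[OF e]) (use i s tval_len[where e = "e(i := num n)" and s = s and \<sigma> = "ty_of z", OF e] in simp_all)
    moreover have "tval (e(i := num n)) (entry (ty_of z) s (Var i)) = elems (tval e s) ! n"
      if "n < length (elems (tval e s))"
      using tval_entry[where e = "e(i := num n)" and s = s and \<sigma> = "ty_of z" and t = "Var i" and i = n, OF e] i s that
      by simp
    ultimately show ?thesis using i by auto
  qed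
  then have "sat (mem z s) e \<longleftrightarrow> (\<exists>n<length (elems (tval e s)). tval e z = elems (tval e s) ! n)"
    unfolding mem_def Let_def i_def[symmetric] sat.simps(1,4,5) using i by (auto simp: Car_UNat simp del: sat.simps(4))
  then show ?thesis by (auto simp: in_set_conv_nth)
qed

lemma internal_le [simp]: "internal (le_fm s t)"
  and internal_less [simp]: "internal (less_fm s t)"
  and internal_mem [simp]: "internal (mem s t)"
  by (simp_all add: le_fm_def less_fm_def mem_def Let_def)

text \<open>The numbers of the model are exactly the numerals, so induction in HOL yields the
  induction axiom, and equality of functionals is HOL equality of classes, so extensionality is
  \<open>fun_ext\<close>.\<close>

lemma EPA_true:
  assumes "A \<in> EPA" "wf_fm A"
  shows "internal A" and "e \<in> Env \<Longrightarrow> sat A e"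
proof -
  show "internal A" using assms(1) by (induction rule: EPA.induct) (auto simp: internal_subst)
  assume e: "e \<in> Env"
  show "sat A e" using assms
  proof (cases rule: EPA.cases)
    case (refl t)
    then show ?thesis by simp
  next
    case (repl s t A x)
    then show ?thesis by (simp add: sat_subst)
  next
    case (ext x f g)
    have "wt (f \<cdot> Var x)" "ty_of (f \<cdot> Var x) = ty_of (g \<cdot> Var x)" "wt (g \<cdot> Var x)" using ext assms(2) by auto
    then obtain \<tau> where \<tau>: "ty_of f = snd x \<leadsto> \<tau>" "ty_of g = snd x \<leadsto> \<tau>" "wt f" "wt g" by auto
    show ?thesis unfolding ext(1) sat.simps
    proof
      assume H: "\<forall>d\<in>Car (emb (snd x)). tval (e(x := d)) (f \<cdot> Var x) = tval (e(x := d)) (g \<cdot> Var x)"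
      show "tval e f = tval e g"
        by (rule fun_ext[of _ "emb (snd x)" "emb \<tau>"])
          (use \<tau> H ext tval_in'[OF \<tau>(3) e \<tau>(1)] tval_in'[OF \<tau>(4) e \<tau>(2)] in auto)
    qed
  next
    case (Suc_not_zero t)
    then obtain n where "tval e t = num n" using assms(2) tval_Num[of t e] e by auto
    with Suc_not_zero show ?thesis by simp
  next
    case (Suc_inj s t)
    then obtain m n where "tval e s = num m" "tval e t = num n"
      using assms(2) tval_Num[of s e] tval_Num[of t e] e by auto
    with Suc_inj show ?thesis by simp
  next
    case (num_induct B n)
    have 0: "sat (subst n zero B) e = sat B (e(n := num 0))"
      using num_induct by (simp add: sat_subst free_forI)
    have S: "sat (subst n (suc (Var n)) B) (e(n := num k)) = sat B (e(n := num (Suc k)))" for k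
      using num_induct by (simp add: sat_subst free_forI)
    have "sat B (e(n := num k))"
      if "sat (subst n zero B) e" "sat (Forall n (B \<^bold>\<longrightarrow> subst n (suc (Var n)) B)) e" for k
    proof (induction k)
      case 0
      show ?case using that(1) unfolding \<open>sat (subst n zero B) e = _\<close> .
    next
      case (Suc k)
      have "sat (B \<^bold>\<longrightarrow> subst n (suc (Var n)) B) (e(n := num k))"
        using that(2) num_induct(3) by (simp only: sat.simps(5) emb.simps num_in)
      with Suc S show ?case by (simp only: sat.simps(4))
    qed
    then have "sat (Forall n B) e"
      if "sat (subst n zero B) e" "sat (Forall n (B \<^bold>\<longrightarrow> subst n (suc (Var n)) B)) e"
      using that unfolding sat.simps(5) num_induct(3) emb.simps Car_UNat by blast
    then show ?thesis unfolding num_induct(1) sat.simps(1,4) by blast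
  next
    case (K_eq \<sigma> \<tau> s t)
    then have "tval e s \<in> Car (emb \<sigma>)" "tval e t \<in> Car (emb \<tau>)"
      using assms(2) e by (auto intro!: tval_in')
    with K_eq show ?thesis by simp
  next
    case (S_eq \<rho> \<sigma> \<tau> r s t)
    then have "wt (Cn (CombS \<rho> \<sigma> \<tau>) \<cdot> r \<cdot> s \<cdot> t)" using assms(2) by (simp only: wf_fm.simps)
    then have "tval e r \<in> Car (emb (\<rho> \<leadsto> \<sigma> \<leadsto> \<tau>))" "tval e s \<in> Car (emb (\<rho> \<leadsto> \<sigma>))" "tval e t \<in> Car (emb \<rho>)"
      using e by (auto intro!: tval_in' simp del: emb.simps)
    with S_eq show ?thesis by simp
  next
    case (Rec_zero \<rho> y z)
    then have "tval e y \<in> Car (emb \<rho>)" "tval e z \<in> Car (emb (\<rho> \<leadsto> Num \<leadsto> \<rho>))"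
      using assms(2) e by (auto intro!: tval_in' simp del: emb.simps)
    with Rec_zero show ?thesis by simp
  next
    case (Rec_Suc \<rho> t y z)
    then have w: "wt (Cn (Rec \<rho>) \<cdot> suc t \<cdot> y \<cdot> z)" using assms(2) by (simp only: wf_fm.simps)
    then have "tval e y \<in> Car (emb \<rho>)" "tval e z \<in> Car (emb (\<rho> \<leadsto> Num \<leadsto> \<rho>))"
      using e by (auto intro!: tval_in' simp del: emb.simps)
    moreover obtain n where "tval e t = num n" using w tval_Num[of t e] e by auto
    ultimately show ?thesis using Rec_Suc by simp
  next
    case (SRec_Nil \<sigma> \<rho> y z)
    then have "tval e y \<in> Car (emb \<rho>)" "tval e z \<in> Car (emb (\<rho> \<leadsto> \<sigma> \<leadsto> \<rho>))"
      using assms(2) e by (auto intro!: tval_in' simp del: emb.simps)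
    with SRec_Nil show ?thesis by (simp add: lrecE_Nil)
  next
    case (SRec_Cons \<sigma> \<rho> t s y z)
    then have "wt (Cn (SRec \<sigma> \<rho>) \<cdot> (Cn (SCons \<sigma>) \<cdot> t \<cdot> s) \<cdot> y \<cdot> z)"
      using assms(2) by (simp only: wf_fm.simps)
    then have "tval e y \<in> Car (emb \<rho>)" "tval e z \<in> Car (emb (\<rho> \<leadsto> \<sigma> \<leadsto> \<rho>))" "tval e t \<in> Car (emb \<sigma>)"
      and s: "tval e s \<in> Car (emb (Sq \<sigma>))"
      using e by (auto intro!: tval_in' simp del: emb.simps)
    moreover obtain xs where "tval e s = lst xs" "set xs \<subseteq> Car (emb \<sigma>)"
      using s by (auto elim: Car_USeq_E)
    ultimately show ?thesis using SRec_Cons by (simp add: consE lrecE_Cons)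
  next
    case (Sq_cases x \<sigma> a s)
    have s: "tval e s \<in> Car (USeq (emb \<sigma>))"
      using Sq_cases assms(2) tval_in'[of s e "Sq \<sigma>"] e by auto
    then obtain xs where xs: "tval e s = lst xs" "set xs \<subseteq> Car (emb \<sigma>)" by (rule Car_USeq_E)
    \<comment> \<open>The variables for head and tail differ because their types do, so neither
      update overwrites the other.\<close>
    have "Sq \<sigma> \<noteq> \<sigma>" for \<sigma> by (induction \<sigma>) auto
    then have xa: "x \<noteq> a" using Sq_cases by metis
    show ?thesis
    proof (cases xs)
      case Nil
      then show ?thesis using xs Sq_cases by simp
    next
      case (Cons y ys)
      then have y: "y \<in> Car (emb \<sigma>)" "set ys \<subseteq> Car (emb \<sigma>)" using xs by auto
      have "sat (s \<doteq> Cn (SCons \<sigma>) \<cdot> Var x \<cdot> Var a) (e(x := y, a := lst ys))"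
        using xs Cons y Sq_cases xa by (simp add: consE)
      moreover have "y \<in> Car (emb (snd x))" "lst ys \<in> Car (emb (snd a))"
        using y Sq_cases by simp_all
      ultimately have "\<exists>d\<in>Car (emb (snd x)). \<exists>d'\<in>Car (emb (snd a)).
          sat (s \<doteq> Cn (SCons \<sigma>) \<cdot> Var x \<cdot> Var a) (e(x := d, a := d'))" by blast
      then show ?thesis unfolding Sq_cases(1) sat.simps(1,4,5) by blast
    qed
  qed
qed

lemma realizable_EPA: "A \<in> EPA \<Longrightarrow> wf_fm A \<Longrightarrow> realizable A"
  by (intro realizable_internal EPA_true)

section \<open>Realizers of the external axioms\<close>

lemma rl_ForallSt:
  "rl (ForallSt v A) e q r \<longleftrightarrow> (\<forall>d\<in>Car (emb (snd v)).
     (\<forall>a\<in>set (num 0 # elems (pfst r)). d \<in> set (elems (ap (pfst q) a))) \<longrightarrow> rl A (e(v := d)) (psnd q) (psnd r))"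
  by simp

lemma rl_Neg: "rl (Neg A) e x y \<longleftrightarrow> \<not> (\<forall>a\<in>set (dfl (chal A) # elems (pfst y)). rl A e a (ap (pfst x) a))"
  by simp

lemma ap_dfl [simp]: "x \<in> Car \<sigma> \<Longrightarrow> ap (dfl (\<sigma> \<Rrightarrow> \<tau>)) x = dfl \<tau>"
  by simp

section \<open>Standardness and external induction\<close>

lemma realizable_St_eq:
  assumes "wf_fm (St s \<^bold>\<and> s \<doteq> t \<^bold>\<longrightarrow> St t)"
  shows "realizable (St s \<^bold>\<and> s \<doteq> t \<^bold>\<longrightarrow> St t)"
proof (rule realizable_uncurry, rule realizableI)
  have ty: "ty_of t = ty_of s" using assms by simp
  \<comment> \<open>The number 0 is the default challenge to \<open>St s\<close>, which is always
    among the tests, so the empty lists suffice.\<close>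
  let ?F = "\<lambda>p. pr (lst []) (pr (lst []) (ap (pfst p) (num 0)))"
  show "dfn (chal (St s \<^bold>\<longrightarrow> s \<doteq> t \<^bold>\<longrightarrow> St t)) (resp (St s \<^bold>\<longrightarrow> s \<doteq> t \<^bold>\<longrightarrow> St t)) ?F"
    by (simp only: chal_simps resp_simps ty) (rule dfn_rules)+
qed auto

lemma realizable_St_closed:
  assumes "fvt t = {}" "wt t"
  shows "realizable (St t)"
proof -
  obtain e0 where e0: "e0 \<in> Env" using ex_Env by blast
  show ?thesis
  proof (rule realizableI)
    show "dfn (chal (St t)) (resp (St t)) (\<lambda>_. lst [tval e0 t])"
      by (rule dfn_const) (simp add: tval_in assms e0)
    show "rl (St t) e x (lst [tval e0 t])" for e x
      using tval_cong[of t e e0] assms by simp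
  qed
qed

text \<open>Every listed function is applied to every listed argument; one of these pairs consists
  of the actual values.\<close>

lemma realizable_St_App:
  assumes "wf_fm (St f \<^bold>\<and> St t \<^bold>\<longrightarrow> St (f \<cdot> t))"
  shows "realizable (St f \<^bold>\<and> St t \<^bold>\<longrightarrow> St (f \<cdot> t))"
proof (rule realizable_uncurry, rule realizableI)
  from assms obtain \<tau> where ty: "ty_of f = ty_of t \<leadsto> \<tau>" by auto
  then have ty': "ty_of (f \<cdot> t) = \<tau>" by simp
  let ?F = "\<lambda>p. pr (lst []) (pr (lst []) (lst (concat (map (\<lambda>g. map (\<lambda>x. ap g x) (elems (ap (pfst (psnd p)) (num 0))))
    (elems (ap (pfst p) (num 0)))))))"
  show "dfn (chal (St f \<^bold>\<longrightarrow> St t \<^bold>\<longrightarrow> St (f \<cdot> t))) (resp (St f \<^bold>\<longrightarrow> St t \<^bold>\<longrightarrow> St (f \<cdot> t))) ?F"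
    by (simp only: chal_simps resp_simps ty ty' emb.simps) (rule dfn_rules)+
qed auto

text \<open>The opponent lists finitely many numbers, and only an \<open>n\<close> in this list
  matters. For each of them the step is iterated by the recursor, with challenges passed down
  towards 0 and responses passed up; the answers for all listed numbers are joined.\<close>

lemma realizable_ext_induct:
  assumes n: "snd n = Num"
  shows "realizable (subst n zero A \<^bold>\<and> ForallSt n (A \<^bold>\<longrightarrow> subst n (suc (Var n)) A) \<^bold>\<longrightarrow> ForallSt n A)"
proof (rule realizable_uncurry, rule realizableI)
  let ?A0 = "subst n zero A" and ?A1 = "subst n (suc (Var n)) A"
  let ?S = "ForallSt n (A \<^bold>\<longrightarrow> ?A1)"
  let ?X = "?A0 \<^bold>\<longrightarrow> ?S \<^bold>\<longrightarrow> ForallSt n A"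
  let ?c = "chal A" and ?r = "resp A"
  let ?cS = "(UNat \<Rrightarrow> USeq UNat) \<otimes> ((?c \<Rrightarrow> ?r) \<otimes> ?c)"
  let ?T = "?c \<Rrightarrow> ?r \<otimes> (USeq ?c \<otimes> USeq ?cS)"
  have c: "chal ?A0 = ?c" "chal ?A1 = ?c" "resp ?A0 = ?r" "resp ?A1 = ?r"
    using n by (simp_all add: chal_subst resp_subst)
  have ch: "chal ?X = (?c \<Rrightarrow> ?r) \<otimes> ((?cS \<Rrightarrow> USeq UNat \<otimes> (USeq ?c \<otimes> ?r)) \<otimes> ((UNat \<Rrightarrow> USeq UNat) \<otimes> ?c))"
    "resp ?X = USeq ?c \<otimes> (USeq ?cS \<otimes> (USeq UNat \<otimes> ?r))"
    using n by (simp_all add: c)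
  (* By recursion on k, ?t maps a challenge u to A(k) to a response together with the challenges to
     A(0) and to the step that have to be met for this response to be correct. *)
  let ?q = "\<lambda>k t u. pr (ap (kE (USeq UNat) UNat) (lst [k])) (pr (LAM ?c ?r (\<lambda>x. pfst (ap t x))) u)"
  let ?o = "\<lambda>p k t u. psnd (ap (pfst (psnd p)) (?q k t u))"
  let ?xs = "\<lambda>p k t u. dfl ?c # elems (pfst (?o p k t u))"
  let ?body = "\<lambda>p k t u. pr (psnd (?o p k t u))
      (pr (lst (concat (map (\<lambda>x. elems (pfst (psnd (ap t x)))) (?xs p k t u))))
          (lst (?q k t u # concat (map (\<lambda>x. elems (psnd (psnd (ap t x)))) (?xs p k t u)))))"
  let ?step = "\<lambda>p k t. LAM ?c (?r \<otimes> (USeq ?c \<otimes> USeq ?cS)) (?body p k t)"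
  let ?zero = "\<lambda>p. LAM ?c (?r \<otimes> (USeq ?c \<otimes> USeq ?cS)) (\<lambda>u. pr (ap (pfst p) u) (pr (lst [u]) (lst [])))"
  let ?t = "\<lambda>p m. rec_nat (?zero p) (\<lambda>k. ?step p (num k)) (natof m)"
  let ?ns = "\<lambda>p. elems (ap (pfst (psnd (psnd p))) (num 0))"
  let ?u = "\<lambda>p. psnd (psnd (psnd p))"
  let ?F = "\<lambda>p. pr (lst (concat (map (\<lambda>m. elems (pfst (psnd (ap (?t p m) (?u p))))) (?ns p))))
     (pr (lst (concat (map (\<lambda>m. elems (psnd (psnd (ap (?t p m) (?u p))))) (?ns p))))
       (pr (lst []) (joins ?r (map (\<lambda>m. pfst (ap (?t p m) (?u p))) (?ns p)))))"
  note R = dfn_rules kE_in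
  have step: "dfn ((chal ?X \<otimes> ?T) \<otimes> UNat) ?T (\<lambda>p. ?step (pfst (pfst p)) (psnd p) (psnd (pfst p)))"
    unfolding ch by (rule R)+
  have zero: "dfn (chal ?X) ?T ?zero"
    unfolding ch by (rule R)+
  have t: "dfn (chal ?X \<otimes> UNat) ?T (\<lambda>p. ?t (pfst p) (psnd p))"
  proof (rule dfn_rec_nat[where F = "\<lambda>p. ?step (pfst p)"])
    show "dfn (chal ?X \<otimes> UNat) UNat psnd" by (rule R)+
    show "dfn (chal ?X \<otimes> UNat) ?T (\<lambda>p. ?zero (pfst p))" by (rule dfn_comp[OF zero] R)+
    have "dfn (((chal ?X \<otimes> UNat) \<otimes> ?T) \<otimes> UNat) ((chal ?X \<otimes> ?T) \<otimes> UNat)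
      (\<lambda>p. pr (pr (pfst (pfst (pfst p))) (psnd (pfst p))) (psnd p))" by (rule R)+
    from dfn_comp[OF step this]
    show "dfn (((chal ?X \<otimes> UNat) \<otimes> ?T) \<otimes> UNat) ?T
      (\<lambda>p. ?step (pfst (pfst (pfst p))) (psnd p) (psnd (pfst p)))" by simp
  qed
  show "dfn (chal ?X) (resp ?X) ?F"
    using t unfolding ch by - (assumption | rule R)+
  fix e p assume e: "e \<in> Env" and p: "p \<in> Car (chal ?X)"
  have tin: "?t p (num k) \<in> Car ?T" for k
    using dfn_in[OF t, of "pr p (num k)"] p by simp
  have ap_zero: "ap (?zero p) u = pr (ap (pfst p) u) (pr (lst [u]) (lst []))" if "u \<in> Car ?c" for u
    by (rule ap_LAM[OF dfn_lam(2)[OF _ p] that]) (unfold ch, (rule R)+)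
  have ap_step: "ap (?step p k t) u = ?body p k t u" if "t \<in> Car ?T" "k \<in> Car UNat" "u \<in> Car ?c" for t k u
  proof -
    have "dfn ?c (?r \<otimes> (USeq ?c \<otimes> USeq ?cS)) (?body (pfst (pfst (pr (pr p t) k))) (psnd (pr (pr p t) k)) (psnd (pfst (pr (pr p t) k))))"
      by (rule dfn_lam(2)[where \<rho> = "(chal ?X \<otimes> ?T) \<otimes> UNat"
            and F = "\<lambda>r. ?body (pfst (pfst r)) (psnd r) (psnd (pfst r))"])
        (unfold ch, (rule R)+, use that p ch in simp)
    then show ?thesis using that(3) by (simp add: ap_LAM)
  qed
  have ap_q: "ap (LAM ?c ?r (\<lambda>x. pfst (ap t x))) u = pfst (ap t u)" if "t \<in> Car ?T" "u \<in> Car ?c" for t u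
    by (rule ap_LAM[OF _ that(2)]) (rule R that)+
  have q_in: "?q k t u \<in> Car ?cS" if "t \<in> Car ?T" "k \<in> Car UNat" "u \<in> Car ?c" for k t u
  proof -
    have "LAM ?c ?r (\<lambda>x. pfst (ap t x)) \<in> Car (?c \<Rrightarrow> ?r)"
      by (rule LAM_in) (rule R that)+
    with that show ?thesis by (auto intro!: ap_in[OF kE_in])
  qed
  \<comment> \<open>The challenge \<open>u\<close> is generalised, because the step at
    \<open>k\<close> tests the strategy for \<open>A\<close> at \<open>k\<close> on challenges of
    its own choice. The hypotheses say that all tests of base and step recorded by the recursion are
    passed.\<close>
  have main: "u \<in> Car ?c \<Longrightarrow>
     (\<And>a. a \<in> set (elems (pfst (psnd (ap (?t p (num k)) u)))) \<Longrightarrow> rl ?A0 e a (ap (pfst p) a)) \<Longrightarrow>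
     (\<And>a. a \<in> set (elems (psnd (psnd (ap (?t p (num k)) u)))) \<Longrightarrow> rl ?S e a (ap (pfst (psnd p)) a)) \<Longrightarrow>
     rl A (e(n := num k)) u (pfst (ap (?t p (num k)) u))" for k u
  proof (induction k arbitrary: u)
    case 0
    have b: "ap (?t p (num 0)) u = pr (ap (pfst p) u) (pr (lst [u]) (lst []))"
      using ap_zero[OF 0(1)] by simp
    have "rl ?A0 e u (ap (pfst p) u)" by (rule 0(2)) (unfold b, simp)
    moreover have "rl ?A0 e = rl A (e(n := num 0))" using n by (simp add: rl_subst free_forI)
    ultimately show ?case unfolding b unfolding elt.sel by (simp only:)
  next
    case (Suc k)
    let ?t' = "?t p (num k)"
    let ?k = "num k"
    have t_Suc: "?t p (num (Suc k)) = ?step p ?k ?t'" by simp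
    have b: "ap (?t p (num (Suc k))) u = ?body p ?k ?t' u"
      unfolding t_Suc by (rule ap_step[OF tin num_in Suc.prems(1)])
    have qi: "?q ?k ?t' u \<in> Car ?cS" by (rule q_in[OF tin num_in Suc.prems(1)])
    have R: "pfst (psnd p) \<in> Car (?cS \<Rrightarrow> USeq UNat \<otimes> (USeq ?c \<otimes> ?r))" using p unfolding ch by blast
    have ri: "ap (pfst (psnd p)) (?q ?k ?t' u) \<in> Car (USeq UNat \<otimes> (USeq ?c \<otimes> ?r))" by (rule ap_in[OF R qi])
    have xs: "set (?xs p ?k ?t' u) \<subseteq> Car ?c" 
      using elems_in[OF pfst_in[OF psnd_in[OF ri]]] dfl_in[of ?c] unfolding list.set insert_subset by (rule conjI[rotated])
    have zs: "set (num 0 # elems (pfst (ap (pfst (psnd p)) (?q ?k ?t' u)))) \<subseteq> Car UNat"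
      using num_in elems_in[OF pfst_in[OF ri]] unfolding list.set insert_subset by (rule conjI)
    \<comment> \<open>The challenge \<open>?q\<close> is itself recorded. It presents
      \<open>k\<close> as standard by the constant list \<open>[k]\<close> and brings the
      recursively obtained strategy for \<open>A\<close> at \<open>k\<close>.\<close>
    have "rl ?S e (?q ?k ?t' u) (ap (pfst (psnd p)) (?q ?k ?t' u))"
      by (rule Suc.prems(3)) (unfold b, simp)
    moreover have "num k \<in> set (elems (ap (pfst (?q ?k ?t' u)) a))"
      if "a \<in> set (num 0 # elems (pfst (ap (pfst (psnd p)) (?q ?k ?t' u))))" for a
    proof -
      have "a \<in> Car UNat" using that zs by blast
      then show ?thesis by simp
    qed
    moreover have "num k \<in> Car (emb (snd n))" using n by simp
    ultimately have "rl (A \<^bold>\<longrightarrow> ?A1) (e(n := num k)) (psnd (?q ?k ?t' u)) (?o p ?k ?t' u)"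
      unfolding rl_ForallSt by blast
    moreover have "rl A (e(n := num k)) x (ap (LAM ?c ?r (\<lambda>x. pfst (ap ?t' x))) x)" if x: "x \<in> set (?xs p ?k ?t' u)" for x
    proof -
      have xc: "x \<in> Car ?c" using x xs by blast
      show ?thesis unfolding ap_q[OF tin xc]
      proof (rule Suc.IH[OF xc])
        fix a assume "a \<in> set (elems (pfst (psnd (ap ?t' x))))"
        then show "rl ?A0 e a (ap (pfst p) a)" 
          by (intro Suc.prems(2)) (unfold b, use x in \<open>simp only: elt.sel set_concat set_map\<close>, blast)
      next
        fix a assume "a \<in> set (elems (psnd (psnd (ap ?t' x))))"
        then show "rl ?S e a (ap (pfst (psnd p)) a)" 
          by (intro Suc.prems(3)) (unfold b, use x in \<open>simp only: elt.sel set_concat set_map list.set\<close>, blast)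
      qed
    qed
    ultimately have R1: "rl ?A1 (e(n := num k)) u (psnd (?o p ?k ?t' u))"
      unfolding rl.simps(4)[of A] elt.sel by blast
    have A1: "rl ?A1 (e(n := num k)) = rl A (e(n := num (Suc k)))"
      using n by (simp add: rl_subst free_forI)
    have c: "pfst (ap (?t p (num (Suc k))) u) = psnd (?o p ?k ?t' u)"
      unfolding b by (rule elt.sel)
    show ?case using R1 unfolding c A1 .
  qed
  show "rl ?X e p (?F p)"
    unfolding rl.simps(4)[of ?A0] rl.simps(4)[of ?S] rl_ForallSt[of n A] elt.sel
  proof (intro impI ballI)
    fix d assume H0: "\<forall>a\<in>set (dfl (chal ?A0) # concat (map (\<lambda>m. elems (pfst (psnd (ap (?t p m) (?u p))))) (?ns p))).
         rl ?A0 e a (ap (pfst p) a)"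
      and H1: "\<forall>a\<in>set (dfl (chal ?S) # concat (map (\<lambda>m. elems (psnd (psnd (ap (?t p m) (?u p))))) (?ns p))).
         rl ?S e a (ap (pfst (psnd p)) a)"
      and d: "d \<in> Car (emb (snd n))" and "\<forall>a\<in>set (num 0 # []). d \<in> set (elems (ap (pfst (psnd (psnd p))) a))"
    then have dn: "d \<in> set (?ns p)" by simp
    obtain k where k: "d = num k" using d n by (auto simp: Car_UNat)
    have u: "?u p \<in> Car ?c" using p unfolding ch by blast
    have "rl A (e(n := num k)) (?u p) (pfst (ap (?t p (num k)) (?u p)))"
    proof (rule main[OF u])
      fix a assume "a \<in> set (elems (pfst (psnd (ap (?t p (num k)) (?u p)))))"
      then have "a \<in> set (concat (map (\<lambda>m. elems (pfst (psnd (ap (?t p m) (?u p))))) (?ns p)))"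
        using dn unfolding k set_concat set_map by blast
      with H0 show "rl ?A0 e a (ap (pfst p) a)" by (meson list.set_intros(2))
    next
      fix a assume "a \<in> set (elems (psnd (psnd (ap (?t p (num k)) (?u p)))))"
      then have "a \<in> set (concat (map (\<lambda>m. elems (psnd (psnd (ap (?t p m) (?u p))))) (?ns p)))"
        using dn unfolding k set_concat set_map by blast
      with H1 show "rl ?S e a (ap (pfst (psnd p)) a)" by (meson list.set_intros(2))
    qed
    then show "rl A (e(n := d)) (?u p) (joins ?r (map (\<lambda>m. pfst (ap (?t p m) (?u p))) (?ns p)))"
      unfolding k by (rule rl_joins[rotated]) (use dn k in \<open>simp only: set_map, blast\<close>)
  qed
qed

section \<open>Idealisation, choice and transfer\<close>

lemma ty_neq: "Sq \<sigma> \<noteq> \<sigma>" "(\<sigma> \<leadsto> \<tau>) \<noteq> \<sigma>" "(\<sigma> \<leadsto> Sq \<tau>) \<noteq> \<tau>"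
  by (auto dest: arg_cong[of _ _ size])

lemma in_concat_map: "x \<in> set (f y) \<Longrightarrow> y \<in> set ys \<Longrightarrow> x \<in> set (concat (map f ys))"
  by auto

lemma not_rl_ForallStE:
  assumes "\<not> rl (ForallSt v A) e q r"
  obtains d where "d \<in> Car (emb (snd v))" "d \<in> set (elems (ap (pfst q) (num 0)))"
    "\<not> rl A (e(v := d)) (psnd q) (psnd r)"
  using assms unfolding rl_ForallSt by auto

text \<open>The opponent's tests of \<open>ForallSt z A\<close> come from a strategy that does not
  see \<open>y\<close>, so the finite list \<open>?L\<close> of all \<open>z\<close> mentioned in
  them is known beforehand. The premise with this list as \<open>x\<close> yields a \<open>y\<close>
  that is good for all of them, and \<open>y\<close> itself need not be exhibited, since quantifiers
  are uniform.\<close>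

lemma realizable_Idealisation:
  assumes A: "internal A" and ty: "snd x = Sq (snd z)" and x: "x \<notin> fv A" "x \<noteq> y" "y \<noteq> z"
  shows "realizable (ForallSt x (Exists y (Forall z (mem (Var z) (Var x) \<^bold>\<longrightarrow> A))) \<^bold>\<longrightarrow> Exists y (ForallSt z A))"
    (is "realizable (ForallSt x ?I \<^bold>\<longrightarrow> Exists y ?G)")
proof (rule realizableI)
  let ?X = "ForallSt x ?I \<^bold>\<longrightarrow> Exists y ?G"
  let ?s = "emb (snd z)"
  let ?cG = "(UNat \<Rrightarrow> USeq ?s) \<otimes> chal A" and ?rG = "USeq UNat \<otimes> resp A"
  let ?cN = "(?cG \<Rrightarrow> ?rG) \<otimes> UNat" and ?rN = "USeq ?cG \<otimes> UNat"
  let ?cE = "(?cN \<Rrightarrow> ?rN) \<otimes> UNat"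
  let ?cP = "(UNat \<Rrightarrow> USeq (USeq ?s)) \<otimes> chal ?I"
  have xz: "x \<noteq> z" using ty ty_neq(1) by metis
  have ch: "chal ?X = (?cP \<Rrightarrow> USeq UNat \<otimes> resp ?I) \<otimes> ?cE"
    "resp ?X = USeq ?cP \<otimes> (USeq ?cN \<otimes> UNat)"
    by (simp_all only: chal_simps resp_simps ty emb.simps ty_of.simps)
  have chN: "chal (Forall y (Neg ?G)) = ?cN" "chal ?G = ?cG"
    by (simp_all only: chal_simps resp_simps ty_of.simps)
  \<comment> \<open>The final response asks for no test of the refuting strategy beyond the default
    one, so the opponent's move is read off at \<open>dfl ?cN\<close>. If the response were wrong,
    one of the challenges in \<open>?qs\<close> would fail for every \<open>y\<close>.\<close>
  let ?r = "\<lambda>p. ap (pfst (psnd p)) (dfl ?cN)"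
  let ?qs = "\<lambda>p. dfl ?cG # elems (pfst (?r p))"
  let ?L = "\<lambda>p. concat (map (\<lambda>q. elems (ap (pfst q) (num 0))) (?qs p))"
  let ?ch = "\<lambda>p. pr (ap (kE (USeq (USeq ?s)) UNat) (lst [lst (?L p)])) (dfl (chal ?I))"
  let ?F = "\<lambda>p. pr (lst [?ch p]) (pr (lst []) (num 0))"
  note R = dfn_rules kE_in
  show "dfn (chal ?X) (resp ?X) ?F"
    unfolding ch by (rule R)+
  fix e p assume e: "e \<in> Env" and p: "p \<in> Car (chal ?X)"
  have "dfnl (chal ?X) ?s ?L" unfolding ch by (rule R)+
  from dfnl_in[OF this p] have L: "set (?L p) \<subseteq> Car ?s" .
  have "dfnl (chal ?X) ?cG ?qs" unfolding ch by (rule R)+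
  from dfnl_in[OF this p] have qs: "set (?qs p) \<subseteq> Car ?cG" .
  have "dfn (chal ?X) ?cP ?ch" unfolding ch by (rule R)+
  from dfn_in[OF this p] have cP: "?ch p \<in> Car ?cP" .
  have "pfst p \<in> Car (?cP \<Rrightarrow> USeq UNat \<otimes> resp ?I)" using p unfolding ch by blast
  from ap_in[OF this cP] have r: "ap (pfst p) (?ch p) \<in> Car (USeq UNat \<otimes> resp ?I)" .
  have Ix: "lst (?L p) \<in> Car (emb (snd x))" using L ty by simp
  have Iint: "internal ?I" using A by simp
  show "rl ?X e p (?F p)"
    unfolding rl.simps(4)[of "ForallSt x ?I"] elt.sel
  proof
    assume "\<forall>a\<in>set (dfl (chal (ForallSt x ?I)) # [?ch p]). rl (ForallSt x ?I) e a (ap (pfst p) a)"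
    then have "rl (ForallSt x ?I) e (?ch p) (ap (pfst p) (?ch p))" by simp
    moreover have "lst (?L p) \<in> set (elems (ap (pfst (?ch p)) a))"
      if "a \<in> set (num 0 # elems (pfst (ap (pfst p) (?ch p))))" for a
    proof -
      have "a \<in> Car UNat" using that elems_in[OF pfst_in[OF r]] by auto
      then show ?thesis using L by (simp only: elt.sel) simp
    qed
    ultimately have "rl ?I (e(x := lst (?L p))) (psnd (?ch p)) (psnd (ap (pfst p) (?ch p)))"
      using Ix unfolding rl_ForallSt by blast
    then have "sat ?I (e(x := lst (?L p)))"
      using r by (subst (asm) rl_internal[OF Iint]) auto
    then obtain v where v: "v \<in> Car (emb (snd y))"
      "\<And>d. d \<in> Car ?s \<Longrightarrow> sat (mem (Var z) (Var x)) (e(x := lst (?L p), y := v, z := d))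
        \<Longrightarrow> sat A (e(x := lst (?L p), y := v, z := d))"
      unfolding sat.simps(1,4,5) by blast
    have v': "sat A (e(y := v, z := d))" if d: "d \<in> set (?L p)" for d
    proof -
      have dc: "d \<in> Car ?s" using d L by blast
      have "sat (mem (Var z) (Var x)) (e(x := lst (?L p), y := v, z := d))"
        by (subst sat_mem) (use e Ix v(1) dc ty d x xz in \<open>auto intro!: Env_upd\<close>)
      from v(2)[OF dc this] have "sat A (e(x := lst (?L p), y := v, z := d))" .
      moreover have "sat A (e(x := lst (?L p), y := v, z := d)) = sat A (e(y := v, z := d))"
        by (rule sat_cong) (use x in auto)
      ultimately show ?thesis by blast
    qed
    show "rl (Exists y ?G) e (psnd p) (pr (lst []) (num 0))"
      unfolding rl_Neg[of "Forall y (Neg ?G)"] chN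
    proof
      assume "\<forall>a\<in>set (dfl ?cN # elems (pfst (pr (lst []) (num 0)))).
        rl (Forall y (Neg ?G)) e a (ap (pfst (psnd p)) a)"
      then have "rl (Forall y (Neg ?G)) e (dfl ?cN) (?r p)" by simp
      then have "rl (Neg ?G) (e(y := v)) (dfl ?cN) (?r p)"
        using v(1) unfolding rl.simps(5) by blast
      then obtain q where q: "q \<in> set (?qs p)" "\<not> rl ?G (e(y := v)) q (ap (pfst (dfl ?cN)) q)"
        unfolding rl_Neg[of ?G] chN by blast
      have qc: "q \<in> Car ?cG" using q(1) qs by blast
      have rG: "ap (pfst (dfl ?cN)) q \<in> Car ?rG"
        by (rule ap_in[OF pfst_in[OF dfl_in] qc])
      from q(2) obtain d where d: "d \<in> Car ?s" "d \<in> set (elems (ap (pfst q) (num 0)))"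
        "\<not> rl A (e(y := v, z := d)) (psnd q) (psnd (ap (pfst (dfl ?cN)) q))"
        by (rule not_rl_ForallStE)
      have "d \<in> set (?L p)" using d(2) q(1) unfolding set_concat set_map by blast
      then have "sat A (e(y := v, z := d))" by (rule v')
      moreover have "rl A (e(y := v, z := d)) (psnd q) (psnd (ap (pfst (dfl ?cN)) q)) = sat A (e(y := v, z := d))"
        by (rule rl_internal[OF A psnd_in[OF qc] psnd_in[OF rG]])
      ultimately show False using d(3) by blast
    qed
  qed
qed

text \<open>\<open>ExistsSt\<close> unfolds to nested negations, so a response reaches candidates
  for \<open>y\<close> only through two layers of lists of challenges. The strategies contained in
  these are run on default challenges, and all elements that they list are collected.\<close>

definition wits :: "var \<Rightarrow> fm \<Rightarrow> elt \<Rightarrow> elt list" where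
  "wits y A r = concat (map (\<lambda>a. concat (map (\<lambda>b. elems (ap (pfst b) (num 0)))
      (dfl (chal (St (Var y) \<^bold>\<longrightarrow> Neg A)) # elems (pfst (ap (pfst a) (dfl (chal (St (Var y) \<^bold>\<and> A))))))))
     (dfl (chal (Neg (St (Var y) \<^bold>\<and> A))) # elems (pfst r)))"

lemma dfnl_wits:
  assumes "dfn \<rho> (resp (ExistsSt y A)) R"
  shows "dfnl \<rho> (emb (snd y)) (\<lambda>p. wits y A (R p))"
proof -
  note R = assms[unfolded chal_simps resp_simps ty_of.simps]
  show ?thesis unfolding wits_def chal_simps resp_simps ty_of.simps
    by (rule dfnl_concat_map dfnl_Cons dfn_const[OF dfl_in] dfnl_elems dfn_pfst R dfn_rules)+
qed

text \<open>Each negation turns a failed test into an entry of a list. Following these entries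
  inwards ends at a strategy for \<open>St\<close> that lists the witness; the matrix is internal,
  so its realizability is truth.\<close>

lemma ExistsSt_elim:
  assumes A: "internal A" and r: "r \<in> Car (resp (ExistsSt y A))"
    and rl: "rl (ExistsSt y A) e (dfl (chal (ExistsSt y A))) r"
  shows "\<exists>d\<in>Car (emb (snd y)). d \<in> set (wits y A r) \<and> sat A (e(y := d))"
proof -
  let ?D = "St (Var y) \<^bold>\<longrightarrow> Neg A" and ?C = "St (Var y) \<^bold>\<and> A" and ?N = "Forall y (Neg (St (Var y) \<^bold>\<and> A))"
  have cN: "chal ?N = chal (Neg ?C)" by simp
  have l: "set (dfl (chal (Neg ?C)) # elems (pfst r)) \<subseteq> Car (chal (Neg ?C))"
    using r elems_in[of "pfst r" "chal (Neg ?C)"] by auto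
  from rl obtain a where a: "a \<in> set (dfl (chal (Neg ?C)) # elems (pfst r))"
    "\<not> rl ?N e a (ap (pfst (dfl (chal (ExistsSt y A)))) a)"
    unfolding rl_Neg[of ?N] cN by blast
  have ac: "a \<in> Car (chal (Neg ?C))" using a l by blast
  have "ap (pfst (dfl (chal (ExistsSt y A)))) a = dfl (resp (Neg ?C))" using ac by simp
  with a(2) obtain d where d: "d \<in> Car (emb (snd y))" "\<not> rl (Neg ?C) (e(y := d)) a (dfl (resp (Neg ?C)))"
    unfolding rl.simps(5) by auto
  have "rl ?C (e(y := d)) (dfl (chal ?C)) (ap (pfst a) (dfl (chal ?C)))"
    using d(2) unfolding rl_Neg[of ?C] not_not by (rule bspec) (rule list.set_intros(1))
  then obtain b where b: "b \<in> set (dfl (chal ?D) # elems (pfst (ap (pfst a) (dfl (chal ?C)))))"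
    "\<not> rl ?D (e(y := d)) b (ap (pfst (dfl (chal ?C))) b)"
    unfolding rl_Neg[of ?D] by blast
  have "pfst a \<in> Car (chal ?C \<Rrightarrow> resp ?C)" using ac by auto
  from ap_in[OF this dfl_in] have "pfst (ap (pfst a) (dfl (chal ?C))) \<in> Car (USeq (chal ?D))" by auto
  from elems_in[OF this] b(1) dfl_in[of "chal ?D"] have bc: "b \<in> Car (chal ?D)"
    unfolding list.set by blast
  then have "ap (pfst (dfl (chal ?C))) b = dfl (resp ?D)" by simp
  note n = b(2)[unfolded this rl.simps(4)[of "St (Var y)"] not_imp]
  from n have "\<forall>a\<in>set (dfl (chal (St (Var y))) # elems (pfst (dfl (resp ?D)))). rl (St (Var y)) (e(y := d)) a (ap (pfst b) a)"
    by (rule conjunct1)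
  then have "rl (St (Var y)) (e(y := d)) (dfl (chal (St (Var y)))) (ap (pfst b) (dfl (chal (St (Var y)))))"
    by (rule bspec) (rule list.set_intros(1))
  then have b2: "d \<in> set (elems (ap (pfst b) (num 0)))" by simp
  have "rl (Neg A) (e(y := d)) (psnd b) (psnd (dfl (resp ?D))) = sat (Neg A) (e(y := d))"
    by (rule rl_internal) (use A bc in auto)
  with conjunct2[OF n] have "sat A (e(y := d))" by simp
  moreover have "d \<in> set (wits y A r)"
    unfolding wits_def by (rule in_concat_map[OF _ a(1)], rule in_concat_map[OF _ b(1)], rule b2)
  ultimately show ?thesis using d(1) by blast
qed

text \<open>Collecting candidates from the premise is definable, so the choice function is an
  element of the model and can itself be listed as a standard \<open>F\<close>. Its values being
  sequences, it need not be decided which candidate is right.\<close>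

lemma realizable_HAC:
  assumes A: "internal A" and F: "snd F = snd x \<leadsto> Sq (snd y)" "F \<notin> fv A" "x \<noteq> y"
  shows "realizable (ForallSt x (ExistsSt y A) \<^bold>\<longrightarrow>
    ExistsSt F (ForallSt x (Exists y (mem (Var y) (Var F \<cdot> Var x) \<^bold>\<and> A))))"
    (is "realizable (ForallSt x ?E \<^bold>\<longrightarrow> ExistsSt F (ForallSt x ?J))")
proof (rule realizableI)
  let ?B = "ForallSt x ?J" and ?P = "ForallSt x ?E"
  let ?X = "?P \<^bold>\<longrightarrow> ExistsSt F ?B"
  let ?D = "St (Var F) \<^bold>\<longrightarrow> Neg ?B" and ?C = "St (Var F) \<^bold>\<and> ?B"
  let ?N = "Forall F (Neg ?C)"
  let ?s = "emb (snd x)" and ?t = "emb (snd y)"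
  have Fty: "emb (snd F) = ?s \<Rrightarrow> USeq ?t" using F by simp
  have neq: "F \<noteq> x" "F \<noteq> y" using F(1) ty_neq(2,3) by metis+
  have iJ: "internal ?J" using A by simp
  let ?cB = "(UNat \<Rrightarrow> USeq ?s) \<otimes> chal ?J" and ?rB = "USeq UNat \<otimes> resp ?J"
  let ?cD = "(UNat \<Rrightarrow> USeq (?s \<Rrightarrow> USeq ?t)) \<otimes> ((?cB \<Rrightarrow> ?rB) \<otimes> UNat)" and ?rD = "USeq UNat \<otimes> (USeq ?cB \<otimes> UNat)"
  let ?cC = "(?cD \<Rrightarrow> ?rD) \<otimes> UNat" and ?rC = "USeq ?cD \<otimes> UNat"
  let ?cN = "(?cC \<Rrightarrow> ?rC) \<otimes> UNat" and ?rN = "USeq ?cC \<otimes> UNat"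
  let ?cP = "(UNat \<Rrightarrow> USeq ?s) \<otimes> chal ?E" and ?rP = "USeq UNat \<otimes> resp ?E"
  have ch: "chal ?X = (?cP \<Rrightarrow> ?rP) \<otimes> ((?cN \<Rrightarrow> ?rN) \<otimes> UNat)"
    "resp ?X = USeq ?cP \<otimes> (USeq ?cN \<otimes> UNat)"
    by (simp_all only: chal_simps resp_simps Fty ty_of.simps)
  have chs: "chal ?N = ?cN" "chal ?C = ?cC" "chal ?D = ?cD" "chal ?B = ?cB" "resp ?B = ?rB"
    by (simp_all only: chal_simps resp_simps Fty ty_of.simps)
  (* The choice function ?F p maps d to the list of witnesses found in the response of the premise
     to the challenge ?q d; the premise is needed only at the finitely many ?ds p. *)
  let ?cst = "\<lambda>d. ap (kE (USeq ?s) UNat) (lst [d])"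
  let ?q = "\<lambda>d. pr (?cst d) (dfl (chal ?E))"
  let ?f = "\<lambda>p d. lst (wits y A (psnd (ap (pfst p) (?q d))))"
  let ?F = "\<lambda>p. LAM ?s (USeq ?t) (?f p)"
  \<comment> \<open>\<open>?d\<close> presents the choice function as standard, and
    \<open>?W\<close> carries this through the negations in \<open>ExistsSt\<close>. Running the
    opponent's strategies on them reveals in \<open>?ds\<close> every \<open>x\<close> at which the
    choice function may be tested.\<close>
  let ?d = "\<lambda>p. pr (ap (kE (USeq (?s \<Rrightarrow> USeq ?t)) UNat) (lst [?F p])) (pr (dfl (?cB \<Rrightarrow> ?rB)) (num 0))"
  let ?W = "\<lambda>p. pr (ap (kE ?rC ?cC) (pr (lst [?d p]) (num 0))) (num 0)"
  let ?cs = "\<lambda>p. dfl ?cC # elems (pfst (ap (pfst (psnd p)) (?W p)))"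
  let ?bs = "\<lambda>p c. dfl ?cB # elems (pfst (psnd (ap (pfst c) (?d p))))"
  let ?ds = "\<lambda>p. concat (map (\<lambda>c. concat (map (\<lambda>b. elems (ap (pfst b) (num 0))) (?bs p c))) (?cs p))"
  let ?G = "\<lambda>p. pr (lst (map ?q (?ds p))) (pr (lst [?W p]) (num 0))"
  note R = dfnl_wits dfn_rules kE_in
  show "dfn (chal ?X) (resp ?X) ?G"
    unfolding ch by (rule R)+
  fix e p assume e: "e \<in> Env" and p: "p \<in> Car (chal ?X)"
  have "dfnl (chal ?X) ?s ?ds" unfolding ch by (rule R)+
  from dfnl_in[OF this p] have ds: "set (?ds p) \<subseteq> Car ?s" .
  have "dfnl (chal ?X) ?cC ?cs" unfolding ch by (rule R)+
  from dfnl_in[OF this p] have cs: "set (?cs p) \<subseteq> Car ?cC" .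
  have F_dfn: "dfn ?s (USeq ?t) (?f p)"
    by (rule dfn_lam(2)[OF _ p]) (unfold ch, (rule R)+)
  then have F_in: "?F p \<in> Car (?s \<Rrightarrow> USeq ?t)" by (rule LAM_in)
  have d_in: "?d p \<in> Car ?cD" using F_in by (auto intro!: ap_in[OF kE_in] simp del: dfl.simps)
  have W_in: "?W p \<in> Car ?cN" using d_in by (auto intro!: ap_in[OF kE_in])
  have Pp: "pfst p \<in> Car (?cP \<Rrightarrow> ?rP)" using p unfolding ch by blast
  have q_in: "?q d \<in> Car ?cP" if "d \<in> Car ?s" for d
    using that by (auto intro!: ap_in[OF kE_in])
  show "rl ?X e p (?G p)"
    unfolding rl.simps(4)[of ?P] elt.sel
  proof
    assume H: "\<forall>a\<in>set (dfl (chal ?P) # map ?q (?ds p)). rl ?P e a (ap (pfst p) a)"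
    have wit: "\<exists>v\<in>Car ?t. v \<in> set (elems (ap (?F p) d)) \<and> sat A (e(x := d, y := v))"
      if d: "d \<in> set (?ds p)" for d
    proof -
      have dc: "d \<in> Car ?s" using d ds by blast
      have r: "ap (pfst p) (?q d) \<in> Car ?rP" by (rule ap_in[OF Pp q_in[OF dc]])
      have "rl ?P e (?q d) (ap (pfst p) (?q d))"
        by (rule bspec[OF H]) (use d in \<open>unfold list.set(2) set_map, intro insertI2 imageI\<close>)
      moreover have "d \<in> set (elems (ap (pfst (?q d)) a))"
        if "a \<in> set (num 0 # elems (pfst (ap (pfst p) (?q d))))" for a
      proof -
        have "a \<in> Car UNat" using that elems_in[OF pfst_in[OF r]] by auto
        then show ?thesis using dc by simp
      qed
      ultimately have "rl ?E (e(x := d)) (psnd (?q d)) (psnd (ap (pfst p) (?q d)))"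
        using dc unfolding rl_ForallSt by blast
      then have "rl ?E (e(x := d)) (dfl (chal ?E)) (psnd (ap (pfst p) (?q d)))" by (simp only: elt.sel)
      from ExistsSt_elim[OF A psnd_in[OF r] this]
      show ?thesis by (simp only: ap_LAM[OF F_dfn dc] elt.sel)
    qed
    have J: "sat ?J (e(F := ?F p, x := d))" if d: "d \<in> set (?ds p)" for d
    proof -
      have dc: "d \<in> Car ?s" using d ds by blast
      obtain v where v: "v \<in> Car ?t" "v \<in> set (elems (ap (?F p) d))" "sat A (e(x := d, y := v))"
        using wit[OF d] by blast
      have "sat (mem (Var y) (Var F \<cdot> Var x)) (e(F := ?F p, x := d, y := v))"
        by (subst sat_mem) (use e v F_in Fty dc F neq in \<open>auto intro!: Env_upd\<close>)
      moreover have "sat A (e(F := ?F p, x := d, y := v)) = sat A (e(x := d, y := v))"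
        by (rule sat_cong) (use F in auto)
      ultimately show ?thesis using v unfolding sat.simps(1,4,5) by blast
    qed
    show "rl (ExistsSt F ?B) e (psnd p) (pr (lst [?W p]) (num 0))"
      unfolding rl_Neg[of ?N] chs
    proof
      assume H: "\<forall>a\<in>set (dfl ?cN # elems (pfst (pr (lst [?W p]) (num 0)))). rl ?N e a (ap (pfst (psnd p)) a)"
      have "rl ?N e (?W p) (ap (pfst (psnd p)) (?W p))"
        by (rule bspec[OF H]) (unfold elt.sel, rule list.set_intros(2)[OF list.set_intros(1)])
      then have "rl (Neg ?C) (e(F := ?F p)) (?W p) (ap (pfst (psnd p)) (?W p))"
        using F_in unfolding rl.simps(5) Fty by blast
      then obtain c where c: "c \<in> set (?cs p)" "\<not> rl ?C (e(F := ?F p)) c (ap (pfst (?W p)) c)"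
        unfolding rl_Neg[of ?C] chs by blast
      have cc: "c \<in> Car ?cC" using c cs by blast
      have "pr (lst [x]) (num 0) \<in> Car ?rC" if "x \<in> Car ?cD" for x using that by simp
      from this[OF d_in] have "ap (pfst (?W p)) c = pr (lst [?d p]) (num 0)"
        unfolding elt.sel using cc by (rule kE)
      with c(2) have "\<forall>a\<in>set (dfl (chal ?D) # [?d p]). rl ?D (e(F := ?F p)) a (ap (pfst c) a)"
        unfolding rl_Neg[of ?D] not_not by (simp only: elt.sel)
      then have "rl ?D (e(F := ?F p)) (?d p) (ap (pfst c) (?d p))"
        by (rule bspec) (rule list.set_intros(2)[OF list.set_intros(1)])
      moreover have Dr: "ap (pfst c) (?d p) \<in> Car ?rD" by (rule ap_in[OF pfst_in[OF cc] d_in])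
      moreover have "rl (St (Var F)) (e(F := ?F p)) a (ap (pfst (?d p)) a)"
        if "a \<in> set (dfl (chal (St (Var F))) # elems (pfst (ap (pfst c) (?d p))))" for a
      proof -
        have "a \<in> Car UNat" using that elems_in[OF pfst_in[OF Dr]] by auto
        then show ?thesis using F_in by simp
      qed
      ultimately have "rl (Neg ?B) (e(F := ?F p)) (psnd (?d p)) (psnd (ap (pfst c) (?d p)))"
        unfolding rl.simps(4)[of "St (Var F)"] by blast
      then obtain b where b: "b \<in> set (?bs p c)" "\<not> rl ?B (e(F := ?F p)) b (ap (pfst (psnd (?d p))) b)"
        unfolding rl_Neg[of ?B] chs by blast
      have "set (?bs p c) \<subseteq> Car ?cB"
        unfolding list.set insert_subset using dfl_in elems_in[OF pfst_in[OF psnd_in[OF Dr]]] by (rule conjI)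
      with b(1) have bc: "b \<in> Car ?cB" by blast
      then have bb: "ap (pfst (psnd (?d p))) b = dfl ?rB" unfolding elt.sel by (rule ap_dfl)
      from b(2) obtain d where d: "d \<in> Car ?s" "d \<in> set (elems (ap (pfst b) (num 0)))"
        "\<not> rl ?J (e(F := ?F p, x := d)) (psnd b) (psnd (dfl ?rB))"
        unfolding bb by (rule not_rl_ForallStE)
      have "d \<in> set (?ds p)" 
        by (rule in_concat_map[OF _ c(1)], rule in_concat_map[OF _ b(1)], rule d(2))
      then have "sat ?J (e(F := ?F p, x := d))" by (rule J)
      moreover have "rl ?J (e(F := ?F p, x := d)) (psnd b) (psnd (dfl ?rB)) = sat ?J (e(F := ?F p, x := d))"
        by (rule rl_internal[OF iJ psnd_in[OF bc] psnd_in[OF dfl_in]])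
      ultimately show False using d(3) by blast
    qed
  qed
qed

text \<open>A function with a zero vanishes at its value under \<open>muE\<close>, so a single
  standard position decides the matter. The opponent lists finitely many functions, among them
  \<open>f\<close>, and testing at the values of \<open>muE\<close> on all of them covers
  \<open>f\<close>.\<close>

lemma realizable_TRANS: "realizable TRANS"
proof -
  let ?f = "(0::nat, Num \<leadsto> Num)" and ?n = "(0::nat, Num)" and ?m = "(1::nat, Num)"
  let ?H = "Neg (Var ?f \<cdot> Var ?n \<doteq> zero)" and ?M = "Forall ?m (Neg (Var ?f \<cdot> Var ?m \<doteq> zero))"
  let ?A = "ForallSt ?n ?H \<^bold>\<longrightarrow> ?M"
  have T: "TRANS = ForallSt ?f ?A" by (simp add: TRANS_def Let_def)
  let ?c1 = "UNat \<Rrightarrow> UNat"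
  let ?cH = "(UNat \<Rrightarrow> USeq UNat) \<otimes> chal ?H"
  have ch: "chal TRANS = (UNat \<Rrightarrow> USeq ?c1) \<otimes> ((?cH \<Rrightarrow> USeq UNat \<otimes> resp ?H) \<otimes> chal ?M)"
    "resp TRANS = USeq UNat \<otimes> (USeq ?cH \<otimes> resp ?M)"
    unfolding T by (simp_all only: chal_simps resp_simps ty_of.simps snd_conv emb.simps)
  let ?q = "\<lambda>p. pr (ap (kE (USeq UNat) UNat) (lst (map (\<lambda>f. ap muE f) (elems (ap (pfst p) (num 0)))))) (dfl (chal ?H))"
  let ?F = "\<lambda>p. pr (lst []) (pr (lst [?q p]) (dfl (resp ?M)))"
  show ?thesis
  proof (rule realizableI)
    show "dfn (chal TRANS) (resp TRANS) ?F" unfolding ch by (rule dfn_rules kE_in muE_in)+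
    fix e p assume e: "e \<in> Env" and p: "p \<in> Car (chal TRANS)"
    have q_in: "?q p \<in> Car ?cH"
    proof -
      have "dfn (chal TRANS) ?cH ?q" unfolding ch by (rule dfn_rules kE_in muE_in)+
      from dfn_in[OF this p] show ?thesis .
    qed
    have fs: "set (elems (ap (pfst p) (num 0))) \<subseteq> Car ?c1"
      using p elems_in[OF ap_in[OF pfst_in num_in]] unfolding ch by blast
    show "rl TRANS e p (?F p)"
      unfolding T rl_ForallSt[of ?f] elt.sel
    proof (intro ballI impI)
      fix f assume f: "f \<in> Car (emb (snd ?f))"
        and "\<forall>a\<in>set [num 0]. f \<in> set (elems (ap (pfst p) a))"
      then have fin: "f \<in> set (elems (ap (pfst p) (num 0)))" by simp
      have f1: "f \<in> Car ?c1" using f by simp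
      show "rl ?A (e(?f := f)) (psnd p) (pr (lst [?q p]) (dfl (resp ?M)))"
        unfolding rl.simps(4)[of "ForallSt ?n ?H"] elt.sel
      proof
        assume "\<forall>a\<in>set (dfl (chal (ForallSt ?n ?H)) # [?q p]).
          rl (ForallSt ?n ?H) (e(?f := f)) a (ap (pfst (psnd p)) a)"
        then have H: "rl (ForallSt ?n ?H) (e(?f := f)) (?q p) (ap (pfst (psnd p)) (?q p))" by simp
        have "pfst (psnd p) \<in> Car (?cH \<Rrightarrow> USeq UNat \<otimes> resp ?H)" using p unfolding ch by blast
        from ap_in[OF this q_in] have r: "ap (pfst (psnd p)) (?q p) \<in> Car (USeq UNat \<otimes> resp ?H)" .
        have mu: "ap muE f \<in> Car UNat" by (rule ap_in[OF muE_in f1])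
        have "ap muE f \<in> set (elems (ap (pfst (?q p)) a))"
          if "a \<in> set (num 0 # elems (pfst (ap (pfst (psnd p)) (?q p))))" for a
        proof -
          have a: "a \<in> Car UNat" using that elems_in[OF pfst_in[OF r]] by auto
          have "set (map (\<lambda>f. ap muE f) (elems (ap (pfst p) (num 0)))) \<subseteq> Car UNat"
            using fs ap_in[OF muE_in] by auto
          then have "ap (pfst (?q p)) a = lst (map (\<lambda>f. ap muE f) (elems (ap (pfst p) (num 0))))"
            using a by simp
          then show ?thesis using fin by simp
        qed
        with H mu have "rl ?H (e(?f := f, ?n := ap muE f)) (psnd (?q p)) (psnd (ap (pfst (psnd p)) (?q p)))"
          unfolding rl_ForallSt[of ?n] by (simp only: snd_conv emb.simps) blast
        moreover have "rl ?H (e(?f := f, ?n := ap muE f)) (psnd (?q p)) (psnd (ap (pfst (psnd p)) (?q p)))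
            = sat ?H (e(?f := f, ?n := ap muE f))"
          by (rule rl_internal) (use r in auto)
        ultimately have nz: "ap f (ap muE f) \<noteq> num 0" by simp
        have "sat ?M (e(?f := f))"
          using muE_zero[OF f1] nz by (auto simp: Car_UNat)
        then show "rl ?M (e(?f := f)) (psnd (psnd p)) (dfl (resp ?M))"
          by (subst rl_internal) (use p in \<open>auto simp: ch\<close>)
      qed
    qed
  qed
qed

section \<open>Refutation of the standard part principle\<close>

text \<open>The challenge brings a strategy that always answers with the test \<open>Q\<close>, so
  following the failed tests inwards ends with \<open>Q\<close> answering some \<open>b\<close>. The
  list containing \<open>b\<close> is computed from \<open>r\<close> and \<open>Q\<close> alone and
  is the same in all environments.\<close>

lemma ExistsSt_challengeE:
  assumes r: "r \<in> Car (resp (ExistsSt v B))" and Q: "Q \<in> Car (chal (St (Var v) \<^bold>\<and> B))"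
    and rl: "rl (ExistsSt v B) e (pr (ap (kE (resp (Neg (St (Var v) \<^bold>\<and> B))) (chal (Neg (St (Var v) \<^bold>\<and> B))))
       (pr (lst [Q]) (num 0))) (num 0)) r"
  obtains d b where "d \<in> Car (emb (snd v))"
    "b \<in> set (concat (map (\<lambda>a. dfl (chal (St (Var v) \<^bold>\<longrightarrow> Neg B)) # elems (pfst (ap (pfst a) Q)))
       (dfl (chal (Neg (St (Var v) \<^bold>\<and> B))) # elems (pfst r))))"
    "b \<in> Car (chal (St (Var v) \<^bold>\<longrightarrow> Neg B))" "d \<in> set (elems (ap (pfst b) (num 0)))"
    "\<not> rl (Neg B) (e(v := d)) (psnd b) (psnd (ap (pfst Q) b))"
proof -
  let ?D = "St (Var v) \<^bold>\<longrightarrow> Neg B" and ?C = "St (Var v) \<^bold>\<and> B" and ?N = "Forall v (Neg (St (Var v) \<^bold>\<and> B))"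
  have cN: "chal ?N = chal (Neg ?C)" by simp
  have r': "pfst r \<in> Car (USeq (chal (Neg ?C)))" using r by auto
  have "set (dfl (chal (Neg ?C)) # elems (pfst r)) \<subseteq> Car (chal (Neg ?C))"
    unfolding list.set insert_subset using dfl_in elems_in[OF r'] by (rule conjI)
  moreover from rl obtain a where a: "a \<in> set (dfl (chal (Neg ?C)) # elems (pfst r))"
    "\<not> rl ?N e a (ap (ap (kE (resp (Neg ?C)) (chal (Neg ?C))) (pr (lst [Q]) (num 0))) a)"
    unfolding rl_Neg[of ?N] cN elt.sel by blast
  ultimately have ac: "a \<in> Car (chal (Neg ?C))" by blast
  have "pr (lst [Q]) (num 0) \<in> Car (resp (Neg ?C))" using Q by simp
  from kE[OF this ac] a(2) obtain d where d: "d \<in> Car (emb (snd v))" "\<not> rl (Neg ?C) (e(v := d)) a (pr (lst [Q]) (num 0))"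
    unfolding rl.simps(5) by auto
  have "rl ?C (e(v := d)) Q (ap (pfst a) Q)"
    using d(2) unfolding rl_Neg[of ?C] not_not elt.sel
    by (rule bspec) (rule list.set_intros(2)[OF list.set_intros(1)])
  then obtain b where b: "b \<in> set (dfl (chal ?D) # elems (pfst (ap (pfst a) Q)))"
    "\<not> rl ?D (e(v := d)) b (ap (pfst Q) b)"
    unfolding rl_Neg[of ?D] by blast
  have "pfst a \<in> Car (chal ?C \<Rrightarrow> resp ?C)" using ac by auto
  from ap_in[OF this Q] have "pfst (ap (pfst a) Q) \<in> Car (USeq (chal ?D))" by auto
  from elems_in[OF this] b(1) dfl_in[of "chal ?D"] have bc: "b \<in> Car (chal ?D)"
    unfolding list.set by blast
  note n = b(2)[unfolded rl.simps(4)[of "St (Var v)"] not_imp]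
  from n have "\<forall>x\<in>set (dfl (chal (St (Var v))) # elems (pfst (ap (pfst Q) b))). rl (St (Var v)) (e(v := d)) x (ap (pfst b) x)"
    by (rule conjunct1)
  then have "rl (St (Var v)) (e(v := d)) (dfl (chal (St (Var v)))) (ap (pfst b) (dfl (chal (St (Var v)))))"
    by (rule bspec) (rule list.set_intros(1))
  then have b2: "d \<in> set (elems (ap (pfst b) (num 0)))" by simp
  have "b \<in> set (concat (map (\<lambda>a. dfl (chal ?D) # elems (pfst (ap (pfst a) Q))) (dfl (chal (Neg ?C)) # elems (pfst r))))"
    by (rule in_concat_map[OF _ a(1)], rule b(1))
  from that[OF d(1) this bc b2 conjunct2[OF n]] show ?thesis .
qed

text \<open>By induction on the bound, \<open>h\<close> arises from its shift by prescribing the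
  value at 0. The recursor ignores its recursive value here and acts as a case distinction.\<close>

lemma ex_finite_support:
  "(\<And>n. N \<le> n \<Longrightarrow> h n = 0) \<Longrightarrow> \<exists>f\<in>Car (UNat \<Rrightarrow> UNat). \<forall>n. ap f (num n) = num (h n)"
proof (induction N arbitrary: h)
  case 0
  then show ?case by (intro bexI[of _ "ap (kE UNat UNat) (num 0)"]) auto
next
  case (Suc N)
  from Suc.IH[of "\<lambda>n. h (Suc n)"] Suc.prems obtain g where
    g: "g \<in> Car (UNat \<Rrightarrow> UNat)" "\<And>n. ap g (num n) = num (h (Suc n))" by auto
  let ?F = "\<lambda>x. rec_nat (num (h 0)) (\<lambda>k. (\<lambda>_ k _. ap g k) x (num k)) (natof x)"
  have F: "dfn UNat UNat ?F"
    by (rule dfn_rec_nat[where F = "\<lambda>_ k _. ap g k"]) (rule dfn_rules g)+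
  have "ap (LAM UNat UNat ?F) (num n) = num (h n)" for n
    by (subst ap_LAM[OF F]) (cases n; simp add: g)+
  with LAM_in[OF F] show ?case by blast
qed

lemma not_realizable_STP: "\<not> realizable STP"
proof
  assume "realizable STP"
  let ?a = "(0::nat, Num \<leadsto> Num)" and ?b = "(1::nat, Num \<leadsto> Num)" and ?n = "(0::nat, Num)"
  let ?eq = "Var ?a \<cdot> Var ?n \<doteq> Var ?b \<cdot> Var ?n"
  let ?ap = "ForallSt ?n ?eq"
  let ?A = "binary ?b \<^bold>\<longrightarrow> Neg ?ap"
  let ?B = "Neg ?A"
  let ?C = "St (Var ?b) \<^bold>\<and> ?B" and ?D = "St (Var ?b) \<^bold>\<longrightarrow> Neg ?B"
  let ?E = "ExistsSt ?b ?B"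
  have STP: "STP = Forall ?a (binary ?a \<^bold>\<longrightarrow> ?E)"
    by (simp add: STP_def approx_def Let_def)
  obtain Y where Y: "Y \<in> Car (chal STP \<Rrightarrow> resp STP)"
    "\<And>e x. e \<in> Env \<Longrightarrow> x \<in> Car (chal STP) \<Longrightarrow> rl STP e x (ap Y x)"
    using \<open>realizable STP\<close> by (rule realizableE) blast
  let ?c1 = "UNat \<Rrightarrow> UNat"
  let ?cP = "(UNat \<Rrightarrow> USeq UNat) \<otimes> UNat" and ?rP = "USeq UNat \<otimes> UNat"
  let ?cA = "(chal (binary ?b) \<Rrightarrow> resp (binary ?b)) \<otimes> ((?cP \<Rrightarrow> ?rP) \<otimes> UNat)"
  let ?rA = "USeq (chal (binary ?b)) \<otimes> (USeq ?cP \<otimes> UNat)"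
  let ?cB = "(?cA \<Rrightarrow> ?rA) \<otimes> UNat" and ?rB = "USeq ?cA \<otimes> UNat"
  let ?cD = "(UNat \<Rrightarrow> USeq ?c1) \<otimes> ((?cB \<Rrightarrow> ?rB) \<otimes> UNat)" and ?rD = "USeq UNat \<otimes> (USeq ?cB \<otimes> UNat)"
  have chs: "chal ?ap = ?cP" "resp ?ap = ?rP" "chal ?A = ?cA" "resp ?A = ?rA" "chal ?B = ?cB" "resp ?B = ?rB"
    "chal ?D = ?cD" "resp ?D = ?rD" "chal ?C = (?cD \<Rrightarrow> ?rD) \<otimes> UNat"
    by (simp_all only: chal_simps resp_simps ty_of.simps snd_conv emb.simps)
  \<comment> \<open>\<open>?ns b\<close> lists the positions \<open>orcE \<beta>\<close> for all
    \<open>\<beta>\<close> that \<open>b\<close> offers. It is presented as a list of standard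
    numbers in the challenge \<open>?p b\<close> to \<open>?ap\<close>, and the remaining terms
    carry this outwards through the negations up to the challenge \<open>?x\<close> to the whole
    principle.\<close>
  let ?ns = "\<lambda>b. lst (map (\<lambda>f. ap orcE f) (elems (ap (pfst b) (num 0))))"
  let ?p = "\<lambda>b. pr (ap (kE (USeq UNat) UNat) (?ns b)) (num 0)"
  let ?z = "\<lambda>b. pr (ap (kE ?rA ?cA) (pr (lst []) (pr (lst [?p b]) (num 0)))) (num 0)"
  let ?o = "\<lambda>b. pr (lst []) (pr (lst [?z b]) (num 0))"
  let ?Q = "pr (LAM ?cD ?rD ?o) (num 0)"
  note R = dfn_rules kE_in orcE_in
  have o: "dfn ?cD ?rD ?o" by (rule R)+
  have ns: "dfn ?cD (USeq UNat) ?ns" by (rule R)+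
  have pdfn: "dfn ?cD ?cP ?p" by (rule R)+
  have zdfn: "dfn ?cD ?cB ?z" by (rule R)+
  have Q: "?Q \<in> Car (chal ?C)" unfolding chs pr_in_iff using LAM_in[OF o] num_in by (rule conjI)
  let ?w = "pr (ap (kE (resp (Neg ?C)) (chal (Neg ?C))) (pr (lst [?Q]) (num 0))) (num 0)"
  let ?x = "pr (dfl (chal (binary ?a) \<Rrightarrow> resp (binary ?a))) ?w"
  have w: "?w \<in> Car (chal ?E)"
  proof -
    have "pr (lst [q]) (num 0) \<in> Car (resp (Neg ?C))" if "q \<in> Car (chal ?C)" for q
      using that by (simp only: resp_simps) simp
    from ap_in[OF kE_in this[OF Q]] show ?thesis
      unfolding chal_simps(4)[of "Forall ?b (Neg ?C)"] chal_simps(1) chal_simps(5) resp_simps(5) pr_in_iff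
      using num_in by (rule conjI)
  qed
  have x: "?x \<in> Car (chal STP)"
    unfolding STP chal_simps(5) chal_simps(4)[of "binary ?a"] pr_in_iff using dfl_in w by (rule conjI)
  define r where "r = psnd (ap Y ?x)"
  have r: "r \<in> Car (resp ?E)"
    using psnd_in[OF ap_in[OF Y(1) x, unfolded STP resp_simps(5) resp_simps(4)[of "binary ?a"]]]
    unfolding r_def .
  define bs where "bs = concat (map (\<lambda>a. dfl (chal ?D) # elems (pfst (ap (pfst a) ?Q)))
       (dfl (chal (Neg ?C)) # elems (pfst r)))"
  \<comment> \<open>Neither \<open>?x\<close> nor \<open>r\<close> mentions \<open>\<alpha>\<close>,
    so these finitely many candidates serve for all \<open>\<alpha>\<close> at once.\<close>
  define Bs where "Bs = (\<Union>b\<in>set bs. set (elems (ap (pfst b) (num 0))))"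
  have key: "\<exists>\<beta>\<in>Car ?c1. \<beta> \<in> Bs \<and> ap \<alpha> (ap orcE \<beta>) = ap \<beta> (ap orcE \<beta>)"
    if \<alpha>: "\<alpha> \<in> Car ?c1" "\<And>n. ap \<alpha> (num n) = num (h n)" "\<And>n. h n \<le> 1" for \<alpha> h
  proof -
    obtain e0 where e0: "e0 \<in> Env" using ex_Env by blast
    let ?e = "e0(?a := \<alpha>)"
    have e: "?e \<in> Env" using e0 \<alpha>(1) by (intro Env_upd) simp_all
    have bin: "sat (binary ?a) ?e"
    proof -
      have "sat (le_fm (Var ?a \<cdot> Var ?n) (suc zero)) (?e(?n := num n))" for n
        by (subst sat_le[where m = "h n" and n = 1]) (use e \<alpha> in \<open>auto intro!: Env_upd\<close>)
      then show ?thesis by (simp add: binary_def Let_def Car_UNat)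
    qed
    have ib: "internal (binary v)" for v by (simp add: binary_def Let_def)
    have "rl STP e0 ?x (ap Y ?x)" by (rule Y(2)[OF e0 x])
    then have "rl (binary ?a \<^bold>\<longrightarrow> ?E) ?e ?x (ap Y ?x)"
      unfolding STP rl.simps(5) by (rule bspec) (use \<alpha>(1) in simp)
    moreover have "rl (binary ?a) ?e c (ap (pfst ?x) c)"
      if "c \<in> set (dfl (chal (binary ?a)) # elems (pfst (ap Y ?x)))" for c
    proof -
      have "pfst (ap Y ?x) \<in> Car (USeq (chal (binary ?a)))"
        by (rule pfst_in[OF ap_in[OF Y(1) x, unfolded STP resp_simps(5) resp_simps(4)[of "binary ?a"]]])
      from elems_in[OF this] that dfl_in have "c \<in> Car (chal (binary ?a))" unfolding list.set by blast
      then show ?thesis unfolding elt.sel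
        by (subst rl_internal[OF ib]) (use bin in \<open>auto intro!: ap_in[OF dfl_in] simp del: dfl.simps\<close>)
    qed
    ultimately have "rl ?E ?e (psnd ?x) (psnd (ap Y ?x))"
      unfolding rl.simps(4)[of "binary ?a"] by blast
    then have "rl ?E ?e ?w r" unfolding r_def elt.sel .
    from ExistsSt_challengeE[OF r Q this] obtain \<beta> b where b: "\<beta> \<in> Car (emb (snd ?b))" "b \<in> set bs"
      "b \<in> Car (chal ?D)" "\<beta> \<in> set (elems (ap (pfst b) (num 0)))"
      "\<not> rl (Neg ?B) (?e(?b := \<beta>)) (psnd b) (psnd (ap (pfst ?Q) b))"
      unfolding bs_def[symmetric] by blast
    let ?e' = "?e(?b := \<beta>)"
    have bc: "b \<in> Car ?cD" using b(3) unfolding chs .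
    have \<beta>: "\<beta> \<in> Car ?c1" using b(1) by simp
    note b5 = b(5)[unfolded rl_Neg[of ?B] not_not elt.sel ap_LAM[OF o bc]]
    have "rl ?B ?e' (?z b) (ap (pfst (psnd b)) (?z b))"
      by (rule bspec[OF b5]) (rule list.set_intros(2)[OF list.set_intros(1)])
    then obtain t where t: "t \<in> set (dfl (chal ?A) # elems (pfst (ap (pfst (psnd b)) (?z b))))"
      "\<not> rl ?A ?e' t (ap (pfst (?z b)) t)"
      unfolding rl_Neg[of ?A] by blast
    have "pfst (ap (pfst (psnd b)) (?z b)) \<in> Car (USeq ?cA)"
      by (rule pfst_in[OF ap_in[OF pfst_in[OF psnd_in[OF bc]] dfn_in[OF zdfn bc]]])
    from elems_in[OF this] t(1) dfl_in have tc: "t \<in> Car ?cA" unfolding chs list.set by blast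
    have "pr (lst []) (pr (lst [q]) (num 0)) \<in> Car ?rA" if "q \<in> Car ?cP" for q using that by simp
    from kE[OF this[OF dfn_in[OF pdfn bc]] tc]
    have "ap (pfst (?z b)) t = pr (lst []) (pr (lst [?p b]) (num 0))" unfolding elt.sel .
    note t2 = t(2)[unfolded this rl.simps(4)[of "binary ?b"] not_imp]
    note t3 = conjunct2[OF t2, unfolded rl_Neg[of ?ap] not_not elt.sel]
    have "rl ?ap ?e' (?p b) (ap (pfst (psnd t)) (?p b))"
      by (rule bspec[OF t3]) (rule list.set_intros(2)[OF list.set_intros(1)])
    moreover have oin: "ap (pfst (psnd t)) (?p b) \<in> Car ?rP"
      by (rule ap_in[OF pfst_in[OF psnd_in[OF tc]] dfn_in[OF pdfn bc]])
    moreover have orc: "ap orcE \<beta> \<in> Car UNat" by (rule ap_in[OF orcE_in \<beta>])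
    moreover have "ap orcE \<beta> \<in> set (elems (ap (pfst (?p b)) c))"
      if "c \<in> set (num 0 # elems (pfst (ap (pfst (psnd t)) (?p b))))" for c
    proof -
      have "c \<in> Car UNat" using that elems_in[OF pfst_in[OF oin]] num_in unfolding list.set by blast
      from kE[OF dfn_in[OF ns bc] this] show ?thesis using b(4) unfolding elt.sel by simp
    qed
    ultimately have "rl ?eq (?e'(?n := ap orcE \<beta>)) (psnd (?p b)) (psnd (ap (pfst (psnd t)) (?p b)))"
      unfolding rl_ForallSt[of ?n] snd_conv emb.simps by blast
    then have "ap \<alpha> (ap orcE \<beta>) = ap \<beta> (ap orcE \<beta>)" by simp
    moreover have "\<beta> \<in> Bs" using b(2,4) unfolding Bs_def by blast
    ultimately show ?thesis using \<beta> by blast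
  qed
  \<comment> \<open>The diagonal: \<open>h\<close> is 1 at the position of a candidate that vanishes
    there, and 0 elsewhere. At \<open>orcE \<beta>\<close> this differs from the value of
    \<open>\<beta>\<close>, because by injectivity no other candidate has the same position.\<close>
  define h :: "nat \<Rightarrow> nat" where
    "h n = (if \<exists>\<beta>\<in>Bs \<inter> Car ?c1. ap orcE \<beta> = num n \<and> ap \<beta> (num n) = num 0 then 1 else 0)" for n
  have fin: "finite ((\<lambda>\<beta>. natof (ap orcE \<beta>)) ` Bs)" by (simp add: Bs_def)
  \<comment> \<open>Only positions of candidates can carry the value 1, so \<open>h\<close> has
    finite support and is a function of the model.\<close>
  have "h n = 0" if "Suc (Max ((\<lambda>\<beta>. natof (ap orcE \<beta>)) ` Bs)) \<le> n" for n
  proof (rule ccontr)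
    assume "h n \<noteq> 0"
    then obtain \<beta> where "\<beta> \<in> Bs" "ap orcE \<beta> = num n" by (auto simp: h_def split: if_splits)
    then have "n \<in> (\<lambda>\<beta>. natof (ap orcE \<beta>)) ` Bs" by force
    from Max_ge[OF fin this] that show False by simp
  qed
  from ex_finite_support[OF this] obtain \<alpha> where
    \<alpha>: "\<alpha> \<in> Car ?c1" and \<alpha>h: "\<forall>n. ap \<alpha> (num n) = num (h n)" by (rule bexE)
  have "h n \<le> 1" for n by (simp add: h_def)
  from key[OF \<alpha> spec[OF \<alpha>h] this] obtain \<beta> where
    \<beta>: "\<beta> \<in> Car ?c1" "\<beta> \<in> Bs \<and> ap \<alpha> (ap orcE \<beta>) = ap \<beta> (ap orcE \<beta>)" by (rule bexE)
  obtain n where n: "ap orcE \<beta> = num n" using ap_in[OF orcE_in \<beta>(1)] by (auto simp: Car_UNat)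
  have v: "ap \<beta> (num n) = num (h n)" using \<beta>(2) \<alpha>h n by simp
  show False
  proof (cases "h n = 0")
    case True
    then have "\<exists>\<beta>\<in>Bs \<inter> Car ?c1. ap orcE \<beta> = num n \<and> ap \<beta> (num n) = num 0"
      using v n \<beta> by (intro bexI[of _ \<beta>]) simp_all
    then have "h n = 1" by (simp only: h_def if_True)
    with True show False by simp
  next
    case False
    then obtain \<beta>' where b': "\<beta>' \<in> Car ?c1" "ap orcE \<beta>' = num n" "ap \<beta>' (num n) = num 0"
      by (auto simp: h_def split: if_splits)
    then have "\<beta>' = \<beta>" using orcE_inj \<beta>(1) n by metis
    with b'(3) v False show False by simp
  qed
qed

section \<open>Soundness and conclusion\<close>

lemma realizable_SysP: "A \<in> SysP \<Longrightarrow> wf_fm A \<Longrightarrow> realizable A"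
proof (induction rule: SysP.induct)
  case (EPA A)
  then show ?case by (intro realizable_EPA)
next
  case (St_eq s t)
  then show ?case by (rule realizable_St_eq)
next
  case (St_closed t)
  then show ?case by (intro realizable_St_closed) simp_all
next
  case (St_App f t)
  then show ?case by (rule realizable_St_App)
next
  case (ext_induct n A)
  then show ?case by (intro realizable_ext_induct)
next
  case (Idealisation A x z y)
  then show ?case by (intro realizable_Idealisation)
next
  case (HAC_int A F x y)
  then show ?case by (intro realizable_HAC)
qed

lemma realizable_derivable:
  assumes "SysP \<union> {TRANS} \<turnstile> A"
  shows "realizable A"
  using assms
proof induction
  case (Axiom A)
  then show ?case using realizable_SysP realizable_TRANS by auto
next
  case (Inst A t x)
  then show ?case by (intro realizable_Inst)
qed (auto intro: realizable_ImpK realizable_ImpS realizable_DNeg realizable_AllImp realizable_Gen realizable_MP)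

theorem theorem4p5:
  assumes "consistent (SysP \<union> {TRANS})"
  shows "\<not> (SysP \<union> {TRANS} \<turnstile> STP)"
  using realizable_derivable not_realizable_STP by blast

end
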